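(* Assume the following symmetry conditions: all base stations have the same power $P_m=P>0$; $B$ divides $A$, and with $A'=A/B$ the $B\times A$ matrix $\beta=(\beta_{m,k})$ ($\beta_{m,k}>0$) splits into $A'$ consecutive column blocks of size $B\times B$ (block $b$ consisting of columns $(b-1)B+1,\dots,bB$), each of which is strongly symmetric, i.e. every row of the block is a permutation of its first row and every column is a permutation of its first column; and the weights are constant on blocks, $W_k=W'_b$ for $k$ in block $b$, with $0\le W'_1\le\dots\le W'_{A'}$. For $\lambda=(\lambda_1,\dots,\lambda_B)>0$ and $Q_1,\dots,Q_A\ge0$ let $$F^\infty_\lambda(Q_1,\dots,Q_A)=\lim_{N\to\infty}\sum_{b=1}^{A'}\frac{\Delta'_b}{N}\,\mathbb{E}\left[\log\left|I+\Sigma(\lambda)^{-1}\widetilde H_{(b-1)B+1:A}\,\mathbf{Q}_{(b-1)B+1:A}\,\widetilde H_{(b-1)B+1:A}^H\right|\right]$$ (assumed to exist), and $G(\lambda)=\max\{F^\infty_\lambda(Q_1,\dots,Q_A): Q_k\ge0,\ \sum_kQ_k\le\sum_m\lambda_mP_m\}$. Then the minimization of $G(\lambda)$ over $\lambda>0$ (normalized without loss of generality so that $\frac1B\sum_m\lambda_m=1$, since $G$ is invariant to a common scaling of $\lambda$) is achieved at $\lambda_m=1$ for all $m=1,\dots,B$; i.e., in the large-system limit, the min-max weighted sum rate problem with per-base-station power constraints $P$ has the same solution as with the cluster sum-power constraint $\sum_kQ_k\le BP$.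
   Context: Cluster model: $B$ base stations with $\gamma N$ antennas each ($\gamma>0$ fixed, $\gamma N\in\mathbb{Z}$) and $A$ user groups of $N$ users each. $\widetilde H$ is the $\gamma BN\times AN$ random matrix whose $(m,k)$ block ($\gamma N\times N$) is $\beta_{m,k}H_{m,k}$, all entries of all $H_{m,k}$ i.i.d. $\mathcal{CN}(0,1)$; $\widetilde H_k$ is its $k$-th block column and $\widetilde H_{c:A}=[\widetilde H_c,\dots,\widetilde H_A]$. $\mathbf{Q}_{c:A}=\frac1N\operatorname{diag}(Q_cI_N,\dots,Q_AI_N)$ (equal per-user power $Q_k/N$ in group $k$). $\Sigma(\lambda)$ is the block-diagonal matrix with diagonal blocks $\lambda_mI_{\gamma N}$, $m=1,\dots,B$. $\Delta'_b=W'_b-W'_{b-1}$ with $W'_0=0$. The user groups are enumerated so that the weights are nondecreasing in the group index. *)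

theory Defs
  imports "HOL-Probability.Probability" "HOL-Combinatorics.Permutations"
    "Jordan_Normal_Form.Determinant"
begin

definition CN01 :: "complex measure" where
  "CN01 = density lborel (\<lambda>z. ennreal (exp (- ((cmod z)\<^sup>2)) / pi))"

text \<open>Number of antennas per base station, gamma N (an integer along the limit filter).\<close>
definition ant :: "real \<Rightarrow> nat \<Rightarrow> nat" where
  "ant \<gamma> N = nat \<lfloor>\<gamma> * real N\<rfloor>"

text \<open>Index set of the i.i.d. entries: (m,k,j,i) is entry (j,i) of H_{m,k} (0-based).\<close>
definition idx :: "nat \<Rightarrow> nat \<Rightarrow> nat \<Rightarrow> nat \<Rightarrow> (nat \<times> nat \<times> nat \<times> nat) set" where
  "idx B A M N = {(m,k,j,i). m < B \<and> k < A \<and> j < M \<and> i < N}"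

text \<open>Entry (r,c) of the matrix H-tilde (0-based), row r = m*M+j, column c = k*N+i.\<close>
definition Hent :: "(nat \<Rightarrow> nat \<Rightarrow> real) \<Rightarrow> nat \<Rightarrow> nat \<Rightarrow>
    (nat \<times> nat \<times> nat \<times> nat \<Rightarrow> complex) \<Rightarrow> nat \<Rightarrow> nat \<Rightarrow> complex" where
  "Hent \<beta> M N \<omega> r c =
     complex_of_real (\<beta> (r div M) (c div N)) * \<omega> (r div M, c div N, r mod M, c mod N)"

text \<open>log | I + Sigma(lam)^{-1} Ht_{c:A} Q_{c:A} Ht_{c:A}^H |, with groups c..A-1 (0-based).\<close>
definition logdet :: "(nat \<Rightarrow> nat \<Rightarrow> real) \<Rightarrow> nat \<Rightarrow> nat \<Rightarrow> nat \<Rightarrow> nat \<Rightarrow>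
    (nat \<Rightarrow> real) \<Rightarrow> (nat \<Rightarrow> real) \<Rightarrow> nat \<Rightarrow> (nat \<times> nat \<times> nat \<times> nat \<Rightarrow> complex) \<Rightarrow> real" where
  "logdet \<beta> B A M N lam Q c \<omega> =
     ln (cmod (det (mat (B * M) (B * M) (\<lambda>(r, s).
        (if r = s then 1 else 0) +
        (1 / complex_of_real (lam (r div M))) *
        (\<Sum>col \<in> {c * N..<A * N}.
           Hent \<beta> M N \<omega> r col * complex_of_real (Q (col div N) / real N)
             * cnj (Hent \<beta> M N \<omega> s col))))))"

text \<open>Finite-N objective; W' indexed 1..A', Delta'_b = W'_b - W'_{b-1}, W'_0 = 0.\<close>
definition FN :: "real \<Rightarrow> nat \<Rightarrow> nat \<Rightarrow> (nat \<Rightarrow> nat \<Rightarrow> real) \<Rightarrow> (nat \<Rightarrow> real) \<Rightarrow>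
    (nat \<Rightarrow> real) \<Rightarrow> (nat \<Rightarrow> real) \<Rightarrow> nat \<Rightarrow> real" where
  "FN \<gamma> B A \<beta> W' lam Q N =
     (\<Sum>b\<in>{1..A div B}.
        ((W' b - (if b = 1 then 0 else W' (b - 1))) / real N) *
        (\<integral>\<omega>. logdet \<beta> B A (ant \<gamma> N) N lam Q ((b - 1) * B) \<omega>
           \<partial>(PiM (idx B A (ant \<gamma> N) N) (\<lambda>_. CN01))))"

definition Nfilter :: "real \<Rightarrow> nat filter" where
  "Nfilter \<gamma> = inf sequentially (principal {N. \<gamma> * real N \<in> \<nat>})"

definition strongly_symmetric_blocks :: "nat \<Rightarrow> nat \<Rightarrow> (nat \<Rightarrow> nat \<Rightarrow> real) \<Rightarrow> bool" where
  "strongly_symmetric_blocks B A' \<beta> \<longleftrightarrow>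
     (\<forall>b<A'.
        (\<forall>m<B. \<exists>\<sigma>. \<sigma> permutes {0..<B} \<and> (\<forall>j<B. \<beta> m (b * B + j) = \<beta> 0 (b * B + \<sigma> j))) \<and>
        (\<forall>j<B. \<exists>\<sigma>. \<sigma> permutes {0..<B} \<and> (\<forall>m<B. \<beta> m (b * B + j) = \<beta> (\<sigma> m) (b * B))))"

definition Gval :: "((nat \<Rightarrow> real) \<Rightarrow> (nat \<Rightarrow> real) \<Rightarrow> real) \<Rightarrow> nat \<Rightarrow> nat \<Rightarrow> real \<Rightarrow>
    (nat \<Rightarrow> real) \<Rightarrow> real" where
  "Gval Finf B A P lam =
     (SUP Q \<in> {Q. (\<forall>k<A. 0 \<le> Q k) \<and> (\<Sum>k<A. Q k) \<le> (\<Sum>m<B. lam m * P)}. Finf lam Q)"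

end

theory Submission
  imports Defs "Jordan_Normal_Form.Schur_Decomposition"
begin

text \<open>
  With \<open>P = I + X X\<^sup>*\<close> and \<open>G = P\<^sup>-\<^sup>1\<close>, the function \<open>ln det (I + D X X\<^sup>*)\<close> is convex in \<open>ln D\<close>
  (its principal-minor expansion is a sum of exponentials with nonnegative weights) and concave in
  the column powers, so both inequalities of the saddle point \<open>(\<lambda>, Q) = (1, block average of Q)\<close>
  follow from tangent inequalities at that single point. The gradients are the partial traces of
  \<open>G\<close> over the antennas of a base station and of \<open>(I + X\<^sup>* X)\<^sup>-\<^sup>1\<close> over the users of a group.
  Gaussian integration by parts together with an Efron--Stein variance bound shows that the
  normalised expected traces satisfy, up to an error of order \<open>N\<^sup>-\<^sup>1\<^sup>/\<^sup>2\<close>, the fixed-point equations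
  \<open>a m (1 + \<Sum>\<^sub>k S m k v k) = \<gamma>\<close> and \<open>v k (1 + \<Sum>\<^sub>m S m k a m) = 1\<close> of the variance profile \<open>S\<close>.
  Strong symmetry makes the row and column sums of \<open>S\<close> constant on blocks, and the equations are
  stable enough to force all \<open>a m\<close> to be asymptotically equal and the \<open>v k\<close> to be asymptotically
  constant on blocks. Hence the gradients vanish in the directions that preserve \<open>\<Sum>\<^sub>m \<lambda> m\<close> and
  the power of each block.
\<close>

section \<open>Determinants and inverses\<close>

text \<open>Strong symmetry need not supply a group of row and column permutations that leaves the
  whole gain matrix invariant: the permutations may differ from row to row and from block to block.
  What survives is that sums over the rows, and over the columns, of one block agree, and such sums
  enter only through the fixed-point equations; so the comparison holds up to an error that vanishes
  as N grows. With \<open>Q'\<close> the block average of \<open>Q\<close>, the chain is F(1, Q)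
  \<le> F(1, Q') \<le> F(lam, Q') in the limit, from concavity and convexity respectively. The
  normalisation of \<open>lam\<close> is used twice: it makes the two power budgets equal, so that
  \<open>Q'\<close> is feasible for \<open>lam\<close>, and it forces the sum of
  \<open>ln (lam m)\<close> to be at most 0, which fixes the sign of the second step. Neither the
  fixed point nor the limit \<open>Finf\<close> is ever computed: only approximate equality of the
  gradient components matters, and for this stability of the equations is enough.\<close>

abbreviation fmat :: "nat \<Rightarrow> (nat \<Rightarrow> nat \<Rightarrow> complex) \<Rightarrow> complex mat" where
  "fmat n P \<equiv> mat n n (\<lambda>(r, s). P r s)"

lemma det_fmat_eq_sum:
  "det (fmat n f) = (\<Sum>p\<in>{p. p permutes {0..<n}}. signof p * (\<Prod>r = 0..<n. f r (p r)))"
proof -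
  have "(\<Prod>r = 0..<n. fmat n f $$ (r, p r)) = (\<Prod>r = 0..<n. f r (p r))"
    if "p permutes {0..<n}" for p
    using permutes_in_image[OF that] by (intro prod.cong) auto
  then show ?thesis by (subst det_def'[of _ n]) auto
qed

lemma det_add_expand:
  "det (fmat n (\<lambda>r s. a r s + b r s)) =
     (\<Sum>S\<in>Pow {..<n}. det (fmat n (\<lambda>r s. if r \<in> S then b r s else a r s)))"
proof -
  have inner: "(\<Prod>r = 0..<n. a r (p r) + b r (p r)) =
      (\<Sum>S\<in>Pow {..<n}. \<Prod>r = 0..<n. if r \<in> S then b r (p r) else a r (p r))" for p
  proof -
    have "(\<Prod>r\<in>{..<n}. b r (p r) + a r (p r)) =
        (\<Sum>S\<in>Pow {..<n}. (\<Prod>r\<in>S. b r (p r)) * (\<Prod>r\<in>{..<n} - S. a r (p r)))"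
      by (rule prod_add) simp
    also have "\<dots> = (\<Sum>S\<in>Pow {..<n}. \<Prod>r\<in>{..<n}. if r \<in> S then b r (p r) else a r (p r))"
    proof (rule sum.cong[OF refl])
      fix S assume S: "S \<in> Pow {..<n}"
      have "(\<Prod>r\<in>{..<n}. if r \<in> S then b r (p r) else a r (p r)) =
          (\<Prod>r\<in>{..<n} \<inter> S. b r (p r)) * (\<Prod>r\<in>{..<n} \<inter> - S. a r (p r))"
        by (subst prod.If_cases) auto
      moreover have "{..<n} \<inter> S = S" "{..<n} \<inter> - S = {..<n} - S" using S by auto
      ultimately show "(\<Prod>r\<in>S. b r (p r)) * (\<Prod>r\<in>{..<n} - S. a r (p r)) =
          (\<Prod>r\<in>{..<n}. if r \<in> S then b r (p r) else a r (p r))" by simp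
    qed
    finally show ?thesis by (simp add: lessThan_atLeast0 add.commute)
  qed
  show ?thesis
    unfolding det_fmat_eq_sum
    by (subst sum.swap) (simp add: inner sum_distrib_left)
qed

text \<open>Matrix determinant lemma. The bordered matrix \<open>?F\<close> is factored in two ways,
  once with Schur complement \<open>?PU\<close> and once with the scalar Schur complement
  \<open>?k\<close>; comparing determinants gives the formula.\<close>

lemma det_rank_one_update:
  assumes inv: "\<And>r t. r < n \<Longrightarrow> t < n \<Longrightarrow> (\<Sum>s<n. P r s * G s t) = of_bool (r = t)"
  shows "det (fmat n (\<lambda>r s. P r s + u r * v s)) =
     det (fmat n P) * (1 + (\<Sum>r<n. \<Sum>s<n. v r * G r s * u s))"
proof -
  let ?P = "fmat n P" and ?G = "fmat n G"
  let ?U = "mat n 1 (\<lambda>(r, s). u r)" and ?V = "mat 1 n (\<lambda>(r, s). v s)"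
  let ?PU = "fmat n (\<lambda>r s. P r s + u r * v s)"
  let ?k = "mat 1 1 (\<lambda>_. 1 + (\<Sum>r<n. \<Sum>s<n. v r * G r s * u s))"
  have PU: "?PU = ?P + ?U * ?V"
    by (rule eq_matI) (auto simp: scalar_prod_def)
  have PG: "?P * ?G = 1\<^sub>m n"
  proof (rule eq_matI)
    fix i j assume "i < dim_row (1\<^sub>m n)" "j < dim_col (1\<^sub>m n)"
    then show "(?P * ?G) $$ (i, j) = 1\<^sub>m n $$ (i, j)"
      using inv[of i j] by (simp add: scalar_prod_def lessThan_atLeast0)
  qed auto
  have VGU: "?V * (?G * ?U) = mat 1 1 (\<lambda>_. \<Sum>r<n. \<Sum>s<n. v r * G r s * u s)"
    by (rule eq_matI) (auto simp: scalar_prod_def lessThan_atLeast0 sum_distrib_left mult.assoc)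
  let ?F = "four_block_mat ?P ?U (- ?V) (1\<^sub>m 1)"
  have c: "?P \<in> carrier_mat n n" "?G \<in> carrier_mat n n" "?U \<in> carrier_mat n 1"
    "?V \<in> carrier_mat 1 n" "?PU \<in> carrier_mat n n" "?k \<in> carrier_mat 1 1"
    "- ?V \<in> carrier_mat 1 n" "?G * ?U \<in> carrier_mat n 1" by auto
  have z: "0\<^sub>m n 1 \<in> carrier_mat n 1" "0\<^sub>m 1 n \<in> carrier_mat 1 n"
    "1\<^sub>m n \<in> carrier_mat n n" "1\<^sub>m 1 \<in> carrier_mat 1 1" by auto
  have F1: "?F = four_block_mat (1\<^sub>m n) ?U (0\<^sub>m 1 n) (1\<^sub>m 1) * four_block_mat ?PU (0\<^sub>m n 1) (- ?V) (1\<^sub>m 1)"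
  proof -
    have "?PU + ?U * - ?V = ?P"
      by (rule eq_matI) (auto simp: scalar_prod_def)
    moreover have "1\<^sub>m n * ?PU = ?PU" "1\<^sub>m n * 0\<^sub>m n 1 + ?U * 1\<^sub>m 1 = ?U"
      "0\<^sub>m 1 n * ?PU + 1\<^sub>m 1 * - ?V = - ?V" "0\<^sub>m 1 n * 0\<^sub>m n 1 + 1\<^sub>m 1 * 1\<^sub>m 1 = (1\<^sub>m 1 :: complex mat)"
      by (auto intro!: eq_matI simp: scalar_prod_def)
    ultimately show ?thesis
      by (subst mult_four_block_mat[OF z(3) c(3) z(2) z(4) c(5) z(1) c(7) z(4)]) simp
  qed
  have F2: "?F = four_block_mat ?P (0\<^sub>m n 1) (- ?V) (1\<^sub>m 1) * four_block_mat (1\<^sub>m n) (?G * ?U) (0\<^sub>m 1 n) ?k"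
  proof -
    have "?P * (?G * ?U) = ?U"
      by (subst assoc_mult_mat[symmetric, OF c(1) c(2) c(3)]) (simp add: PG left_mult_one_mat[OF c(3)])
    then have "?P * (?G * ?U) + 0\<^sub>m n 1 * ?k = ?U"
      by (simp add: left_mult_zero_mat[OF c(6)])
    moreover have "?P * 1\<^sub>m n + 0\<^sub>m n 1 * 0\<^sub>m 1 n = ?P" "- ?V * 1\<^sub>m n + 1\<^sub>m 1 * 0\<^sub>m 1 n = - ?V"
      by (auto intro!: eq_matI simp: scalar_prod_def)
    moreover have "- ?V * (?G * ?U) + 1\<^sub>m 1 * ?k = 1\<^sub>m 1"
    proof -
      have "- ?V * (?G * ?U) = - (?V * (?G * ?U))"
        by (rule uminus_mult_left_mat) auto
      then show ?thesis
        unfolding VGU by (auto intro!: eq_matI simp: scalar_prod_def)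
    qed
    ultimately show ?thesis
      by (subst mult_four_block_mat[OF c(1) z(1) c(7) z(4) z(3) c(8) z(2) c(6)]) simp
  qed
  have "det ?F = det ?PU"
    unfolding F1
    by (subst det_mult[OF four_block_carrier_mat[OF z(3,4)] four_block_carrier_mat[OF c(5) z(4)]])
       (simp only: det_four_block_mat_upper_right_zero[OF c(5) refl c(7) z(4)]
         det_four_block_mat_lower_left_zero[OF z(3) c(3) refl z(4)] det_one mult_1_left mult_1_right)
  moreover have "det ?F = det ?P * det ?k"
    unfolding F2
    by (subst det_mult[OF four_block_carrier_mat[OF c(1) z(4)] four_block_carrier_mat[OF z(3) c(6)]])
       (simp only: det_four_block_mat_upper_right_zero[OF c(1) refl c(7) z(4)]
         det_four_block_mat_lower_left_zero[OF z(3) c(8) refl c(6)] det_one mult_1_left mult_1_right)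
  moreover have "det ?k = 1 + (\<Sum>r<n. \<Sum>s<n. v r * G r s * u s)"
    by (subst det_single) auto
  ultimately show ?thesis by simp
qed

text \<open>The adjugate formula makes every entry a quotient of polynomials in the entries of
  \<open>P\<close>, which is what measurability will use. For a singular matrix the value is 0 by
  division by zero, so the inverse laws carry a determinant hypothesis.\<close>

definition minv :: "nat \<Rightarrow> (nat \<Rightarrow> nat \<Rightarrow> complex) \<Rightarrow> nat \<Rightarrow> nat \<Rightarrow> complex" where
  "minv n P r s = adj_mat (fmat n P) $$ (r, s) / det (fmat n P)"

lemma minv_right:
  assumes d: "det (fmat n P) \<noteq> 0" and rt: "r < n" "t < n"
  shows "(\<Sum>s<n. P r s * minv n P s t) = of_bool (r = t)"
proof -
  have adj: "adj_mat (fmat n P) \<in> carrier_mat n n" by (rule adj_mat) auto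
  have "(fmat n P * adj_mat (fmat n P)) $$ (r, t) = (\<Sum>s<n. P r s * adj_mat (fmat n P) $$ (s, t))"
    using rt adj by (simp add: scalar_prod_def lessThan_atLeast0)
  moreover have "fmat n P * adj_mat (fmat n P) = det (fmat n P) \<cdot>\<^sub>m 1\<^sub>m n"
    by (rule adj_mat) auto
  ultimately have "(\<Sum>s<n. P r s * adj_mat (fmat n P) $$ (s, t)) = (det (fmat n P) \<cdot>\<^sub>m 1\<^sub>m n) $$ (r, t)"
    by simp
  then have "(\<Sum>s<n. P r s * adj_mat (fmat n P) $$ (s, t)) = det (fmat n P) * of_bool (r = t)"
    using rt by simp
  then show ?thesis using d
    by (simp add: minv_def sum_divide_distrib[symmetric] split: if_splits)
qed

lemma minv_left:
  assumes d: "det (fmat n P) \<noteq> 0" and rt: "r < n" "t < n"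
  shows "(\<Sum>s<n. minv n P r s * P s t) = of_bool (r = t)"
proof -
  have adj: "adj_mat (fmat n P) \<in> carrier_mat n n" by (rule adj_mat) auto
  have "(adj_mat (fmat n P) * fmat n P) $$ (r, t) = (\<Sum>s<n. adj_mat (fmat n P) $$ (r, s) * P s t)"
    using rt adj by (simp add: scalar_prod_def lessThan_atLeast0)
  moreover have "adj_mat (fmat n P) * fmat n P = det (fmat n P) \<cdot>\<^sub>m 1\<^sub>m n"
    by (rule adj_mat) auto
  ultimately have "(\<Sum>s<n. adj_mat (fmat n P) $$ (r, s) * P s t) = (det (fmat n P) \<cdot>\<^sub>m 1\<^sub>m n) $$ (r, t)"
    by simp
  then have "(\<Sum>s<n. adj_mat (fmat n P) $$ (r, s) * P s t) = det (fmat n P) * of_bool (r = t)"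
    using rt by simp
  then show ?thesis using d
    by (simp add: minv_def sum_divide_distrib[symmetric] split: if_splits)
qed

lemma minv_solve:
  assumes d: "det (fmat n P) \<noteq> 0" and r: "r < n"
    and h: "\<And>r. r < n \<Longrightarrow> (\<Sum>s<n. P r s * h s) = y r"
  shows "h r = (\<Sum>s<n. minv n P r s * y s)"
proof -
  have "(\<Sum>s<n. minv n P r s * y s) = (\<Sum>s<n. \<Sum>t<n. minv n P r s * P s t * h t)"
    by (intro sum.cong) (simp_all add: h[symmetric] sum_distrib_left mult.assoc)
  also have "\<dots> = (\<Sum>t<n. (\<Sum>s<n. minv n P r s * P s t) * h t)"
    by (subst sum.swap) (simp add: sum_distrib_right)
  also have "\<dots> = (\<Sum>t<n. if r = t then h t else 0)"
    using r d by (intro sum.cong) (auto simp: minv_left)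
  also have "\<dots> = h r" using r by simp
  finally show ?thesis by simp
qed

lemma minv_apply:
  assumes d: "det (fmat n P) \<noteq> 0" and r: "r < n"
  shows "(\<Sum>s<n. P r s * (\<Sum>t<n. minv n P s t * y t)) = y r"
proof -
  have "(\<Sum>s<n. P r s * (\<Sum>t<n. minv n P s t * y t)) = (\<Sum>t<n. (\<Sum>s<n. P r s * minv n P s t) * y t)"
    by (simp add: sum_distrib_left sum_distrib_right mult.assoc) (rule sum.swap)
  also have "\<dots> = (\<Sum>t<n. if r = t then y t else 0)"
    using r d by (intro sum.cong) (auto simp: minv_right)
  also have "\<dots> = y r" using r by simp
  finally show ?thesis .
qed

section \<open>The Gram matrix plus the identity\<close>

text \<open>The column set is an argument so that adding a column is \<open>insert\<close> together
  with a rank-one change, and induction over columns is induction over finite sets.\<close>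

definition gram :: "nat set \<Rightarrow> (nat \<Rightarrow> nat \<Rightarrow> complex) \<Rightarrow> nat \<Rightarrow> nat \<Rightarrow> complex" where
  "gram C X r s = (\<Sum>c\<in>C. X r c * cnj (X s c))"

text \<open>For nonnegative \<open>D\<close> this has the determinant of the symmetric form with
  square roots of \<open>D\<close> on both sides. Here \<open>D\<close> scales whole rows, and
  entries equal to 0 remain meaningful; they serve to single out principal minors.\<close>

definition id_plus :: "(nat \<Rightarrow> real) \<Rightarrow> nat set \<Rightarrow> (nat \<Rightarrow> nat \<Rightarrow> complex) \<Rightarrow> nat \<Rightarrow> nat \<Rightarrow> complex" where
  "id_plus D C X r s = of_bool (r = s) + of_real (D r) * gram C X r s"

lemma gram_insert:
  "finite C \<Longrightarrow> c \<notin> C \<Longrightarrow> gram (insert c C) X r s = gram C X r s + X r c * cnj (X s c)"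
  by (simp add: gram_def)

lemma id_plus_insert:
  "finite C \<Longrightarrow> c \<notin> C \<Longrightarrow>
    id_plus D (insert c C) X r s = id_plus D C X r s + (of_real (D r) * X r c) * cnj (X s c)"
  by (simp add: id_plus_def gram_insert algebra_simps)

lemma gram_quadratic_form:
  "(\<Sum>r<n. cnj (z r) * (\<Sum>s<n. gram C X r s * z s)) =
     of_real (\<Sum>c\<in>C. (cmod (\<Sum>r<n. cnj (X r c) * z r))\<^sup>2)"
proof -
  have "(\<Sum>r<n. cnj (z r) * (\<Sum>s<n. gram C X r s * z s)) =
      (\<Sum>r<n. \<Sum>s<n. \<Sum>c\<in>C. (cnj (z r) * X r c) * (cnj (X s c) * z s))"
    by (simp add: gram_def sum_distrib_left sum_distrib_right mult_ac)
  also have "\<dots> = (\<Sum>r<n. \<Sum>c\<in>C. \<Sum>s<n. (cnj (z r) * X r c) * (cnj (X s c) * z s))"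
    by (rule sum.cong[OF refl], rule sum.swap)
  also have "\<dots> = (\<Sum>c\<in>C. \<Sum>r<n. \<Sum>s<n. (cnj (z r) * X r c) * (cnj (X s c) * z s))"
    by (rule sum.swap)
  also have "\<dots> = (\<Sum>c\<in>C. cnj (\<Sum>r<n. cnj (X r c) * z r) * (\<Sum>r<n. cnj (X r c) * z r))"
    unfolding cnj_sum sum_product by (simp add: mult_ac)
  also have "\<dots> = of_real (\<Sum>c\<in>C. (cmod (\<Sum>r<n. cnj (X r c) * z r))\<^sup>2)"
    by (simp only: of_real_sum complex_norm_square mult.commute)
  finally show ?thesis .
qed

text \<open>\<open>x\<^sup>* (I + D K)\<^sup>-\<^sup>1 D x\<close> is a sum of squares also when \<open>D\<close> is singular.\<close>

lemma kappa_formula: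
  fixes x :: "nat \<Rightarrow> complex"
  assumes d: "det (fmat n (id_plus D C X)) \<noteq> 0"
  defines "z \<equiv> \<lambda>r. \<Sum>s<n. minv n (id_plus D C X) r s * (of_real (D s) * x s)"
  shows "(\<Sum>r<n. cnj (x r) * z r) = of_real (
      (\<Sum>r<n. D r * (cmod (x r - (\<Sum>s<n. gram C X r s * z s)))\<^sup>2) +
      (\<Sum>c\<in>C. (cmod (\<Sum>r<n. cnj (X r c) * z r))\<^sup>2))"
    and "r < n \<Longrightarrow> z r = of_real (D r) * (x r - (\<Sum>s<n. gram C X r s * z s))"
proof -
  define w where "w r = (\<Sum>s<n. gram C X r s * z s)" for r
  have z: "z r = of_real (D r) * (x r - w r)" if "r < n" for r
  proof -
    have "(\<Sum>s<n. id_plus D C X r s * z s) = of_real (D r) * x r"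
      unfolding z_def by (rule minv_apply[OF d that])
    moreover have "(\<Sum>s<n. id_plus D C X r s * z s) = (\<Sum>s<n. if s = r then z s else 0) + of_real (D r) * w r"
      unfolding w_def id_plus_def
      by (simp add: distrib_right sum.distrib sum_distrib_left mult.assoc)
    ultimately show ?thesis using that by (simp add: algebra_simps)
  qed
  show "r < n \<Longrightarrow> z r = of_real (D r) * (x r - (\<Sum>s<n. gram C X r s * z s))"
    using z unfolding w_def .
  \<comment> \<open>Since \<open>z\<close> is \<open>D\<close> times \<open>x - w\<close>, the part
    \<open>x - w\<close> of \<open>x\<close> pairs with \<open>z\<close> to weighted squares; the
    part \<open>w\<close> yields the Gram form of \<open>z\<close>.\<close>
  have "(\<Sum>r<n. cnj (x r) * z r) = (\<Sum>r<n. cnj (x r - w r) * z r + cnj (w r) * z r)"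
    by (simp add: algebra_simps)
  also have "\<dots> = (\<Sum>r<n. cnj (x r - w r) * z r) + (\<Sum>r<n. cnj (w r) * z r)"
    by (rule sum.distrib)
  also have "(\<Sum>r<n. cnj (x r - w r) * z r) = of_real (\<Sum>r<n. D r * (cmod (x r - w r))\<^sup>2)"
  proof -
    have "cnj (x r - w r) * z r = of_real (D r * (cmod (x r - w r))\<^sup>2)" if "r < n" for r
      unfolding z[OF that] of_real_mult complex_norm_square by (simp only: mult_ac)
    then show ?thesis unfolding of_real_sum by (intro sum.cong) auto
  qed
  also have "(\<Sum>r<n. cnj (w r) * z r) = cnj (\<Sum>r<n. cnj (z r) * w r)"
    by (simp add: mult.commute)
  also have "(\<Sum>r<n. cnj (z r) * w r) = of_real (\<Sum>c\<in>C. (cmod (\<Sum>r<n. cnj (X r c) * z r))\<^sup>2)"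
    unfolding w_def by (rule gram_quadratic_form)
  finally show "(\<Sum>r<n. cnj (x r) * z r) = of_real (
      (\<Sum>r<n. D r * (cmod (x r - (\<Sum>s<n. gram C X r s * z s)))\<^sup>2) +
      (\<Sum>c\<in>C. (cmod (\<Sum>r<n. cnj (X r c) * z r))\<^sup>2))"
    unfolding w_def by simp
qed

lemma det_id_plus_insert:
  assumes C: "finite C" "c \<notin> C" and d: "det (fmat n (id_plus D C X)) \<noteq> 0"
  shows "det (fmat n (id_plus D (insert c C) X)) = det (fmat n (id_plus D C X)) *
    (1 + (\<Sum>r<n. cnj (X r c) * (\<Sum>s<n. minv n (id_plus D C X) r s * (of_real (D s) * X s c))))"
proof -
  have "det (fmat n (\<lambda>r s. id_plus D C X r s + (of_real (D r) * X r c) * cnj (X s c))) =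
    det (fmat n (id_plus D C X)) * (1 + (\<Sum>r<n. \<Sum>s<n. cnj (X r c) * minv n (id_plus D C X) r s * (of_real (D s) * X s c)))"
    by (rule det_rank_one_update) (rule minv_right[OF d])
  then show ?thesis
    by (simp add: id_plus_insert[OF C] sum_distrib_left mult.assoc)
qed

text \<open>Adding a column multiplies the determinant by \<open>1 + k\<close>, where
  \<open>k\<close> is the sum of squares in \<open>kappa_formula\<close>, hence real and
  nonnegative.\<close>

lemma det_id_plus_ge_1:
  assumes "finite C" and D: "\<And>r. r < n \<Longrightarrow> D r \<ge> 0"
  shows "\<exists>\<rho>\<ge>1. det (fmat n (id_plus D C X)) = of_real \<rho>"
  using assms(1)
proof (induction C rule: finite_induct)
  case empty
  have "fmat n (id_plus D {} X) = 1\<^sub>m n"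
    by (rule eq_matI) (auto simp: id_plus_def gram_def)
  then show ?case by (intro exI[of _ 1]) simp
next
  case (insert c C)
  then obtain \<rho> where \<rho>: "\<rho> \<ge> 1" "det (fmat n (id_plus D C X)) = of_real \<rho>" by blast
  then have d: "det (fmat n (id_plus D C X)) \<noteq> 0" by simp
  let ?z = "\<lambda>r. \<Sum>s<n. minv n (id_plus D C X) r s * (of_real (D s) * X s c)"
  define k where "k = (\<Sum>r<n. D r * (cmod (X r c - (\<Sum>s<n. gram C X r s * ?z s)))\<^sup>2) +
      (\<Sum>c'\<in>C. (cmod (\<Sum>r<n. cnj (X r c') * ?z r))\<^sup>2)"
  have "det (fmat n (id_plus D (insert c C) X)) = of_real (\<rho> * (1 + k))"
    unfolding det_id_plus_insert[OF insert(1,2) d] \<rho>(2) kappa_formula(1)[OF d] k_def by simp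
  moreover have "k \<ge> 0" unfolding k_def using D by (intro add_nonneg_nonneg sum_nonneg mult_nonneg_nonneg) auto
  then have "\<rho> * (1 + k) \<ge> 1" using \<rho>(1)
    using mult_mono[of 1 \<rho> 1 "1 + k"] by simp
  ultimately show ?case by blast
qed

section \<open>Principal minors and convexity in the logarithms of the row scalings\<close>

text \<open>Rows outside \<open>S\<close> are replaced by rows of the identity, so this is the
  principal minor of the Gram matrix on \<open>S\<close> without reindexing to a smaller
  matrix.\<close>

definition minor :: "nat \<Rightarrow> nat set \<Rightarrow> (nat \<Rightarrow> nat \<Rightarrow> complex) \<Rightarrow> nat set \<Rightarrow> complex" where
  "minor n C X S = det (fmat n (\<lambda>r s. if r \<in> S then gram C X r s else of_bool (r = s)))"

lemma det_scale_rows: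
  "det (fmat n (\<lambda>r s. d r * f r s)) = (\<Prod>r<n. d r) * det (fmat n f)"
  unfolding det_fmat_eq_sum prod.distrib by (simp add: sum_distrib_left lessThan_atLeast0 mult_ac)

lemma det_id_plus_minors:
  "det (fmat n (id_plus D C X)) = (\<Sum>S\<in>Pow {..<n}. of_real (\<Prod>r\<in>S. D r) * minor n C X S)"
proof -
  have "det (fmat n (\<lambda>r s. if r \<in> S then of_real (D r) * gram C X r s else of_bool (r = s))) =
      of_real (\<Prod>r\<in>S. D r) * minor n C X S" if "S \<in> Pow {..<n}" for S
  proof -
    have "det (fmat n (\<lambda>r s. if r \<in> S then of_real (D r) * gram C X r s else of_bool (r = s))) =
        det (fmat n (\<lambda>r s. (if r \<in> S then of_real (D r) else 1) *
          (if r \<in> S then gram C X r s else of_bool (r = s))))"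
      by (intro arg_cong[where f = det] eq_matI) auto
    also have "\<dots> = (\<Prod>r<n. if r \<in> S then of_real (D r) else 1) * minor n C X S"
      unfolding det_scale_rows minor_def ..
    also have "(\<Prod>r<n. if r \<in> S then of_real (D r) else 1) = (\<Prod>r\<in>S. of_real (D r) :: complex)"
      using that by (subst prod.inter_restrict[symmetric]) (auto simp: Int_absorb1)
    finally show ?thesis by simp
  qed
  then show ?thesis unfolding id_plus_def det_add_expand by (intro sum.cong) auto
qed

text \<open>A principal minor of the Gram matrix is the leading coefficient in \<open>t\<close> of
  \<open>det (I + D K)\<close> with \<open>D\<close> equal to \<open>t\<close> on \<open>S\<close> and \<open>0\<close> elsewhere, hence nonnegative.\<close>

lemma minor_nonneg:
  assumes C: "finite C" and S: "S \<subseteq> {..<n}"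
  shows "Im (minor n C X S) = 0" "Re (minor n C X S) \<ge> 0"
proof -
  have fS: "finite S" using S finite_subset by blast
  define D where "D t r = (if r \<in> S then t else 0 :: real)" for t r
  define f where "f t = det (fmat n (id_plus (D t) C X)) / of_real (t ^ card S)" for t :: real
  have real: "Im (f t) = 0 \<and> Re (f t) \<ge> 0" if t: "t > 0" for t
  proof -
    have "\<exists>\<rho>\<ge>1. det (fmat n (id_plus (D t) C X)) = of_real \<rho>"
      using t by (intro det_id_plus_ge_1 C) (auto simp: D_def)
    then obtain \<rho> where "\<rho> \<ge> 1" "det (fmat n (id_plus (D t) C X)) = of_real \<rho>" by blast
    then have "f t = of_real (\<rho> / t ^ card S)" by (simp add: f_def)
    then show ?thesis using \<open>\<rho> \<ge> 1\<close> t by simp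
  qed
  have fsum: "f t = (\<Sum>T\<in>Pow {..<n}. of_real ((\<Prod>r\<in>T. D t r) / t ^ card S) * minor n C X T)" for t
    unfolding f_def det_id_plus_minors by (simp add: sum_divide_distrib)
  \<comment> \<open>Sets not inside \<open>S\<close> contribute 0 and proper subsets have too small
    a power of \<open>t\<close>, so only \<open>T = S\<close> survives.\<close>
  have "((\<lambda>t. (\<Prod>r\<in>T. D t r) / t ^ card S) \<longlongrightarrow> of_bool (T = S)) at_top" if T: "T \<in> Pow {..<n}" for T
  proof (cases "T \<subseteq> S")
    case False
    then obtain r where "r \<in> T" "r \<notin> S" by blast
    moreover have "finite T" using T finite_subset by blast
    ultimately have "(\<Prod>r\<in>T. D t r) = 0" for t by (subst prod_zero_iff) (auto simp: D_def)
    then show ?thesis using False by auto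
  next
    case True
    have pr: "(\<Prod>r\<in>T. D t r) = t ^ card T" for t
    proof -
      have "(\<Prod>r\<in>T. D t r) = (\<Prod>r\<in>T. t)"
        using True by (intro prod.cong) (auto simp: D_def)
      then show ?thesis by simp
    qed
    show ?thesis
    proof (cases "T = S")
      case True
      have "eventually (\<lambda>t::real. t ^ card T / t ^ card S = of_bool (T = S)) at_top"
        using eventually_gt_at_top[of 0] by eventually_elim (simp add: True)
      then show ?thesis unfolding pr by (rule tendsto_eventually)
    next
      case False
      then have less: "card T < card S" using True by (intro psubset_card_mono[OF fS]) blast
      have "((\<lambda>t::real. inverse (t ^ (card S - card T))) \<longlongrightarrow> 0) at_top"
        by (rule tendsto_inverse_0_at_top[OF filterlim_pow_at_top[OF _ filterlim_ident]]) (use less in simp)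
      moreover have "eventually (\<lambda>t::real. inverse (t ^ (card S - card T)) = t ^ card T / t ^ card S) at_top"
        using eventually_gt_at_top[of 0] by eventually_elim (use less in \<open>simp add: power_diff field_simps\<close>)
      ultimately have "((\<lambda>t::real. t ^ card T / t ^ card S) \<longlongrightarrow> 0) at_top"
        by (rule Lim_transform_eventually)
      then show ?thesis unfolding pr using False by simp
    qed
  qed
  note limT = this
  have "(f \<longlongrightarrow> (\<Sum>T\<in>Pow {..<n}. of_real (of_bool (T = S)) * minor n C X T)) at_top"
    unfolding fsum by (rule tendsto_sum) (rule tendsto_mult[OF tendsto_of_real[OF limT] tendsto_const], simp)
  moreover have "(\<Sum>T\<in>Pow {..<n}. of_real (of_bool (T = S)) * minor n C X T) =
      (\<Sum>T\<in>Pow {..<n}. if T = S then minor n C X T else 0)"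
    by (intro sum.cong) auto
  moreover have "\<dots> = minor n C X S" using S by simp
  ultimately have lim: "(f \<longlongrightarrow> minor n C X S) at_top" by simp
  have "((\<lambda>t. Im (f t)) \<longlongrightarrow> Im (minor n C X S)) at_top" using lim by (rule tendsto_Im)
  moreover have "((\<lambda>t. Im (f t)) \<longlongrightarrow> 0) at_top"
    by (rule tendsto_eventually, rule eventually_mono[OF eventually_gt_at_top[of 0]]) (use real in blast)
  ultimately show "Im (minor n C X S) = 0"
    by (rule tendsto_unique[OF trivial_limit_at_top_linorder])
  have "((\<lambda>t. Re (f t)) \<longlongrightarrow> Re (minor n C X S)) at_top" using lim by (rule tendsto_Re)
  moreover have "eventually (\<lambda>t. 0 \<le> Re (f t)) at_top"
    by (rule eventually_mono[OF eventually_gt_at_top[of 0]]) (use real in blast)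
  ultimately show "Re (minor n C X S) \<ge> 0"
    by (rule tendsto_lowerbound) simp
qed


text \<open>With \<open>D r = exp (y r)\<close> the right side is a sum of exponentials of linear
  forms with nonnegative weights, so its logarithm is convex in \<open>y\<close>.\<close>

lemma det_id_plus_weights:
  assumes C: "finite C"
  shows "det (fmat n (id_plus D C X)) = of_real (\<Sum>S\<in>Pow {..<n}. (\<Prod>r\<in>S. D r) * Re (minor n C X S))"
  unfolding det_id_plus_minors of_real_sum
proof (rule sum.cong[OF refl])
  fix S assume "S \<in> Pow {..<n}"
  then have "minor n C X S = of_real (Re (minor n C X S))"
    using minor_nonneg(1)[OF C, of S n X] by (simp add: complex_eq_iff)
  then show "of_real (\<Prod>r\<in>S. D r) * minor n C X S = of_real ((\<Prod>r\<in>S. D r) * Re (minor n C X S))"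
    by (metis of_real_mult)
qed

abbreviation id_plus_gram :: "nat set \<Rightarrow> (nat \<Rightarrow> nat \<Rightarrow> complex) \<Rightarrow> nat \<Rightarrow> nat \<Rightarrow> complex" where
  "id_plus_gram \<equiv> id_plus (\<lambda>_. 1)"

definition resolvent :: "nat \<Rightarrow> nat set \<Rightarrow> (nat \<Rightarrow> nat \<Rightarrow> complex) \<Rightarrow> nat \<Rightarrow> nat \<Rightarrow> complex" where
  "resolvent n C X = minv n (id_plus_gram C X)"

lemma det_id_plus_gram_nonzero: "finite C \<Longrightarrow> det (fmat n (id_plus_gram C X)) \<noteq> 0"
  using det_id_plus_ge_1[of C n "\<lambda>_. 1" X] by fastforce

lemma gram_resolvent:
  assumes C: "finite C" and "r < n" "t < n"
  shows "(\<Sum>s<n. gram C X r s * resolvent n C X s t) = of_bool (r = t) - resolvent n C X r t"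
proof -
  have "(\<Sum>s<n. id_plus_gram C X r s * resolvent n C X s t) = of_bool (r = t)"
    unfolding resolvent_def using assms by (intro minv_right det_id_plus_gram_nonzero)
  moreover have "(\<Sum>s<n. id_plus_gram C X r s * resolvent n C X s t) =
      (\<Sum>s<n. if s = r then resolvent n C X s t else 0) + (\<Sum>s<n. gram C X r s * resolvent n C X s t)"
    unfolding sum.distrib[symmetric] by (intro sum.cong) (auto simp: id_plus_def distrib_right)
  ultimately show ?thesis using assms by (simp add: algebra_simps)
qed

text \<open>Setting \<open>D r\<close> to 0 subtracts row \<open>r\<close> of the Gram matrix, a
  rank-one update. The determinant ratio then expresses the diagonal resolvent entry through
  principal minors.\<close>

lemma det_id_plus_zero_row:
  assumes C: "finite C" and r: "r < n"
  shows "det (fmat n (id_plus ((\<lambda>_. 1)(r := 0)) C X)) = det (fmat n (id_plus_gram C X)) * resolvent n C X r r"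
proof -
  have "det (fmat n (\<lambda>i j. id_plus_gram C X i j + (if i = r then - 1 else 0) * gram C X r j)) =
    det (fmat n (id_plus_gram C X)) * (1 + (\<Sum>i<n. \<Sum>s<n. gram C X r i * resolvent n C X i s * (if s = r then - 1 else 0)))"
    unfolding resolvent_def by (rule det_rank_one_update) (rule minv_right[OF det_id_plus_gram_nonzero[OF C]])
  also have "(\<Sum>i<n. \<Sum>s<n. gram C X r i * resolvent n C X i s * (if s = r then - 1 else 0)) =
      (\<Sum>i<n. \<Sum>s<n. if s = r then - (gram C X r i * resolvent n C X i s) else 0)"
    by (intro sum.cong) auto
  also have "\<dots> = - (\<Sum>i<n. gram C X r i * resolvent n C X i r)"
    using r by (simp add: sum_negf)
  also have "\<dots> = resolvent n C X r r - 1"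
    using gram_resolvent[OF C r r] by simp
  also have "fmat n (\<lambda>i j. id_plus_gram C X i j + (if i = r then - 1 else 0) * gram C X r j) =
      fmat n (id_plus ((\<lambda>_. 1)(r := 0)) C X)"
    by (rule eq_matI) (auto simp: id_plus_def)
  finally show ?thesis by simp
qed

text \<open>The minors divided by \<open>p\<close> form a probability distribution on row sets
  \<open>S\<close> (an L-ensemble), and the diagonal resolvent entry is the probability that
  \<open>S\<close> avoids \<open>r\<close>.\<close>

lemma resolvent_diag_weights:
  fixes X :: "nat \<Rightarrow> nat \<Rightarrow> complex"
  assumes C: "finite C" and r: "r < n"
  defines "p \<equiv> \<Sum>S\<in>Pow {..<n}. Re (minor n C X S)"
  shows "resolvent n C X r r = of_real ((\<Sum>S\<in>{S\<in>Pow {..<n}. r \<notin> S}. Re (minor n C X S)) / p)"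
    and "det (fmat n (id_plus_gram C X)) = of_real p" and "p \<ge> 1"
proof -
  show det: "det (fmat n (id_plus_gram C X)) = of_real p"
    unfolding p_def det_id_plus_weights[OF C] by simp
  then show p1: "p \<ge> 1" using det_id_plus_ge_1[OF C, of n "\<lambda>_. 1" X] by auto
  have "(\<Sum>S\<in>Pow {..<n}. (\<Prod>i\<in>S. ((\<lambda>_. 1 :: real)(r := 0)) i) * Re (minor n C X S)) =
      (\<Sum>S\<in>Pow {..<n}. if r \<notin> S then Re (minor n C X S) else 0)"
  proof (rule sum.cong[OF refl])
    fix S assume "S \<in> Pow {..<n}"
    then have fS: "finite S" using finite_subset by blast
    show "(\<Prod>i\<in>S. ((\<lambda>_. 1 :: real)(r := 0)) i) * Re (minor n C X S) =
        (if r \<notin> S then Re (minor n C X S) else 0)"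
    proof (cases "r \<in> S")
      case True
      then have "(\<Prod>i\<in>S. ((\<lambda>_. 1 :: real)(r := 0)) i) = 0" using fS by (subst prod_zero_iff) auto
      then show ?thesis using True by simp
    next
      case False
      then have "(\<Prod>i\<in>S. ((\<lambda>_. 1 :: real)(r := 0)) i) = (\<Prod>i\<in>S. 1)" by (intro prod.cong) auto
      then show ?thesis using False by simp
    qed
  qed
  also have "\<dots> = (\<Sum>S\<in>{S\<in>Pow {..<n}. r \<notin> S}. Re (minor n C X S))"
    by (subst sum.inter_filter) auto
  finally have eq: "of_real (\<Sum>S\<in>{S\<in>Pow {..<n}. r \<notin> S}. Re (minor n C X S)) = of_real p * resolvent n C X r r"
    using det_id_plus_zero_row[OF C r, of X]
    unfolding det det_id_plus_weights[OF C, of n "(\<lambda>_. 1)(r := 0)"] by (simp only:)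
  have "of_real p \<noteq> (0 :: complex)" using p1 by simp
  then show "resolvent n C X r r = of_real ((\<Sum>S\<in>{S\<in>Pow {..<n}. r \<notin> S}. Re (minor n C X S)) / p)"
    unfolding of_real_divide eq by (rule nonzero_mult_div_cancel_left[symmetric])
qed

lemma ln_weighted_sum_ge:
  fixes w d :: "'a \<Rightarrow> real"
  assumes "finite I" and w: "\<And>i. i \<in> I \<Longrightarrow> w i \<ge> 0" and s: "(\<Sum>i\<in>I. w i) = 1"
    and d: "\<And>i. i \<in> I \<Longrightarrow> d i > 0"
  shows "(\<Sum>i\<in>I. w i * ln (d i)) \<le> ln (\<Sum>i\<in>I. w i * d i)"
proof -
  define m where "m = (\<Sum>i\<in>I. w i * ln (d i))"
  have "w i * (1 + ln (d i) - m) \<le> w i * (d i * exp (- m))" if "i \<in> I" for i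
  proof (rule mult_left_mono[OF _ w[OF that]])
    have "ln (d i * exp (- m)) \<le> d i * exp (- m) - 1"
      using d[OF that] by (intro ln_le_minus_one) simp
    then show "1 + ln (d i) - m \<le> d i * exp (- m)" using d[OF that] by (simp add: ln_mult)
  qed
  then have "(\<Sum>i\<in>I. w i * (1 + ln (d i) - m)) \<le> (\<Sum>i\<in>I. w i * (d i * exp (- m)))"
    by (rule sum_mono)
  also have "(\<Sum>i\<in>I. w i * (1 + ln (d i) - m)) = (\<Sum>i\<in>I. w i) + m - (\<Sum>i\<in>I. w i) * m"
    unfolding m_def by (simp add: algebra_simps sum.distrib sum_subtractf sum_distrib_right)
  also have "(\<Sum>i\<in>I. w i * (d i * exp (- m))) = (\<Sum>i\<in>I. w i * d i) * exp (- m)"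
    by (simp add: sum_distrib_right mult.assoc)
  finally have "1 \<le> (\<Sum>i\<in>I. w i * d i) * exp (- m)" using s by simp
  then have "exp m \<le> (\<Sum>i\<in>I. w i * d i)" by (simp add: exp_minus field_simps)
  then show ?thesis unfolding m_def[symmetric]
    by (subst ln_ge_iff) (auto intro: less_le_trans[OF exp_gt_zero])
qed

text \<open>Jensen's inequality for the product of \<open>D\<close> over a random row set
  \<open>S\<close> drawn with probability \<open>w S / p\<close>. The coefficient of
  \<open>ln (D r)\<close> is the probability that \<open>S\<close> contains
  \<open>r\<close>.\<close>

theorem ln_det_tangent_rows:
  assumes C: "finite C" and D: "\<And>r. r < n \<Longrightarrow> D r > 0"
  shows "ln (Re (det (fmat n (id_plus_gram C X)))) + (\<Sum>r<n. ln (D r) * (1 - Re (resolvent n C X r r)))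
     \<le> ln (Re (det (fmat n (id_plus D C X))))"
proof -
  define w where "w S = Re (minor n C X S)" for S
  define p where "p = (\<Sum>S\<in>Pow {..<n}. w S)"
  have p: "det (fmat n (id_plus_gram C X)) = of_real p" unfolding p_def w_def det_id_plus_weights[OF C] by simp
  then have p1: "p \<ge> 1" using det_id_plus_ge_1[OF C, of n "\<lambda>_. 1" X] by auto
  have w0: "w S \<ge> 0" if "S \<in> Pow {..<n}" for S using minor_nonneg(2)[OF C] that by (simp add: w_def)
  have dpos: "(\<Prod>r\<in>S. D r) > 0" if "S \<in> Pow {..<n}" for S using that D by (intro prod_pos) auto
  have res: "1 - Re (resolvent n C X r r) = (\<Sum>S\<in>Pow {..<n}. if r \<in> S then w S / p else 0)" if "r < n" for r
  proof -
    have "(\<Sum>S\<in>{S\<in>Pow {..<n}. r \<notin> S}. w S) + (\<Sum>S\<in>Pow {..<n}. if r \<in> S then w S else 0) = p"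
      unfolding p_def sum.inter_filter[OF finite_Pow_iff[THEN iffD2, OF finite_lessThan]] sum.distrib[symmetric]
      by (intro sum.cong) auto
    then have "1 - Re (resolvent n C X r r) = (\<Sum>S\<in>Pow {..<n}. if r \<in> S then w S else 0) / p"
      unfolding resolvent_diag_weights(1)[OF C that] w_def[symmetric] p_def[symmetric] using p1
      by (simp add: field_simps)
    then show ?thesis by (simp add: sum_divide_distrib if_distrib[of "\<lambda>x. x / p"] cong: if_cong)
  qed
  have "(\<Sum>r<n. ln (D r) * (1 - Re (resolvent n C X r r))) =
      (\<Sum>r<n. \<Sum>S\<in>Pow {..<n}. if r \<in> S then w S / p * ln (D r) else 0)"
    by (intro sum.cong refl) (auto simp: res sum_distrib_left intro!: sum.cong)
  also have "\<dots> = (\<Sum>S\<in>Pow {..<n}. \<Sum>r<n. if r \<in> S then w S / p * ln (D r) else 0)"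
    by (rule sum.swap)
  also have "\<dots> = (\<Sum>S\<in>Pow {..<n}. w S / p * ln (\<Prod>r\<in>S. D r))"
  proof (rule sum.cong[OF refl])
    fix S assume S: "S \<in> Pow {..<n}"
    then have "finite S" using finite_subset by blast
    then have "ln (\<Prod>r\<in>S. D r) = (\<Sum>r\<in>S. ln (D r))" using S D by (intro ln_prod) force+
    moreover have "(\<Sum>r<n. if r \<in> S then w S / p * ln (D r) else 0) = (\<Sum>r\<in>{..<n} \<inter> S. w S / p * ln (D r))"
      by (subst sum.inter_restrict) auto
    moreover have "{..<n} \<inter> S = S" using S by auto
    ultimately show "(\<Sum>r<n. if r \<in> S then w S / p * ln (D r) else 0) = w S / p * ln (\<Prod>r\<in>S. D r)"
      by (simp add: sum_distrib_left)
  qed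
  also have "\<dots> \<le> ln (\<Sum>S\<in>Pow {..<n}. w S / p * (\<Prod>r\<in>S. D r))"
    using w0 p1 dpos by (intro ln_weighted_sum_ge) (auto simp: p_def sum_divide_distrib[symmetric])
  also have "(\<Sum>S\<in>Pow {..<n}. w S / p * (\<Prod>r\<in>S. D r)) = Re (det (fmat n (id_plus D C X))) / p"
    unfolding det_id_plus_weights[OF C] w_def Re_complex_of_real by (simp add: sum_divide_distrib mult.commute)
  also have "ln (Re (det (fmat n (id_plus D C X))) / p) = ln (Re (det (fmat n (id_plus D C X)))) - ln p"
  proof -
    have "Re (det (fmat n (id_plus D C X))) \<ge> 1"
      using det_id_plus_ge_1[OF C, of n D X] D by (metis Re_complex_of_real less_imp_le)
    then show ?thesis using p1 by (simp add: ln_div)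
  qed
  finally show ?thesis unfolding p by simp
qed

section \<open>Concavity in the column powers\<close>

lemma trace_similar:
  fixes A B :: "complex mat"
  assumes "similar_mat A B" and A: "A \<in> carrier_mat n n"
  shows "(\<Sum>i<n. A $$ (i, i)) = (\<Sum>i<n. B $$ (i, i))"
proof -
  obtain P Q where "similar_mat_wit A B P Q" using assms(1) unfolding similar_mat_def by blast
  from similar_mat_witD2[OF A this] have
    QP: "Q * P = 1\<^sub>m n" and AB: "A = P * B * Q" and c: "B \<in> carrier_mat n n" "P \<in> carrier_mat n n" "Q \<in> carrier_mat n n"
    by auto
  have trace_mult: "(\<Sum>i<n. (V * W) $$ (i, i)) = (\<Sum>i<n. \<Sum>j<n. V $$ (i, j) * W $$ (j, i))"
    if "V \<in> carrier_mat n n" "W \<in> carrier_mat n n" for V W :: "complex mat"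
    using that by (intro sum.cong) (auto simp: scalar_prod_def lessThan_atLeast0)
  have "(\<Sum>i<n. A $$ (i, i)) = (\<Sum>i<n. \<Sum>j<n. (P * B) $$ (i, j) * Q $$ (j, i))"
    unfolding AB using c by (intro trace_mult) auto
  also have "\<dots> = (\<Sum>j<n. \<Sum>i<n. Q $$ (j, i) * (P * B) $$ (i, j))"
    by (subst sum.swap) (simp add: mult.commute)
  also have "\<dots> = (\<Sum>j<n. (Q * (P * B)) $$ (j, j))"
    using c by (intro trace_mult[symmetric]) auto
  also have "Q * (P * B) = B"
    unfolding assoc_mult_mat[OF c(3,2,1), symmetric] QP by (rule left_mult_one_mat[OF c(1)])
  finally show ?thesis .
qed

text \<open>The matrix need not be Hermitian, so \<open>ln x \<le> x - 1\<close> is summed over the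
  eigenvalues on the diagonal of a Schur form; determinant and trace survive the similarity.\<close>

lemma ln_det_le_trace:
  fixes M :: "complex mat"
  assumes M: "M \<in> carrier_mat n n"
    and pos: "\<And>\<mu>. eigenvalue M \<mu> \<Longrightarrow> Im \<mu> = 0 \<and> Re \<mu> > 0"
  shows "ln (Re (det M)) \<le> (\<Sum>i<n. Re (M $$ (i, i)) - 1)" "Re (det M) > 0"
proof -
  obtain as where as: "char_poly M = (\<Prod>a\<leftarrow>as. [:- a, 1:])" "length as = n"
    using char_poly_factorized[OF M] by blast
  obtain B where B: "B \<in> carrier_mat n n" "upper_triangular B" "similar_mat M B"
    using schur_decomposition_exists[OF M as(1)] by blast
  have ev: "eigenvalue M (B $$ (i, i))" if "i < n" for i
  proof -
    have "char_poly M = (\<Prod>a\<leftarrow>diag_mat B. [:- a, 1:])"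
      using char_poly_similar[OF B(3)] char_poly_upper_triangular[OF B(1,2)] by simp
    moreover have "B $$ (i, i) \<in> set (diag_mat B)" using that B(1) by (auto simp: diag_mat_def)
    ultimately have "poly (char_poly M) (B $$ (i, i)) = 0"
      by (auto simp: poly_prod_list prod_list_zero_iff intro!: image_eqI)
    then show ?thesis using eigenvalue_root_char_poly[OF M] by simp
  qed
  define b where "b i = Re (B $$ (i, i))" for i
  have Bb: "B $$ (i, i) = of_real (b i)" and b0: "b i > 0" if "i < n" for i
    using pos[OF ev[OF that]] by (auto simp: b_def complex_eq_iff)
  have "det M = det B" by (rule det_similar[OF B(3)])
  also have "\<dots> = (\<Prod>i<n. B $$ (i, i))"
    using det_upper_triangular[OF B(2,1)] B(1) by (simp add: prod_list_diag_prod lessThan_atLeast0)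
  also have "\<dots> = of_real (\<Prod>i<n. b i)" by (simp add: Bb)
  finally have det: "Re (det M) = (\<Prod>i<n. b i)" by (metis Re_complex_of_real)
  show "Re (det M) > 0" unfolding det using b0 by (intro prod_pos) auto
  have "ln (Re (det M)) = (\<Sum>i<n. ln (b i))" unfolding det using b0 by (intro ln_prod) force+
  also have "\<dots> \<le> (\<Sum>i<n. b i - 1)" using b0 by (intro sum_mono ln_le_minus_one) auto
  also have "\<dots> = Re (\<Sum>i<n. B $$ (i, i)) - n" by (simp add: b_def sum_subtractf)
  also have "(\<Sum>i<n. B $$ (i, i)) = (\<Sum>i<n. M $$ (i, i))" using trace_similar[OF B(3) M] by simp
  finally show "ln (Re (det M)) \<le> (\<Sum>i<n. Re (M $$ (i, i)) - 1)" by (simp add: sum_subtractf)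
qed

lemma id_plus_gram_quadratic_form:
  "(\<Sum>r<n. cnj (z r) * (\<Sum>s<n. id_plus_gram C X r s * z s)) =
     of_real ((\<Sum>r<n. (cmod (z r))\<^sup>2) + (\<Sum>c\<in>C. (cmod (\<Sum>r<n. cnj (X r c) * z r))\<^sup>2))"
proof -
  have "(\<Sum>s<n. id_plus_gram C X r s * z s) = z r + (\<Sum>s<n. gram C X r s * z s)" if "r < n" for r
  proof -
    have "(\<Sum>s<n. id_plus_gram C X r s * z s) = (\<Sum>s<n. if s = r then z s else 0) + (\<Sum>s<n. gram C X r s * z s)"
      unfolding sum.distrib[symmetric] by (intro sum.cong) (auto simp: id_plus_def distrib_right)
    then show ?thesis using that by simp
  qed
  then have "(\<Sum>r<n. cnj (z r) * (\<Sum>s<n. id_plus_gram C X r s * z s)) =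
      (\<Sum>r<n. cnj (z r) * z r) + (\<Sum>r<n. cnj (z r) * (\<Sum>s<n. gram C X r s * z s))"
    by (simp add: distrib_left sum.distrib)
  also have "(\<Sum>r<n. cnj (z r) * z r) = of_real (\<Sum>r<n. (cmod (z r))\<^sup>2)"
    by (simp only: of_real_sum complex_norm_square mult.commute)
  finally show ?thesis by (simp only: gram_quadratic_form of_real_add)
qed

text \<open>Concavity of ln det: the difference of the two logarithms is ln det of
  \<open>?M\<close>, the inverse of \<open>?A\<close> times \<open>?B\<close>, and this is bounded
  by the trace of \<open>?M\<close> minus the identity. The slope in \<open>\<tau> c\<close> is the
  resolvent form of column \<open>c\<close>.\<close>

theorem ln_det_tangent_columns:
  assumes C: "finite C" and \<tau>: "\<And>c. c \<in> C \<Longrightarrow> \<tau> c \<ge> 0"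
    and Y: "\<And>r c. r < n \<Longrightarrow> c \<in> C \<Longrightarrow> Y r c = of_real (sqrt (\<tau> c)) * X r c"
  shows "ln (Re (det (fmat n (id_plus_gram C Y)))) \<le> ln (Re (det (fmat n (id_plus_gram C X)))) +
    (\<Sum>c\<in>C. (\<tau> c - 1) * Re (\<Sum>r<n. \<Sum>s<n. cnj (X r c) * resolvent n C X r s * X s c))"
proof -
  let ?A = "fmat n (id_plus_gram C X)" and ?B = "fmat n (id_plus_gram C Y)" and ?G = "fmat n (resolvent n C X)"
  let ?M = "?G * ?B"
  have M: "?M \<in> carrier_mat n n" by auto
  have gr: "gram C Y r s = (\<Sum>c\<in>C. of_real (\<tau> c) * (X r c * cnj (X s c)))" if "r < n" "s < n" for r s
    unfolding gram_def
  proof (rule sum.cong[OF refl])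
    fix c assume c: "c \<in> C"
    have "Y r c * cnj (Y s c) = of_real (sqrt (\<tau> c)) * of_real (sqrt (\<tau> c)) * (X r c * cnj (X s c))"
      using that c by (simp add: Y mult_ac)
    also have "of_real (sqrt (\<tau> c)) * of_real (sqrt (\<tau> c)) = (of_real (\<tau> c) :: complex)"
      using \<tau>[OF c] by (simp flip: of_real_mult)
    finally show "Y r c * cnj (Y s c) = of_real (\<tau> c) * (X r c * cnj (X s c))" .
  qed
  have inv: "(\<Sum>s<n. id_plus_gram C X r s * resolvent n C X s t) = of_bool (r = t)" if "r < n" "t < n" for r t
    unfolding resolvent_def using that C by (intro minv_right det_id_plus_gram_nonzero)
  have AG: "?A * ?G = 1\<^sub>m n"
    by (rule eq_matI) (auto simp: scalar_prod_def inv lessThan_atLeast0[symmetric])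
  have AM: "?A * ?M = ?B"
    by (subst assoc_mult_mat[symmetric, of _ n n _ n _ n]) (auto simp: AG)
  obtain a where a: "a \<ge> 1" "det ?A = of_real a" using det_id_plus_ge_1[OF C, of n "\<lambda>_. 1" X] by auto
  obtain b where b: "b \<ge> 1" "det ?B = of_real b" using det_id_plus_ge_1[OF C, of n "\<lambda>_. 1" Y] by auto
  have "det ?A * det ?M = det ?B"
    by (subst det_mult[symmetric, of _ n]) (auto simp: AM)
  then have detM: "det ?M = of_real (b / a)" using a b by (simp add: field_simps)
  \<comment> \<open>\<open>?M\<close> is not Hermitian, but \<open>?B v = \<mu> ?A v\<close>
    exhibits \<open>\<mu>\<close> as a quotient of two positive quadratic forms.\<close>
  have pos: "Im \<mu> = 0 \<and> Re \<mu> > 0" if ev: "eigenvalue ?M \<mu>" for \<mu>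
  proof -
    obtain v where v: "v \<in> carrier_vec n" "v \<noteq> 0\<^sub>v n" "?M *\<^sub>v v = \<mu> \<cdot>\<^sub>v v"
      using ev unfolding eigenvalue_def eigenvector_def carrier_matD(1)[OF M] by auto
    have "?B *\<^sub>v v = ?A *\<^sub>v (\<mu> \<cdot>\<^sub>v v)"
      by (subst v(3)[symmetric]) (subst assoc_mult_mat_vec[symmetric, of _ n n _ n]; use v M in \<open>simp add: AM\<close>)
    then have "(\<Sum>s<n. id_plus_gram C Y r s * v $ s) = \<mu> * (\<Sum>s<n. id_plus_gram C X r s * v $ s)" if "r < n" for r
    proof -
      have "(?B *\<^sub>v v) $ r = (?A *\<^sub>v (\<mu> \<cdot>\<^sub>v v)) $ r" using \<open>?B *\<^sub>v v = ?A *\<^sub>v (\<mu> \<cdot>\<^sub>v v)\<close> by simp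
      then show ?thesis using that v(1)
        by (simp add: scalar_prod_def lessThan_atLeast0 sum_distrib_left mult_ac)
    qed
    then have "(\<Sum>r<n. cnj (v $ r) * (\<Sum>s<n. id_plus_gram C Y r s * v $ s)) =
        \<mu> * (\<Sum>r<n. cnj (v $ r) * (\<Sum>s<n. id_plus_gram C X r s * v $ s))"
      by (simp add: sum_distrib_left mult_ac)
    moreover define N where "N = (\<Sum>r<n. (cmod (v $ r))\<^sup>2)"
    moreover define x where "x = (\<Sum>c\<in>C. (cmod (\<Sum>r<n. cnj (X r c) * v $ r))\<^sup>2)"
    moreover define y where "y = (\<Sum>c\<in>C. (cmod (\<Sum>r<n. cnj (Y r c) * v $ r))\<^sup>2)"
    ultimately have eq: "of_real (N + y) = \<mu> * of_real (N + x)"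
      unfolding id_plus_gram_quadratic_form by simp
    have "\<exists>r<n. v $ r \<noteq> 0" using v(1,2) by (metis carrier_vecD eq_vecI index_zero_vec)
    then obtain r where r: "r < n" "v $ r \<noteq> 0" by blast
    have "N \<ge> (cmod (v $ r))\<^sup>2" unfolding N_def by (rule member_le_sum) (use r in auto)
    then have "N > 0" using r(2) by (smt (verit) norm_le_zero_iff zero_less_power zero_le_power2 power_eq_0_iff norm_eq_zero)
    moreover have "x \<ge> 0" "y \<ge> 0" unfolding x_def y_def by (auto intro: sum_nonneg)
    moreover have "\<mu> = of_real ((N + y) / (N + x))"
      using eq \<open>N > 0\<close> \<open>x \<ge> 0\<close> by (simp add: field_simps flip: of_real_add)
    ultimately show ?thesis by simp
  qed
  have diag: "?M $$ (i, i) - 1 = (\<Sum>c\<in>C. of_real (\<tau> c - 1) * (\<Sum>s<n. resolvent n C X i s * X s c * cnj (X i c)))"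
    if i: "i < n" for i
  proof -
    have left: "(\<Sum>s<n. resolvent n C X i s * id_plus_gram C X s i) = 1"
      unfolding resolvent_def using minv_left[OF det_id_plus_gram_nonzero[OF C] i i, of X] by simp
    have "?M $$ (i, i) = (\<Sum>s<n. resolvent n C X i s * id_plus_gram C Y s i)"
      using i by (simp add: scalar_prod_def lessThan_atLeast0)
    then have "?M $$ (i, i) - 1 = (\<Sum>s<n. resolvent n C X i s * (id_plus_gram C Y s i - id_plus_gram C X s i))"
      unfolding left[symmetric] by (simp add: right_diff_distrib sum_subtractf)
    also have "\<dots> = (\<Sum>s<n. \<Sum>c\<in>C. of_real (\<tau> c - 1) * (resolvent n C X i s * X s c * cnj (X i c)))"
    proof (intro sum.cong refl)
      fix s assume "s \<in> {..<n}"
      then have "id_plus_gram C Y s i - id_plus_gram C X s i = (\<Sum>c\<in>C. of_real (\<tau> c - 1) * (X s c * cnj (X i c)))"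
        using i gr[of s i] by (simp add: id_plus_def gram_def[of C X] sum_subtractf[symmetric] left_diff_distrib)
      then show "resolvent n C X i s * (id_plus_gram C Y s i - id_plus_gram C X s i) =
          (\<Sum>c\<in>C. of_real (\<tau> c - 1) * (resolvent n C X i s * X s c * cnj (X i c)))"
        by (simp add: sum_distrib_left mult_ac)
    qed
    also have "\<dots> = (\<Sum>c\<in>C. \<Sum>s<n. of_real (\<tau> c - 1) * (resolvent n C X i s * X s c * cnj (X i c)))"
      by (rule sum.swap)
    finally show ?thesis by (simp add: sum_distrib_left)
  qed
  have "ln (Re (det ?M)) \<le> (\<Sum>i<n. Re (?M $$ (i, i)) - 1)" by (rule ln_det_le_trace(1)[OF M pos])
  also have "\<dots> = Re (\<Sum>i<n. \<Sum>c\<in>C. of_real (\<tau> c - 1) * (\<Sum>s<n. resolvent n C X i s * X s c * cnj (X i c)))"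
    unfolding Re_sum[of _ "{..<n}"]
  proof (rule sum.cong[OF refl])
    fix i assume "i \<in> {..<n}"
    then have "i < n" by simp
    show "Re (?M $$ (i, i)) - 1 = Re (\<Sum>c\<in>C. of_real (\<tau> c - 1) * (\<Sum>s<n. resolvent n C X i s * X s c * cnj (X i c)))"
      using arg_cong[OF diag[OF \<open>i < n\<close>], of Re] by (simp only: minus_complex.sel one_complex.sel)
  qed
  also have "(\<Sum>i<n. \<Sum>c\<in>C. of_real (\<tau> c - 1) * (\<Sum>s<n. resolvent n C X i s * X s c * cnj (X i c))) =
      (\<Sum>c\<in>C. of_real (\<tau> c - 1) * (\<Sum>i<n. \<Sum>s<n. cnj (X i c) * resolvent n C X i s * X s c))"
    by (subst sum.swap) (simp add: sum_distrib_left mult_ac)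
  also have "Re \<dots> = (\<Sum>c\<in>C. (\<tau> c - 1) * Re (\<Sum>r<n. \<Sum>s<n. cnj (X r c) * resolvent n C X r s * X s c))"
    unfolding Re_sum[of _ C] by (intro sum.cong refl) (simp only: Re_complex_of_real times_complex.simps Im_complex_of_real mult_zero_left diff_zero)
  finally show ?thesis unfolding detM a b using a b by (simp add: ln_div)
qed

section \<open>Resolvents under column and entry changes\<close>

lemma resolvent_gram:
  assumes C: "finite C" and "r < n" "t < n"
  shows "(\<Sum>s<n. resolvent n C X r s * gram C X s t) = of_bool (r = t) - resolvent n C X r t"
proof -
  have "(\<Sum>s<n. resolvent n C X r s * id_plus_gram C X s t) = of_bool (r = t)"
    unfolding resolvent_def using assms by (intro minv_left det_id_plus_gram_nonzero)
  moreover have "(\<Sum>s<n. resolvent n C X r s * id_plus_gram C X s t) =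
      (\<Sum>s<n. if s = t then resolvent n C X r s else 0) + (\<Sum>s<n. resolvent n C X r s * gram C X s t)"
    unfolding sum.distrib[symmetric] by (intro sum.cong) (auto simp: id_plus_def distrib_left)
  ultimately show ?thesis using assms by (simp add: algebra_simps)
qed

lemma resolvent_solve:
  assumes C: "finite C" and r: "r < n"
    and h: "\<And>r. r < n \<Longrightarrow> (\<Sum>s<n. id_plus_gram C X r s * h s) = y r"
  shows "h r = (\<Sum>s<n. resolvent n C X r s * y s)"
  unfolding resolvent_def by (rule minv_solve[OF det_id_plus_gram_nonzero[OF C] r h])

lemma id_plus_gram_apply_resolvent:
  assumes C: "finite C" and r: "r < n"
  shows "(\<Sum>s<n. id_plus_gram C X r s * (\<Sum>t<n. resolvent n C X s t * y t)) = y r"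
  unfolding resolvent_def by (rule minv_apply[OF det_id_plus_gram_nonzero[OF C] r])

lemma id_plus_gram_hermitian: "id_plus_gram C X s r = cnj (id_plus_gram C X r s)"
  by (auto simp: id_plus_def gram_def mult.commute)

lemma resolvent_hermitian:
  assumes C: "finite C" and r: "r < n" and t: "t < n"
  shows "cnj (resolvent n C X t r) = resolvent n C X r t"
proof -
  have "cnj (resolvent n C X t r) = (\<Sum>s<n. resolvent n C X r s * (if s = t then 1 else 0))"
  proof (rule resolvent_solve[OF C r])
    fix a assume a: "a < n"
    have "(\<Sum>s<n. id_plus_gram C X a s * cnj (resolvent n C X t s)) = cnj (\<Sum>s<n. resolvent n C X t s * id_plus_gram C X s a)"
      by (simp add: id_plus_gram_hermitian[of C X _ a] mult.commute)
    also have "(\<Sum>s<n. resolvent n C X t s * id_plus_gram C X s a) = of_bool (t = a)"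
      unfolding resolvent_def using a t C by (intro minv_left det_id_plus_gram_nonzero)
    finally show "(\<Sum>s<n. id_plus_gram C X a s * cnj (resolvent n C X t s)) = (if a = t then 1 else 0)" by auto
  qed
  also have "\<dots> = (\<Sum>s<n. if s = t then resolvent n C X r s else 0)" by (intro sum.cong) auto
  finally show ?thesis using t by simp
qed

lemma resolvent_cong:
  assumes "\<And>r c. r < n \<Longrightarrow> c \<in> C \<Longrightarrow> X r c = Y r c"
  shows "resolvent n C X = resolvent n C Y"
proof -
  have "fmat n (id_plus_gram C X) = fmat n (id_plus_gram C Y)"
    using assms by (intro eq_matI) (auto simp: id_plus_def gram_def intro!: sum.cong)
  then show ?thesis unfolding resolvent_def minv_def by (intro ext) simp
qed

lemma resolvent_diag_bounds:
  assumes C: "finite C" and r: "r < n"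
  shows "0 \<le> Re (resolvent n C X r r)" "Re (resolvent n C X r r) \<le> 1" "Im (resolvent n C X r r) = 0"
proof -
  let ?w = "\<lambda>S. Re (minor n C X S)"
  let ?q = "\<Sum>S\<in>{S\<in>Pow {..<n}. r \<notin> S}. ?w S" and ?p = "\<Sum>S\<in>Pow {..<n}. ?w S"
  have w: "?w S \<ge> 0" if "S \<in> Pow {..<n}" for S using minor_nonneg(2)[OF C] that by simp
  have "0 \<le> ?q" by (intro sum_nonneg w) auto
  moreover have "?q \<le> ?p" by (intro sum_mono2 w) auto
  ultimately show "0 \<le> Re (resolvent n C X r r)" "Re (resolvent n C X r r) \<le> 1" "Im (resolvent n C X r r) = 0"
    using resolvent_diag_weights(3)[OF C r, of X] unfolding resolvent_diag_weights(1)[OF C r] by simp_all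
qed

definition resolvent_col :: "nat \<Rightarrow> nat set \<Rightarrow> (nat \<Rightarrow> nat \<Rightarrow> complex) \<Rightarrow> nat \<Rightarrow> nat \<Rightarrow> complex" where
  "resolvent_col n C X c r = (\<Sum>s<n. resolvent n C X r s * X s c)"

text \<open>The \<open>c\<close>-th diagonal entry of \<open>(I + X\<^sup>* X)\<^sup>-\<^sup>1\<close>.\<close>
definition coresolvent :: "nat \<Rightarrow> nat set \<Rightarrow> (nat \<Rightarrow> nat \<Rightarrow> complex) \<Rightarrow> nat \<Rightarrow> real" where
  "coresolvent n C X c = 1 - Re (\<Sum>r<n. cnj (X r c) * resolvent_col n C X c r)"

text \<open>The common summand of both traces: summed over rows it gives
  \<open>1 - coresolvent\<close>, summed over columns it gives 1 minus the diagonal resolvent entry.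
  This is why the row and the column fixed-point equations share the same terms.\<close>

definition overlap :: "nat \<Rightarrow> nat set \<Rightarrow> (nat \<Rightarrow> nat \<Rightarrow> complex) \<Rightarrow> nat \<Rightarrow> nat \<Rightarrow> real" where
  "overlap n C X r c = Re (cnj (X r c) * resolvent_col n C X c r)"

lemma sum_overlap_rows: "(\<Sum>r<n. overlap n C X r c) = 1 - coresolvent n C X c"
  by (simp add: overlap_def coresolvent_def)

lemma sum_overlap_columns:
  assumes C: "finite C" and r: "r < n"
  shows "(\<Sum>c\<in>C. overlap n C X r c) = 1 - Re (resolvent n C X r r)"
proof -
  have "(\<Sum>c\<in>C. cnj (X r c) * resolvent_col n C X c r) =
      (\<Sum>c\<in>C. \<Sum>s<n. resolvent n C X r s * (X s c * cnj (X r c)))"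
    unfolding resolvent_col_def by (simp add: sum_distrib_left mult_ac)
  also have "\<dots> = (\<Sum>s<n. resolvent n C X r s * gram C X s r)"
    unfolding gram_def by (subst sum.swap) (simp add: sum_distrib_left)
  also have "\<dots> = 1 - resolvent n C X r r" using resolvent_gram[OF C r r] by simp
  finally have "Re (\<Sum>c\<in>C. cnj (X r c) * resolvent_col n C X c r) = Re (1 - resolvent n C X r r)" by simp
  then show ?thesis unfolding overlap_def by (simp add: Re_sum del: times_complex.sel)
qed

text \<open>Sherman--Morrison: \<open>h\<close> and \<open>k\<close> refer to the matrix with column \<open>c\<close> removed.\<close>

lemma rank_one_resolvent:
  fixes X :: "nat \<Rightarrow> nat \<Rightarrow> complex" and n :: nat
  assumes C: "finite C" and c: "c \<notin> C"
  defines "h \<equiv> resolvent_col n C X c"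
  defines "k \<equiv> Re (\<Sum>r<n. cnj (X r c) * h r)"
  shows "(\<Sum>r<n. cnj (X r c) * h r) = of_real k"
    and "(\<Sum>r<n. (cmod (h r))\<^sup>2) \<le> k"
    and "\<And>r t. r < n \<Longrightarrow> t < n \<Longrightarrow>
      resolvent n (insert c C) X r t = resolvent n C X r t - h r * cnj (h t) / of_real (1 + k)"
    and "\<And>r. r < n \<Longrightarrow> resolvent_col n (insert c C) X c r = h r / of_real (1 + k)"
    and "coresolvent n (insert c C) X c = 1 / (1 + k)"
proof -
  have d: "det (fmat n (id_plus_gram C X)) \<noteq> 0" by (rule det_id_plus_gram_nonzero[OF C])
  have hz: "h = (\<lambda>r. \<Sum>s<n. minv n (id_plus_gram C X) r s * (of_real 1 * X s c))"
    unfolding h_def resolvent_col_def resolvent_def by simp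
  have kf: "(\<Sum>r<n. cnj (X r c) * h r) = of_real (
      (\<Sum>r<n. 1 * (cmod (X r c - (\<Sum>s<n. gram C X r s * h s)))\<^sup>2) +
      (\<Sum>c'\<in>C. (cmod (\<Sum>r<n. cnj (X r c') * h r))\<^sup>2))"
    unfolding hz by (rule kappa_formula(1)[OF d])
  show xk: "(\<Sum>r<n. cnj (X r c) * h r) = of_real k" unfolding k_def kf by simp
  have hr: "h r = X r c - (\<Sum>s<n. gram C X r s * h s)" if "r < n" for r
    using kappa_formula(2)[OF d that, of "\<lambda>s. X s c"] unfolding hz by simp
  have "k = (\<Sum>r<n. (cmod (h r))\<^sup>2) + (\<Sum>c'\<in>C. (cmod (\<Sum>r<n. cnj (X r c') * h r))\<^sup>2)"
  proof -
    have "(\<Sum>r<n. 1 * (cmod (X r c - (\<Sum>s<n. gram C X r s * h s)))\<^sup>2) = (\<Sum>r<n. (cmod (h r))\<^sup>2)"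
      by (intro sum.cong) (auto simp: hr[symmetric])
    then show ?thesis unfolding k_def kf by simp
  qed
  then show hk: "(\<Sum>r<n. (cmod (h r))\<^sup>2) \<le> k" by (simp add: sum_nonneg)
  have "0 \<le> (\<Sum>r<n. (cmod (h r))\<^sup>2)" by (intro sum_nonneg) auto
  then have k0: "k \<ge> 0" using hk by simp
  then have kne: "of_real (1 + k) \<noteq> (0 :: complex)" "1 + complex_of_real k \<noteq> 0"
    by (auto simp: complex_eq_iff)
  have Ph: "(\<Sum>s<n. id_plus_gram C X r s * h s) = X r c" if "r < n" for r
    unfolding h_def resolvent_col_def by (rule id_plus_gram_apply_resolvent[OF C that])
  have PG: "(\<Sum>s<n. id_plus_gram C X r s * resolvent n C X s t) = of_bool (r = t)" if "r < n" "t < n" for r t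
    unfolding resolvent_def using that C by (intro minv_right det_id_plus_gram_nonzero)
  have xG: "(\<Sum>s<n. cnj (X s c) * resolvent n C X s t) = cnj (h t)" if "t < n" for t
    unfolding h_def resolvent_col_def cnj_sum
    by (intro sum.cong) (auto simp: resolvent_hermitian[OF C _ that] mult.commute)
  show sm: "resolvent n (insert c C) X r t = resolvent n C X r t - h r * cnj (h t) / of_real (1 + k)"
    if r: "r < n" and t: "t < n" for r t
  proof -
    have fi: "finite (insert c C)" using C by simp
    have "resolvent n C X r t - h r * cnj (h t) / of_real (1 + k) =
        (\<Sum>s<n. resolvent n (insert c C) X r s * (if s = t then 1 else 0))"
    proof (rule resolvent_solve[OF fi r])
      fix a assume a: "a < n"
      have "(\<Sum>s<n. id_plus_gram (insert c C) X a s * (resolvent n C X s t - h s * cnj (h t) / of_real (1 + k))) =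
        (\<Sum>s<n. id_plus_gram C X a s * resolvent n C X s t - id_plus_gram C X a s * h s * (cnj (h t) / of_real (1 + k))
          + X a c * (cnj (X s c) * resolvent n C X s t) - cnj (X s c) * h s * (X a c * cnj (h t) / of_real (1 + k)))"
        by (intro sum.cong refl) (simp add: id_plus_insert[OF C c] algebra_simps)
      also have "\<dots> = of_bool (a = t) - X a c * (cnj (h t) / of_real (1 + k))
          + X a c * cnj (h t) - of_real k * (X a c * cnj (h t) / of_real (1 + k))"
        unfolding sum.distrib sum_subtractf sum_distrib_right[symmetric] sum_distrib_left[symmetric]
          PG[OF a t] Ph[OF a] xG[OF t] xk ..
      also have "\<dots> = of_bool (a = t)"
      proof -
        have cancel: "A - p + z - w = A" if "p + w = z" for A p z w :: complex
          unfolding that[symmetric] by simp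
        have e: "x * (y / q) + (q - 1) * (x * y / q) = x * y" if "q \<noteq> 0" for x y q :: complex
          using that by (simp add: field_simps)
        have "of_real k = of_real (1 + k) - (1 :: complex)" by simp
        with e[OF kne(1)] show ?thesis by (metis cancel)
      qed
      finally show "(\<Sum>s<n. id_plus_gram (insert c C) X a s * (resolvent n C X s t - h s * cnj (h t) / of_real (1 + k)))
         = (if a = t then 1 else 0)" by simp
    qed
    also have "\<dots> = (\<Sum>s<n. if s = t then resolvent n (insert c C) X r s else 0)" by (intro sum.cong) auto
    finally show ?thesis using t by simp
  qed
  show colr: "resolvent_col n (insert c C) X c r = h r / of_real (1 + k)" if r: "r < n" for r
  proof -
    have "resolvent_col n (insert c C) X c r =
        (\<Sum>s<n. resolvent n C X r s * X s c - h r / of_real (1 + k) * cnj (cnj (X s c) * h s))"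
      unfolding resolvent_col_def by (intro sum.cong refl) (simp add: sm[OF r] algebra_simps)
    also have "\<dots> = h r - h r / of_real (1 + k) * cnj (of_real k)"
      unfolding sum_subtractf sum_distrib_left[symmetric] cnj_sum[symmetric] xk
      by (simp add: h_def resolvent_col_def)
    also have "\<dots> = h r / of_real (1 + k)" using kne by (simp add: field_simps)
    finally show ?thesis .
  qed
  have "(\<Sum>r<n. cnj (X r c) * resolvent_col n (insert c C) X c r) = (\<Sum>r<n. cnj (X r c) * h r) / of_real (1 + k)"
    unfolding sum_divide_distrib by (intro sum.cong) (auto simp: colr)
  then have "(\<Sum>r<n. cnj (X r c) * resolvent_col n (insert c C) X c r) = of_real (k / (1 + k))"
    unfolding xk by simp
  then show "coresolvent n (insert c C) X c = 1 / (1 + k)"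
    unfolding coresolvent_def using k0 by (simp add: field_simps)
qed

text \<open>Hides the concrete \<open>h\<close> and \<open>k\<close>. What the later bounds exploit
  is that the squared norm of \<open>h\<close> is at most \<open>k\<close>, so the rank-one
  correction has trace at most \<open>k / (1 + k)\<close>.\<close>

lemma column_removal:
  assumes C: "finite C" and c: "c \<in> C"
  obtains h :: "nat \<Rightarrow> complex" and k :: real where "(\<Sum>r<n. (cmod (h r))\<^sup>2) \<le> k" "0 \<le> k"
    "\<And>r t. r < n \<Longrightarrow> t < n \<Longrightarrow>
      resolvent n C X r t = resolvent n (C - {c}) X r t - h r * cnj (h t) / of_real (1 + k)"
    "\<And>r. r < n \<Longrightarrow> resolvent_col n C X c r = h r / of_real (1 + k)"
    "coresolvent n C X c = 1 / (1 + k)"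
proof -
  have C': "finite (C - {c})" "c \<notin> C - {c}" and C: "insert c (C - {c}) = C" using assms by auto
  note ro = rank_one_resolvent[OF C', where X = X and n = n, unfolded C]
  have "0 \<le> (\<Sum>r<n. (cmod (resolvent_col n (C - {c}) X c r))\<^sup>2)" by (intro sum_nonneg) auto
  from this ro(2) have "0 \<le> Re (\<Sum>r<n. cnj (X r c) * resolvent_col n (C - {c}) X c r)"
    by (rule order_trans)
  from that[OF ro(2) this ro(3) ro(4) ro(5)] show ?thesis .
qed

lemma coresolvent_bounds:
  assumes C: "finite C" and c: "c \<in> C"
  shows "0 \<le> coresolvent n C X c" "coresolvent n C X c \<le> 1"
proof -
  obtain k :: real where "0 \<le> k" "coresolvent n C X c = 1 / (1 + k)"
    using column_removal[OF C c, of n X] by metis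
  then show "0 \<le> coresolvent n C X c" "coresolvent n C X c \<le> 1" by simp_all
qed

text \<open>Since the squared modulus of \<open>h r\<close> is at most \<open>k\<close>, and so at
  most the square of \<open>1 + k\<close>, the entries of the resolvent column have modulus at most
  1. Integrability of the overlaps rests on this linear growth in \<open>X r c\<close>.\<close>

lemma overlap_bound:
  assumes C: "finite C" and c: "c \<in> C" and r: "r < n"
  shows "\<bar>overlap n C X r c\<bar> \<le> cmod (X r c)"
proof -
  obtain h :: "nat \<Rightarrow> complex" and k :: real where hk: "(\<Sum>r<n. (cmod (h r))\<^sup>2) \<le> k" and k0: "0 \<le> k"
    and col: "\<And>r. r < n \<Longrightarrow> resolvent_col n C X c r = h r / of_real (1 + k)"
    using column_removal[OF C c, of n X] by metis
  have "(cmod (h r))\<^sup>2 \<le> (\<Sum>r<n. (cmod (h r))\<^sup>2)" by (rule member_le_sum) (use r in auto)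
  then have "(cmod (h r))\<^sup>2 \<le> k" using hk by simp
  moreover have "(1 + k)\<^sup>2 = 1 + k + k + k * k" by (simp add: power2_eq_square algebra_simps)
  ultimately have "(cmod (h r))\<^sup>2 \<le> (1 + k)\<^sup>2" using k0 zero_le_square[of k] by linarith
  then have "cmod (h r) \<le> 1 + k" by (rule power2_le_imp_le) (use k0 in simp)
  then have "cmod (resolvent_col n C X c r) \<le> 1"
    using k0 unfolding col[OF r] norm_divide norm_of_real by simp
  then have "cmod (cnj (X r c) * resolvent_col n C X c r) \<le> cmod (X r c) * 1"
    unfolding norm_mult complex_mod_cnj by (rule mult_left_mono) auto
  then show ?thesis unfolding overlap_def
    using abs_Re_le_cmod[of "cnj (X r c) * resolvent_col n C X c r"] by linarith
qed

text \<open>The rank-one correction is positive semidefinite with trace at most 1, and its partial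
  trace over any set \<open>R\<close> of rows inherits both bounds.\<close>

lemma sum_resolvent_diag_column_removal:
  fixes Z :: "nat \<Rightarrow> nat \<Rightarrow> complex"
  assumes C: "finite C" "c0 \<in> C" and R: "R \<subseteq> {..<n}"
  defines "d \<equiv> (\<Sum>r\<in>R. Re (resolvent n (C - {c0}) Z r r)) - (\<Sum>r\<in>R. Re (resolvent n C Z r r))"
  shows "0 \<le> d \<and> d \<le> 1"
proof -
  obtain h :: "nat \<Rightarrow> complex" and k :: real where hk: "(\<Sum>r<n. (cmod (h r))\<^sup>2) \<le> k" "0 \<le> k"
    and sm: "\<And>r t. r < n \<Longrightarrow> t < n \<Longrightarrow>
      resolvent n C Z r t = resolvent n (C - {c0}) Z r t - h r * cnj (h t) / of_real (1 + k)"
    using column_removal[OF C, of n Z] by metis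
  have h0: "0 \<le> (\<Sum>r\<in>R. (cmod (h r))\<^sup>2)" by (intro sum_nonneg) auto
  have hR: "(\<Sum>r\<in>R. (cmod (h r))\<^sup>2) \<le> (\<Sum>r<n. (cmod (h r))\<^sup>2)" using R by (intro sum_mono2) auto
  have "Re (resolvent n (C - {c0}) Z r r) - Re (resolvent n C Z r r) = (cmod (h r))\<^sup>2 / (1 + k)"
    if "r \<in> R" for r
  proof -
    have r: "r < n" using that R by auto
    have "resolvent n (C - {c0}) Z r r - resolvent n C Z r r = of_real ((cmod (h r))\<^sup>2 / (1 + k))"
      unfolding of_real_divide complex_norm_square sm[OF r r] by simp
    then show ?thesis by (metis Re_complex_of_real minus_complex.sel(1))
  qed
  then have "d = (\<Sum>r\<in>R. (cmod (h r))\<^sup>2) / (1 + k)"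
    unfolding d_def sum_subtractf[symmetric] sum_divide_distrib by (intro sum.cong) auto
  then show ?thesis using hk h0 hR by simp
qed

text \<open>Both sums are compared with the matrix lacking column \<open>c0\<close>. Each lies below
  that common value by an amount between 0 and 1, so the change is at most 1 rather than 2.\<close>

lemma sum_resolvent_diag_column_change:
  assumes C: "finite C" and R: "R \<subseteq> {..<n}"
    and eq: "\<And>r c. r < n \<Longrightarrow> c \<in> C - {c0} \<Longrightarrow> X r c = Y r c"
  shows "\<bar>(\<Sum>r\<in>R. Re (resolvent n C X r r)) - (\<Sum>r\<in>R. Re (resolvent n C Y r r))\<bar> \<le> 1"
proof (cases "c0 \<in> C")
  case False
  then have "resolvent n C X = resolvent n C Y" using eq by (intro resolvent_cong) auto
  then show ?thesis by simp
next
  case True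
  have "resolvent n (C - {c0}) X = resolvent n (C - {c0}) Y" using eq by (intro resolvent_cong) auto
  then show ?thesis
    using sum_resolvent_diag_column_removal[OF C True R, of X]
      sum_resolvent_diag_column_removal[OF C True R, of Y] by (simp add: abs_le_iff)
qed

text \<open>Dependence on a single entry: the resolvent identities reduce it to one real quadratic
  polynomial \<open>\<alpha> + 2 Re (\<zeta>\<^sup>* b) + \<delta> |\<zeta>|\<^sup>2\<close>.\<close>

lemma single_entry_dependence:
  assumes C: "finite C" and c: "c \<in> C" and r: "r < n"
  obtains \<alpha> \<delta> :: real and b :: complex where "\<delta> \<ge> 0" "(cmod b)\<^sup>2 \<le> \<alpha> * \<delta>"
    "\<And>\<zeta>. 1 \<le> \<alpha> + 2 * Re (cnj \<zeta> * b) + \<delta> * (cmod \<zeta>)\<^sup>2"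
    "\<And>Y. (\<And>i j. i < n \<Longrightarrow> j \<in> C \<Longrightarrow> (i, j) \<noteq> (r, c) \<Longrightarrow> Y i j = X i j) \<Longrightarrow>
       overlap n C Y r c = Re (cnj (Y r c) * (b + of_real \<delta> * Y r c)) /
         (\<alpha> + 2 * Re (cnj (Y r c) * b) + \<delta> * (cmod (Y r c))\<^sup>2) \<and>
       Re (resolvent n C Y r r) * coresolvent n C Y c = (\<alpha> * \<delta> - (cmod b)\<^sup>2) /
         (\<alpha> + 2 * Re (cnj (Y r c) * b) + \<delta> * (cmod (Y r c))\<^sup>2)\<^sup>2"
proof -
  define C0 where "C0 = C - {c}"
  have C': "C = insert c C0" "finite C0" "c \<notin> C0" using assms by (auto simp: C0_def)
  define G where "G = resolvent n C0 X"
  \<comment> \<open>Column \<open>c\<close> is \<open>x\<close> plus the free entry at position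
    \<open>r\<close>. In the expansion of \<open>1 + k\<close> around \<open>x\<close>,
    \<open>\<alpha>\<close> is the constant term, \<open>b\<close> the linear coefficient, and
    \<open>\<delta>\<close> the diagonal resolvent entry of the matrix without column
    \<open>c\<close>.\<close>
  define x where "x s = (if s = r then 0 else X s c)" for s
  define g where "g s = (\<Sum>t<n. G s t * x t)" for s
  define b where "b = g r"
  define a where "a = 1 + (\<Sum>s<n. cnj (x s) * g s)"
  define \<alpha> where "\<alpha> = Re a"
  define \<delta> where "\<delta> = Re (G r r)"
  have Grr: "G r r = of_real \<delta>"
    using resolvent_diag_bounds(3)[OF C'(2) r, of X] by (simp add: \<delta>_def G_def complex_eq_iff)
  have \<delta>0: "\<delta> \<ge> 0" using resolvent_diag_bounds(1)[OF C'(2) r, of X] by (simp add: \<delta>_def G_def)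
  have main: "1 \<le> \<alpha> + 2 * Re (cnj (Y r c) * b) + \<delta> * (cmod (Y r c))\<^sup>2 \<and>
     overlap n C Y r c = Re (cnj (Y r c) * (b + of_real \<delta> * Y r c)) /
         (\<alpha> + 2 * Re (cnj (Y r c) * b) + \<delta> * (cmod (Y r c))\<^sup>2) \<and>
       Re (resolvent n C Y r r) * coresolvent n C Y c = (\<alpha> * \<delta> - (cmod b)\<^sup>2) /
         (\<alpha> + 2 * Re (cnj (Y r c) * b) + \<delta> * (cmod (Y r c))\<^sup>2)\<^sup>2"
    if Y: "\<And>i j. i < n \<Longrightarrow> j \<in> C \<Longrightarrow> (i, j) \<noteq> (r, c) \<Longrightarrow> Y i j = X i j" for Y
  proof -
    define \<zeta> where "\<zeta> = Y r c"
    have GY: "resolvent n C0 Y = G"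
      unfolding G_def using Y by (intro resolvent_cong) (auto simp: C0_def)
    have Yx: "Y s c = x s + (if s = r then \<zeta> else 0)" if "s < n" for s
      using Y[OF that c] by (auto simp: x_def \<zeta>_def)
    define h where "h = resolvent_col n C0 Y c"
    define k where "k = Re (\<Sum>s<n. cnj (Y s c) * h s)"
    note ro = rank_one_resolvent[OF C'(2,3), where X = Y and n = n, folded h_def, folded k_def, folded C'(1)]
    have h: "h s = g s + G s r * \<zeta>" for s
    proof -
      have "h s = (\<Sum>t<n. G s t * x t + (if t = r then G s t * \<zeta> else 0))"
        unfolding h_def resolvent_col_def GY by (intro sum.cong) (auto simp: Yx distrib_left)
      then show ?thesis using r by (simp add: sum.distrib g_def)
    qed
    have xG: "(\<Sum>s<n. cnj (x s) * G s r) = cnj b"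
      unfolding b_def g_def cnj_sum G_def
      by (intro sum.cong) (auto simp: resolvent_hermitian[OF C'(2) _ r] mult.commute)
    have "of_real k = (\<Sum>s<n. cnj (x s) * g s + cnj (x s) * G s r * \<zeta> + (if s = r then cnj \<zeta> * h s else 0))"
      unfolding ro(1)[symmetric] by (intro sum.cong) (auto simp: Yx h algebra_simps)
    also have "\<dots> = a - 1 + cnj b * \<zeta> + cnj \<zeta> * (b + of_real \<delta> * \<zeta>)"
      using r unfolding sum.distrib sum_distrib_right[symmetric] xG
      by (simp add: a_def h b_def Grr)
    finally have k: "k = Re (a - 1 + cnj b * \<zeta> + cnj \<zeta> * (b + of_real \<delta> * \<zeta>))"
      by (metis Re_complex_of_real)
    have k1: "1 + k = \<alpha> + 2 * Re (cnj \<zeta> * b) + \<delta> * (cmod \<zeta>)\<^sup>2"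
      unfolding k \<alpha>_def cmod_power2 by (simp add: algebra_simps power2_eq_square)
    have hr: "h r = b + of_real \<delta> * \<zeta>" by (simp add: h b_def Grr)
    have "0 \<le> (\<Sum>s<n. (cmod (h s))\<^sup>2)" by (intro sum_nonneg) auto
    then have k0: "k \<ge> 0" using ro(2) by simp
    have ov: "overlap n C Y r c = Re (cnj \<zeta> * h r) / (1 + k)"
    proof -
      have "cnj (Y r c) * resolvent_col n C Y c r = cnj \<zeta> * h r / of_real (1 + k)"
        using ro(4)[OF r] by (simp add: \<zeta>_def)
      then show ?thesis unfolding overlap_def by (simp only: Re_divide_of_real)
    qed
    have "resolvent n C Y r r = of_real (\<delta> - (cmod (h r))\<^sup>2 / (1 + k))"
      unfolding ro(3)[OF r r] GY Grr of_real_diff of_real_divide complex_norm_square ..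
    then have "Re (resolvent n C Y r r) = \<delta> - (cmod (h r))\<^sup>2 / (1 + k)" by (simp only: Re_complex_of_real)
    also have "\<delta> - (cmod (h r))\<^sup>2 / (1 + k) = (\<delta> * (1 + k) - (cmod (h r))\<^sup>2) / (1 + k)"
      using k0 by (simp add: diff_divide_distrib)
    finally have "Re (resolvent n C Y r r) * coresolvent n C Y c = (\<delta> * (1 + k) - (cmod (h r))\<^sup>2) / (1 + k)\<^sup>2"
      unfolding ro(5) by (simp add: power2_eq_square)
    also have "\<delta> * (1 + k) - (cmod (h r))\<^sup>2 = \<alpha> * \<delta> - (cmod b)\<^sup>2"
      unfolding k1 hr cmod_power2 by (simp add: algebra_simps power2_eq_square)
    finally have "Re (resolvent n C Y r r) * coresolvent n C Y c = (\<alpha> * \<delta> - (cmod b)\<^sup>2) / (1 + k)\<^sup>2" .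
    moreover have "1 \<le> 1 + k" using k0 by simp
    ultimately show ?thesis using ov unfolding k1 hr \<zeta>_def[symmetric] by (intro conjI)
  qed
  have upd: "1 \<le> \<alpha> + 2 * Re (cnj \<zeta> * b) + \<delta> * (cmod \<zeta>)\<^sup>2" for \<zeta>
  proof -
    define Y where "Y i j = (if (i, j) = (r, c) then \<zeta> else X i j)" for i j
    have Yrc: "Y r c = \<zeta>" by (simp add: Y_def)
    have "1 \<le> \<alpha> + 2 * Re (cnj (Y r c) * b) + \<delta> * (cmod (Y r c))\<^sup>2"
      by (rule conjunct1[OF main]) (auto simp: Y_def)
    then show ?thesis unfolding Yrc .
  qed
  \<comment> \<open>Read off the product formula at \<open>X\<close>, whose left side is a product
    of nonnegative factors.\<close>
  have "(cmod b)\<^sup>2 \<le> \<alpha> * \<delta>"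
  proof -
    have "Re (resolvent n C X r r) * coresolvent n C X c = (\<alpha> * \<delta> - (cmod b)\<^sup>2) /
         (\<alpha> + 2 * Re (cnj (X r c) * b) + \<delta> * (cmod (X r c))\<^sup>2)\<^sup>2" using main[of X] by simp
    moreover have "0 \<le> Re (resolvent n C X r r) * coresolvent n C X c"
      using resolvent_diag_bounds(1)[OF C r] coresolvent_bounds(1)[OF C c] by simp
    moreover have "(\<alpha> + 2 * Re (cnj (X r c) * b) + \<delta> * (cmod (X r c))\<^sup>2)\<^sup>2 > 0"
      using upd[of "X r c"] by (intro zero_less_power) linarith
    ultimately show ?thesis by (simp add: zero_le_divide_iff)
  qed
  from that[OF \<delta>0 this upd conjunct2[OF main]] show ?thesis .
qed

section \<open>The complex Gaussian measure\<close>

text \<open>Law of the real and of the imaginary part: the unit variance of the complex variable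
  splits into two halves.\<close>

abbreviation half_normal :: "real measure" where
  "half_normal \<equiv> density lborel (\<lambda>x. ennreal (normal_density 0 (1 / sqrt 2) x))"

lemma half_normal_density: "normal_density 0 (1 / sqrt 2) x = exp (- x\<^sup>2) / sqrt pi"
  by (simp add: normal_density_def power_divide)

lemma prob_space_half_normal: "prob_space half_normal"
  by (rule prob_space_normal_density) simp

lemma measurable_Complex [measurable]:
  "(\<lambda>(x, y). Complex x y) \<in> borel \<Otimes>\<^sub>M borel \<rightarrow>\<^sub>M borel"
  unfolding borel_measurable_complex_iff by (simp add: case_prod_beta)

lemma lborel_complex: "lborel = distr (lborel \<Otimes>\<^sub>M lborel) borel (\<lambda>(x, y). Complex x y)"
proof (rule lborel_eqI)
  fix l u :: complex assume le: "\<And>b. b \<in> Basis \<Longrightarrow> l \<bullet> b \<le> u \<bullet> b"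
  have "Re l \<le> Re u" "Im l \<le> Im u"
    using le[of 1] le[of \<i>] by (auto simp: Basis_complex_def inner_complex_def)
  have vim: "(\<lambda>(x, y). Complex x y) -` box l u \<inter> space (lborel \<Otimes>\<^sub>M lborel) =
      {Re l<..<Re u} \<times> {Im l<..<Im u}"
    by (auto simp: box_def Basis_complex_def inner_complex_def space_pair_measure)
  have "emeasure (distr (lborel \<Otimes>\<^sub>M lborel) borel (\<lambda>(x, y). Complex x y)) (box l u) =
      emeasure (lborel \<Otimes>\<^sub>M lborel) ({Re l<..<Re u} \<times> {Im l<..<Im u})"
    by (subst emeasure_distr) (simp_all add: vim)
  also have "\<dots> = ennreal (Re u - Re l) * ennreal (Im u - Im l)"
    using \<open>Re l \<le> Re u\<close> \<open>Im l \<le> Im u\<close> by (subst lborel.emeasure_pair_measure_Times) auto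
  also have "\<dots> = (\<Prod>b\<in>Basis. (u - l) \<bullet> b)"
    using \<open>Re l \<le> Re u\<close> \<open>Im l \<le> Im u\<close>
    by (simp add: Basis_complex_def inner_complex_def ennreal_mult)
  finally show "emeasure (distr (lborel \<Otimes>\<^sub>M lborel) borel (\<lambda>(x, y). Complex x y)) (box l u) =
      ennreal (\<Prod>b\<in>Basis. (u - l) \<bullet> b)" .
qed simp

lemma CN01_eq: "CN01 = distr (half_normal \<Otimes>\<^sub>M half_normal) borel (\<lambda>(x, y). Complex x y)"
proof -
  interpret prob_space half_normal by (rule prob_space_half_normal)
  have "CN01 = distr (density (lborel \<Otimes>\<^sub>M lborel)
      (\<lambda>p. ennreal (exp (- ((cmod (case p of (x, y) \<Rightarrow> Complex x y))\<^sup>2)) / pi))) borel (\<lambda>(x, y). Complex x y)"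
    unfolding CN01_def by (subst lborel_complex) (rule density_distr; measurable)
  also have "density (lborel \<Otimes>\<^sub>M lborel) (\<lambda>p. ennreal (exp (- ((cmod (case p of (x, y) \<Rightarrow> Complex x y))\<^sup>2)) / pi)) =
      density (lborel \<Otimes>\<^sub>M lborel)
        (\<lambda>(x, y). ennreal (normal_density 0 (1 / sqrt 2) x) * ennreal (normal_density 0 (1 / sqrt 2) y))"
  proof -
    have "exp (- (x\<^sup>2 + y\<^sup>2)) / pi = (exp (- x\<^sup>2) / sqrt pi) * (exp (- y\<^sup>2) / sqrt pi)" for x y
      by (simp add: exp_add[symmetric])
    then show ?thesis
      by (intro arg_cong[where f = "density _"] ext)
         (auto simp: half_normal_density cmod_power2 ennreal_mult[symmetric])
  qed
  also have "\<dots> = half_normal \<Otimes>\<^sub>M half_normal"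
    by (rule pair_measure_density[symmetric]) (auto intro: lborel.sigma_finite_measure_axioms sigma_finite_measure_axioms)
  finally show ?thesis .
qed

lemma sets_CN01 [measurable_cong, simp]: "sets CN01 = sets borel"
  by (simp add: CN01_def)

lemma space_CN01 [simp]: "space CN01 = UNIV"
  by (simp add: CN01_def)

lemma prob_space_CN01: "prob_space CN01"
proof -
  interpret N: prob_space half_normal by (rule prob_space_half_normal)
  interpret NN: pair_prob_space half_normal half_normal ..
  show ?thesis unfolding CN01_eq by (intro NN.prob_space_distr) measurable
qed

text \<open>Integration by parts acts on the inner variable, once the real and once the imaginary
  part; hence both orders of integration.\<close>

lemma integral_CN01:
  fixes f :: "complex \<Rightarrow> real"
  assumes "integrable CN01 f"
  shows "(\<integral>z. f z \<partial>CN01) = (\<integral>x. \<integral>y. f (Complex x y) \<partial>half_normal \<partial>half_normal)"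
    and "(\<integral>z. f z \<partial>CN01) = (\<integral>y. \<integral>x. f (Complex x y) \<partial>half_normal \<partial>half_normal)"
proof -
  interpret N: prob_space half_normal by (rule prob_space_half_normal)
  interpret NN: pair_prob_space half_normal half_normal ..
  have [measurable]: "f \<in> borel_measurable borel" using borel_measurable_integrable[OF assms] by simp
  have int: "integrable (half_normal \<Otimes>\<^sub>M half_normal) (\<lambda>(x, y). f (Complex x y))"
    using assms unfolding CN01_eq by (subst (asm) integrable_distr_eq) (auto simp: case_prod_beta')
  have eq: "(\<integral>z. f z \<partial>CN01) = (\<integral>p. (case p of (x, y) \<Rightarrow> f (Complex x y)) \<partial>(half_normal \<Otimes>\<^sub>M half_normal))"
    unfolding CN01_eq by (subst integral_distr) (auto simp: case_prod_beta')
  show "(\<integral>z. f z \<partial>CN01) = (\<integral>x. \<integral>y. f (Complex x y) \<partial>half_normal \<partial>half_normal)"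
    unfolding eq using NN.integral_fst'[OF int] by simp
  show "(\<integral>z. f z \<partial>CN01) = (\<integral>y. \<integral>x. f (Complex x y) \<partial>half_normal \<partial>half_normal)"
    unfolding eq using NN.integral_snd[OF int] by simp
qed

lemma integrable_half_normal_power: "integrable half_normal (\<lambda>x. x ^ k)" "integrable half_normal (\<lambda>x. \<bar>x\<bar> ^ k)"
proof -
  have "integrable lborel (\<lambda>x. normal_density 0 (1 / sqrt 2) x * (x - 0) ^ k)"
    by (rule integrable_normal_moment) simp
  then show "integrable half_normal (\<lambda>x. x ^ k)"
    by (subst integrable_density) auto
  have "integrable lborel (\<lambda>x. normal_density 0 (1 / sqrt 2) x * \<bar>x - 0\<bar> ^ k)"
    by (rule integrable_normal_moment_abs) simp
  then show "integrable half_normal (\<lambda>x. \<bar>x\<bar> ^ k)"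
    by (subst integrable_density) auto
qed

lemma integrable_CN01_cmod_sq: "integrable CN01 (\<lambda>z. (cmod z)\<^sup>2)"
proof -
  interpret N: prob_space half_normal by (rule prob_space_half_normal)
  interpret NN: pair_prob_space half_normal half_normal ..
  have "integrable (distr (half_normal \<Otimes>\<^sub>M half_normal) half_normal fst) (\<lambda>x. x\<^sup>2)"
    unfolding N.distr_pair_fst by (rule integrable_half_normal_power(1))
  then have fst: "integrable (half_normal \<Otimes>\<^sub>M half_normal) (\<lambda>p. (fst p)\<^sup>2)"
    by (rule integrable_distr[OF measurable_fst])
  from NN.integrable_product_swap[OF this]
  have snd: "integrable (half_normal \<Otimes>\<^sub>M half_normal) (\<lambda>p. (snd p)\<^sup>2)"
    by (simp add: case_prod_beta')
  have "integrable (half_normal \<Otimes>\<^sub>M half_normal) (\<lambda>(x, y). x\<^sup>2 * 1 + 1 * y\<^sup>2 :: real)"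
    unfolding case_prod_beta'
    by (intro Bochner_Integration.integrable_add) (simp_all add: fst snd)
  then show ?thesis
    unfolding CN01_eq
    by (subst integrable_distr_eq) (auto simp: case_prod_beta' cmod_power2)
qed

text \<open>The density \<open>?\<phi>\<close> has derivative \<open>- 2 * x * ?\<phi> x\<close>, so
  \<open>(f' x - 2 * x * f x) * ?\<phi> x\<close> is the derivative of
  \<open>f x * ?\<phi> x\<close>, which vanishes at both ends. The factor 1/2 is the
  variance.\<close>

lemma half_normal_stein:
  fixes f f' :: "real \<Rightarrow> real"
  assumes deriv: "\<And>x. (f has_real_derivative f' x) (at x)"
    and cont: "\<And>x. isCont f' x"
    and bnd: "\<And>x. \<bar>f x\<bar> \<le> K" "\<And>x. \<bar>f' x\<bar> \<le> K'"
  shows "(\<integral>x. x * f x \<partial>half_normal) = (\<integral>x. f' x \<partial>half_normal) / 2"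
proof -
  interpret N: prob_space half_normal by (rule prob_space_half_normal)
  let ?\<phi> = "normal_density 0 (1 / sqrt 2)"
  have contf: "isCont f x" for x using deriv DERIV_isCont by blast
  have [measurable]: "f \<in> borel_measurable borel" "f' \<in> borel_measurable borel"
    using contf cont by (auto intro!: borel_measurable_continuous_onI simp: continuous_on_eq_continuous_at)
  have int1: "integrable half_normal f'"
    by (rule N.integrable_const_bound[of _ K']) (auto simp: bnd)
  have int2: "integrable half_normal (\<lambda>x. x * f x)"
  proof (rule Bochner_Integration.integrable_bound)
    show "integrable half_normal (\<lambda>x. K * \<bar>x\<bar> ^ 1)"
      by (rule integrable_mult_right) (rule integrable_half_normal_power(2))
    have "norm (x * f x) \<le> norm (K * \<bar>x\<bar> ^ 1)" for x
      using mult_right_mono[OF order_trans[OF bnd(1)[of x] abs_ge_self], of "\<bar>x\<bar>"]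
      by (simp add: abs_mult mult.commute)
    then show "AE x in half_normal. norm (x * f x) \<le> norm (K * \<bar>x\<bar> ^ 1)" by simp
  qed measurable
  define F where "F x = f x * ?\<phi> x" for x
  have \<phi>': "(?\<phi> has_real_derivative - 2 * x * ?\<phi> x) (at x)" for x
  proof -
    have "((\<lambda>x. exp (- x\<^sup>2)) has_real_derivative - 2 * x * exp (- x\<^sup>2)) (at x)"
      by (auto intro!: derivative_eq_intros)
    from DERIV_cdivide[OF this, of "sqrt pi"] show ?thesis
      unfolding half_normal_density[abs_def] by simp
  qed
  have F': "(F has_vector_derivative (f' x - 2 * x * f x) * ?\<phi> x) (at x)" for x
    unfolding F_def has_real_derivative_iff_has_vector_derivative[symmetric]
    by (rule DERIV_cong[OF DERIV_mult[OF deriv \<phi>']]) (simp add: algebra_simps)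
  have int: "integrable lborel (\<lambda>x. (f' x - 2 * x * f x) * ?\<phi> x)"
  proof -
    have "integrable half_normal (\<lambda>x. f' x - 2 * (x * f x))"
      using int1 int2 by auto
    then show ?thesis by (subst (asm) integrable_density) (auto simp: mult_ac)
  qed
  have lim: "(F \<longlongrightarrow> 0) at_top" "(F \<longlongrightarrow> 0) at_bot"
  proof -
    have "((\<lambda>x::real. exp (- x\<^sup>2) / sqrt pi) \<longlongrightarrow> 0) at_top" by real_asymp
    then have "(?\<phi> \<longlongrightarrow> 0) at_top" by (simp add: half_normal_density[abs_def])
    then have 1: "((\<lambda>x. K * ?\<phi> x) \<longlongrightarrow> 0) at_top" by (rule tendsto_mult_right_zero)
    have "((\<lambda>x::real. exp (- x\<^sup>2) / sqrt pi) \<longlongrightarrow> 0) at_bot" by real_asymp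
    then have "(?\<phi> \<longlongrightarrow> 0) at_bot" by (simp add: half_normal_density[abs_def])
    then have 2: "((\<lambda>x. K * ?\<phi> x) \<longlongrightarrow> 0) at_bot" by (rule tendsto_mult_right_zero)
    have b: "norm (F x) \<le> K * ?\<phi> x" for x
      unfolding F_def by (simp add: abs_mult mult_right_mono bnd)
    show "(F \<longlongrightarrow> 0) at_top" by (rule Lim_null_comparison[OF always_eventually 1]) (use b in blast)
    show "(F \<longlongrightarrow> 0) at_bot" by (rule Lim_null_comparison[OF always_eventually 2]) (use b in blast)
  qed
  have "(LBINT x=-\<infinity>..\<infinity>. (f' x - 2 * x * f x) * ?\<phi> x) = 0 - 0"
  proof (rule interval_integral_FTC_integrable)
    show "isCont (\<lambda>x. (f' x - 2 * x * f x) * ?\<phi> x) x" for x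
      unfolding half_normal_density by (intro continuous_intros cont contf) auto
    show "set_integrable lborel (einterval (- \<infinity>) \<infinity>) (\<lambda>x. (f' x - 2 * x * f x) * ?\<phi> x)"
      using int by (simp add: set_integrable_def)
    show "((F \<circ> real_of_ereal) \<longlongrightarrow> 0) (at_right (- \<infinity>))"
      using lim(2) by (simp add: ereal_tendsto_simps)
    show "((F \<circ> real_of_ereal) \<longlongrightarrow> 0) (at_left \<infinity>)"
      using lim(1) by (simp add: ereal_tendsto_simps)
  qed (use F' in auto)
  then have "(\<integral>x. (f' x - 2 * x * f x) * ?\<phi> x \<partial>lborel) = 0"
    by (simp add: interval_lebesgue_integral_def set_lebesgue_integral_def)
  moreover have "(\<integral>x. (f' x - 2 * x * f x) * ?\<phi> x \<partial>lborel) = (\<integral>x. f' x - 2 * (x * f x) \<partial>half_normal)"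
    by (subst integral_density) (auto simp: mult_ac)
  moreover have "\<dots> = (\<integral>x. f' x \<partial>half_normal) - 2 * (\<integral>x. x * f x \<partial>half_normal)"
    using int1 int2 by simp
  ultimately show ?thesis by simp
qed

text \<open>Stein's identity for the gradient of \<open>ln p\<close>: the two real components of
  \<open>(b + \<delta> z) / p z\<close> are half the partial derivatives of \<open>ln p\<close>, and
  half the divergence of this field is the right integrand. With the coefficients of
  \<open>single_entry_dependence\<close> the integrands are the overlap and the product of the
  diagonal entries of resolvent and coresolvent.\<close>

lemma CN01_stein_quadratic:
  fixes \<alpha> \<delta> :: real and b :: complex
  assumes \<delta>: "\<delta> \<ge> 0" and disc: "(cmod b)\<^sup>2 \<le> \<alpha> * \<delta>"
  defines "p \<equiv> \<lambda>z. \<alpha> + 2 * Re (cnj z * b) + \<delta> * (cmod z)\<^sup>2"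
  assumes p1: "\<And>z. p z \<ge> 1"
  shows "(\<integral>z. Re (cnj z * (b + of_real \<delta> * z)) / p z \<partial>CN01) =
     (\<integral>z. (\<alpha> * \<delta> - (cmod b)\<^sup>2) / (p z)\<^sup>2 \<partial>CN01)"
proof -
  interpret N: prob_space half_normal by (rule prob_space_half_normal)
  interpret prob_space CN01 by (rule prob_space_CN01)
  let ?b1 = "Re b" and ?b2 = "Im b"
  define q where "q x y = p (Complex x y)" for x y
  have q: "q x y = \<alpha> + 2 * (?b1 * x + ?b2 * y) + \<delta> * (x\<^sup>2 + y\<^sup>2)" for x y
    by (simp add: q_def p_def cmod_power2 algebra_simps)
  have q1: "q x y \<ge> 1" for x y unfolding q_def by (rule p1)
  define f1 where "f1 x y = (?b1 + \<delta> * x) / q x y" for x y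
  define f2 where "f2 x y = (?b2 + \<delta> * y) / q x y" for x y
  define g1 where "g1 x y = \<delta> / q x y - 2 * (f1 x y)\<^sup>2" for x y
  define g2 where "g2 x y = \<delta> / q x y - 2 * (f2 x y)\<^sup>2" for x y
  \<comment> \<open>Completing the square: the difference does not depend on the point. It bounds
    \<open>f1\<close> and \<open>f2\<close> through \<open>disc\<close> and later evaluates the
    divergence.\<close>
  have key: "\<delta> * q x y - ((?b1 + \<delta> * x)\<^sup>2 + (?b2 + \<delta> * y)\<^sup>2) = \<alpha> * \<delta> - (cmod b)\<^sup>2" for x y
    unfolding q cmod_power2 by (simp add: algebra_simps power2_eq_square)
  have f_bound: "(f1 x y)\<^sup>2 + (f2 x y)\<^sup>2 \<le> \<delta>" for x y
  proof -
    have "(?b1 + \<delta> * x)\<^sup>2 + (?b2 + \<delta> * y)\<^sup>2 \<le> \<delta> * q x y" using key[of x y] disc by linarith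
    also have "\<dots> \<le> \<delta> * (q x y * q x y)"
      using q1[of x y] \<delta> by (intro mult_left_mono) auto
    finally show ?thesis unfolding f1_def f2_def power_divide add_divide_distrib[symmetric]
      using q1[of x y] by (subst pos_divide_le_eq) (auto simp: power2_eq_square)
  qed
  then have sq: "(f1 x y)\<^sup>2 \<le> \<delta>" "(f2 x y)\<^sup>2 \<le> \<delta>" for x y
    by (smt (verit) zero_le_power2)+
  then have ab: "\<bar>f1 x y\<bar> \<le> sqrt \<delta>" "\<bar>f2 x y\<bar> \<le> sqrt \<delta>" for x y
    by (simp_all add: real_le_rsqrt)
  have dq: "0 \<le> \<delta> / q x y \<and> \<delta> / q x y \<le> \<delta>" for x y
    using q1[of x y] \<delta> by (simp add: divide_le_eq mult_left_mono[of 1 "q x y" \<delta>, simplified])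
  have gb: "\<bar>g1 x y\<bar> \<le> 2 * \<delta>" "\<bar>g2 x y\<bar> \<le> 2 * \<delta>" for x y
    unfolding g1_def g2_def using sq[of x y] dq[of x y] by (smt (verit) zero_le_power2)+
  have qne: "q x y \<noteq> 0" for x y using q1[of x y] by linarith
  have qd1: "((\<lambda>x. q x y) has_real_derivative 2 * (?b1 + \<delta> * x)) (at x)" for x y
    unfolding q by (auto intro!: derivative_eq_intros simp: algebra_simps)
  have qd2: "((\<lambda>y. q x y) has_real_derivative 2 * (?b2 + \<delta> * y)) (at y)" for x y
    unfolding q by (auto intro!: derivative_eq_intros simp: algebra_simps)
  have d1: "((\<lambda>x. f1 x y) has_real_derivative g1 x y) (at x)" for x y
    unfolding f1_def g1_def
    by (rule derivative_eq_intros qd1 qne refl | simp)+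
       (simp add: qne field_simps power2_eq_square)
  have d2: "((\<lambda>y. f2 x y) has_real_derivative g2 x y) (at y)" for x y
    unfolding f2_def g2_def
    by (rule derivative_eq_intros qd2 qne refl | simp)+
       (simp add: qne field_simps power2_eq_square)
  have c1: "isCont (\<lambda>x. g1 x y) x" for x y
    unfolding g1_def f1_def by (intro continuous_intros DERIV_isCont[OF qd1] qne)
  have c2: "isCont (\<lambda>y. g2 x y) y" for x y
    unfolding g2_def f2_def by (intro continuous_intros DERIV_isCont[OF qd2] qne)
  have s1: "(\<integral>x. x * f1 x y \<partial>half_normal) = (\<integral>x. g1 x y \<partial>half_normal) / 2" for y
    by (rule half_normal_stein[OF d1 c1 ab(1) gb(1)])
  have s2: "(\<integral>y. y * f2 x y \<partial>half_normal) = (\<integral>y. g2 x y \<partial>half_normal) / 2" for x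
    by (rule half_normal_stein[OF d2 c2 ab(2) gb(2)])
  have m [measurable]: "p \<in> borel_measurable borel" 
    unfolding p_def by (intro borel_measurable_continuous_onI continuous_intros)
  have int_lin: "integrable CN01 (\<lambda>z. Re z * f1 (Re z) (Im z))" "integrable CN01 (\<lambda>z. Im z * f2 (Re z) (Im z))"
  proof -
    have i: "integrable CN01 (\<lambda>z. sqrt \<delta> * (1 + (cmod z)\<^sup>2))"
      by (intro integrable_mult_right Bochner_Integration.integrable_add integrable_CN01_cmod_sq) auto
    have le: "\<bar>a\<bar> \<le> 1 + (cmod z)\<^sup>2" if "\<bar>a\<bar> \<le> cmod z" for a z
      using that zero_le_power2[of "cmod z - 1"] norm_ge_zero[of z] by (simp add: power2_diff)
    show "integrable CN01 (\<lambda>z. Re z * f1 (Re z) (Im z))"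
    proof (rule Bochner_Integration.integrable_bound[OF i])
      have "norm (Re z * f1 (Re z) (Im z)) \<le> norm (sqrt \<delta> * (1 + (cmod z)\<^sup>2))" for z
      proof -
        have "\<bar>Re z\<bar> * \<bar>f1 (Re z) (Im z)\<bar> \<le> (1 + (cmod z)\<^sup>2) * sqrt \<delta>"
          by (intro mult_mono le abs_Re_le_cmod ab) auto
        then show ?thesis using \<delta> by (simp add: abs_mult mult.commute)
      qed
      then show "AE z in CN01. norm (Re z * f1 (Re z) (Im z)) \<le> norm (sqrt \<delta> * (1 + (cmod z)\<^sup>2))" by simp
    qed (simp add: f1_def q_def)
    show "integrable CN01 (\<lambda>z. Im z * f2 (Re z) (Im z))"
    proof (rule Bochner_Integration.integrable_bound[OF i])
      have "norm (Im z * f2 (Re z) (Im z)) \<le> norm (sqrt \<delta> * (1 + (cmod z)\<^sup>2))" for z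
      proof -
        have "\<bar>Im z\<bar> * \<bar>f2 (Re z) (Im z)\<bar> \<le> (1 + (cmod z)\<^sup>2) * sqrt \<delta>"
          by (intro mult_mono le abs_Im_le_cmod ab) auto
        then show ?thesis using \<delta> by (simp add: abs_mult mult.commute)
      qed
      then show "AE z in CN01. norm (Im z * f2 (Re z) (Im z)) \<le> norm (sqrt \<delta> * (1 + (cmod z)\<^sup>2))" by simp
    qed (simp add: f2_def q_def)
  qed
  have int_g: "integrable CN01 (\<lambda>z. g1 (Re z) (Im z))" "integrable CN01 (\<lambda>z. g2 (Re z) (Im z))"
    by (rule integrable_const_bound[of _ "2 * \<delta>"], simp add: gb, simp add: g1_def g2_def f1_def f2_def q_def)+
  have "(\<integral>z. Re (cnj z * (b + of_real \<delta> * z)) / p z \<partial>CN01) =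
      (\<integral>z. Re z * f1 (Re z) (Im z) + Im z * f2 (Re z) (Im z) \<partial>CN01)"
    by (intro Bochner_Integration.integral_cong refl)
       (simp add: f1_def f2_def q_def add_divide_distrib distrib_left)
  also have "\<dots> = (\<integral>z. Re z * f1 (Re z) (Im z) \<partial>CN01) + (\<integral>z. Im z * f2 (Re z) (Im z) \<partial>CN01)"
    using int_lin by simp
  also have "(\<integral>z. Re z * f1 (Re z) (Im z) \<partial>CN01) = (\<integral>z. g1 (Re z) (Im z) \<partial>CN01) / 2"
    unfolding integral_CN01(2)[OF int_lin(1)] integral_CN01(2)[OF int_g(1)] by (simp add: s1)
  also have "(\<integral>z. Im z * f2 (Re z) (Im z) \<partial>CN01) = (\<integral>z. g2 (Re z) (Im z) \<partial>CN01) / 2"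
    unfolding integral_CN01(1)[OF int_lin(2)] integral_CN01(1)[OF int_g(2)] by (simp add: s2)
  also have "(\<integral>z. g1 (Re z) (Im z) \<partial>CN01) / 2 + (\<integral>z. g2 (Re z) (Im z) \<partial>CN01) / 2 =
      (\<integral>z. (g1 (Re z) (Im z) + g2 (Re z) (Im z)) / 2 \<partial>CN01)"
    using int_g by (simp add: add_divide_distrib)
  also have "\<dots> = (\<integral>z. (\<alpha> * \<delta> - (cmod b)\<^sup>2) / (p z)\<^sup>2 \<partial>CN01)"
  proof (intro Bochner_Integration.integral_cong refl)
    fix z
    let ?x = "Re z" and ?y = "Im z"
    have gen: "(\<delta> / Q - 2 * (u / Q)\<^sup>2 + (\<delta> / Q - 2 * (v / Q)\<^sup>2)) / 2 = (\<delta> * Q - (u\<^sup>2 + v\<^sup>2)) / Q\<^sup>2"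
      if "Q \<noteq> 0" for Q u v :: real
      using that by (simp add: field_simps power2_eq_square)
    have "(g1 ?x ?y + g2 ?x ?y) / 2 =
        (\<delta> * q ?x ?y - ((?b1 + \<delta> * ?x)\<^sup>2 + (?b2 + \<delta> * ?y)\<^sup>2)) / (q ?x ?y)\<^sup>2"
      unfolding g1_def g2_def f1_def f2_def by (rule gen[OF qne])
    then show "(g1 (Re z) (Im z) + g2 (Re z) (Im z)) / 2 = (\<alpha> * \<delta> - (cmod b)\<^sup>2) / (p z)\<^sup>2"
      unfolding key by (simp only: q_def complex.collapse)
  qed
  finally show ?thesis .
qed

section \<open>Concentration\<close>

lemma (in prob_space) second_moment_bounded:
  fixes h :: "'a \<Rightarrow> real"
  assumes [measurable]: "h \<in> borel_measurable M" and K: "\<And>x. \<bar>h x\<bar> \<le> K"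
  shows "integrable M h" "integrable M (\<lambda>x. (h x)\<^sup>2)"
    "expectation (\<lambda>x. (h x - expectation h)\<^sup>2) = expectation (\<lambda>x. (h x)\<^sup>2) - (expectation h)\<^sup>2"
proof -
  show 1: "integrable M h" by (rule integrable_const_bound[of _ K]) (auto simp: K)
  have "(h x)\<^sup>2 \<le> K\<^sup>2" for x using power_mono[OF K[of x], of 2] by simp
  then show 2: "integrable M (\<lambda>x. (h x)\<^sup>2)"
    by (intro integrable_const_bound[of _ "K\<^sup>2"]) auto
  show "expectation (\<lambda>x. (h x - expectation h)\<^sup>2) = expectation (\<lambda>x. (h x)\<^sup>2) - (expectation h)\<^sup>2"
    by (rule variance_eq[OF 1 2])
qed

lemma (in prob_space) variance_oscillation:
  fixes h :: "'a \<Rightarrow> real"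
  assumes [measurable]: "h \<in> borel_measurable M" and K: "\<And>x. \<bar>h x\<bar> \<le> K"
    and osc: "\<And>x y. x \<in> space M \<Longrightarrow> y \<in> space M \<Longrightarrow> \<bar>h x - h y\<bar> \<le> d"
  shows "expectation (\<lambda>x. (h x)\<^sup>2) - (expectation h)\<^sup>2 \<le> d\<^sup>2"
proof -
  have int: "integrable M h" by (rule second_moment_bounded(1)[OF assms(1) K])
  have dev: "(h x - expectation h)\<^sup>2 \<le> d\<^sup>2" if x: "x \<in> space M" for x
  proof -
    have "h x - expectation h = expectation (\<lambda>y. h x - h y)" using int by (simp add: prob_space)
    also have "\<bar>\<dots>\<bar> \<le> expectation (\<lambda>y. \<bar>h x - h y\<bar>)" by (rule integral_abs_bound)
    also have "\<dots> \<le> expectation (\<lambda>y. d)" using int osc x by (intro integral_mono) auto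
    also have "\<dots> = d" by (simp add: prob_space)
    finally show ?thesis using power_mono[of "\<bar>h x - expectation h\<bar>" d 2] by simp
  qed
  have "expectation (\<lambda>x. (h x - expectation h)\<^sup>2) \<le> expectation (\<lambda>x. d\<^sup>2)"
  proof (rule integral_mono)
    have "integrable M (\<lambda>x. (h x)\<^sup>2 - 2 * expectation h * h x + (expectation h)\<^sup>2)"
      using second_moment_bounded(1,2)[OF assms(1) K] by auto
    then show "integrable M (\<lambda>x. (h x - expectation h)\<^sup>2)" by (simp add: power2_diff algebra_simps)
  qed (auto simp: dev)
  also have "\<dots> = d\<^sup>2" by (simp add: prob_space)
  finally show ?thesis using second_moment_bounded(3)[OF assms(1) K] by simp
qed

text \<open>The mean absolute deviation of \<open>g\<close> is at most \<open>sqrt V\<close>, and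
  \<open>h\<close> is bounded by \<open>H\<close>. Only one factor has to concentrate, so a variance
  bound for the row traces will do.\<close>

lemma (in prob_space) covariance_le_sqrt_variance:
  fixes g h :: "'a \<Rightarrow> real"
  assumes [measurable]: "g \<in> borel_measurable M" "h \<in> borel_measurable M"
    and K: "\<And>x. \<bar>g x\<bar> \<le> K" and H: "\<And>x. \<bar>h x\<bar> \<le> H"
    and V: "expectation (\<lambda>x. (g x)\<^sup>2) - (expectation g)\<^sup>2 \<le> V"
  shows "\<bar>expectation (\<lambda>x. g x * h x) - expectation g * expectation h\<bar> \<le> sqrt V * H"
proof -
  let ?e = "expectation g"
  have ig: "integrable M g" and ih: "integrable M h"
    using second_moment_bounded(1) K H assms(1,2) by blast+
  have igh: "integrable M (\<lambda>x. g x * h x)"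
    by (rule integrable_const_bound[of _ "K * H"])
       (auto simp: abs_mult intro!: mult_mono K H order_trans[OF abs_ge_zero K])
  define z where "z x = \<bar>g x - ?e\<bar>" for x
  have zm [measurable]: "z \<in> borel_measurable M" unfolding z_def by measurable
  have zK: "\<bar>z x\<bar> \<le> K + \<bar>?e\<bar>" for x
    using K[of x] abs_triangle_ineq4[of "g x" ?e] by (simp add: z_def)
  \<comment> \<open>Cauchy-Schwarz, in the form that the variance of \<open>z\<close> is
    nonnegative.\<close>
  have "0 \<le> expectation (\<lambda>x. (z x - expectation z)\<^sup>2)" by simp
  also have "\<dots> = expectation (\<lambda>x. (z x)\<^sup>2) - (expectation z)\<^sup>2"
    by (rule second_moment_bounded(3)[OF zm zK])
  also have "expectation (\<lambda>x. (z x)\<^sup>2) = expectation (\<lambda>x. (g x)\<^sup>2) - ?e\<^sup>2"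
    unfolding z_def power2_abs by (rule second_moment_bounded(3)[OF assms(1) K])
  finally have "(expectation z)\<^sup>2 \<le> V" using V by simp
  then have zV: "expectation z \<le> sqrt V" by (rule real_le_rsqrt)
  have "expectation (\<lambda>x. g x * h x) - ?e * expectation h = expectation (\<lambda>x. (g x - ?e) * h x)"
    using igh ih by (simp add: left_diff_distrib)
  also have "\<bar>\<dots>\<bar> \<le> expectation (\<lambda>x. \<bar>(g x - ?e) * h x\<bar>)" by (rule integral_abs_bound)
  also have "\<dots> \<le> expectation (\<lambda>x. z x * H)"
  proof (rule integral_mono)
    show "integrable M (\<lambda>x. \<bar>(g x - ?e) * h x\<bar>)"
      using igh ih by (simp add: left_diff_distrib)
    show "integrable M (\<lambda>x. z x * H)" using second_moment_bounded(1)[OF zm zK] by simp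
    show "\<bar>(g x - ?e) * h x\<bar> \<le> z x * H" for x
      unfolding abs_mult z_def by (intro mult_left_mono H) auto
  qed
  also have "\<dots> = expectation z * H" by simp
  also have "\<dots> \<le> sqrt V * H"
    using zV H order_trans[OF abs_ge_zero H] by (intro mult_right_mono) auto
  finally show ?thesis .
qed

text \<open>Efron--Stein. The coordinates are grouped into blocks \<open>J l\<close> because the bound must count
  the columns of a matrix, not its entries.\<close>

lemma variance_bounded_differences:
  fixes J :: "'l \<Rightarrow> 'i set" and f :: "('i \<Rightarrow> 'a) \<Rightarrow> real" and D :: "'a measure"
  assumes D: "prob_space D" and "finite L"
    and "\<And>l. l \<in> L \<Longrightarrow> finite (J l)" and "disjoint_family_on J L"
    and "f \<in> borel_measurable (PiM (\<Union>l\<in>L. J l) (\<lambda>_. D))"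
    and "\<And>\<omega>. \<bar>f \<omega>\<bar> \<le> K"
    and "\<And>l \<omega> \<omega>'. l \<in> L \<Longrightarrow> \<omega> \<in> space (PiM (\<Union>l\<in>L. J l) (\<lambda>_. D)) \<Longrightarrow>
      \<omega>' \<in> space (PiM (\<Union>l\<in>L. J l) (\<lambda>_. D)) \<Longrightarrow> (\<And>i. i \<notin> J l \<Longrightarrow> \<omega> i = \<omega>' i) \<Longrightarrow> \<bar>f \<omega> - f \<omega>'\<bar> \<le> d"
  shows "(\<integral>\<omega>. (f \<omega>)\<^sup>2 \<partial>PiM (\<Union>l\<in>L. J l) (\<lambda>_. D)) - (\<integral>\<omega>. f \<omega> \<partial>PiM (\<Union>l\<in>L. J l) (\<lambda>_. D))\<^sup>2
    \<le> real (card L) * d\<^sup>2"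
  using assms(2-)
proof (induction L arbitrary: f rule: finite_induct)
  case empty
  let ?P = "PiM {} (\<lambda>_. D) :: ('i \<Rightarrow> 'a) measure"
  interpret P: prob_space ?P by (rule prob_space_PiM) (rule D)
  have "(\<integral>\<omega>. (f \<omega>)\<^sup>2 \<partial>?P) = (\<integral>\<omega>. (f (\<lambda>_. undefined))\<^sup>2 \<partial>?P)"
    by (rule Bochner_Integration.integral_cong) (auto simp: space_PiM)
  moreover have "(\<integral>\<omega>. f \<omega> \<partial>?P) = (\<integral>\<omega>. f (\<lambda>_. undefined) \<partial>?P)"
    by (rule Bochner_Integration.integral_cong) (auto simp: space_PiM)
  ultimately show ?case by (simp add: P.prob_space)
next
  case (insert l L)
  interpret D: prob_space D by (rule D)
  interpret PS: product_prob_space "\<lambda>_. D" by standard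
  let ?I = "\<Union>l\<in>L. J l"
  let ?PI = "PiM ?I (\<lambda>_. D)" and ?PJ = "PiM (J l) (\<lambda>_. D)"
  interpret PI: prob_space ?PI by (rule prob_space_PiM) (rule D)
  interpret PJ: prob_space ?PJ by (rule prob_space_PiM) (rule D)
  interpret PIJ: prob_space "PiM (?I \<union> J l) (\<lambda>_. D)" by (rule prob_space_PiM) (rule D)
  have un: "(\<Union>l'\<in>insert l L. J l') = ?I \<union> J l" by auto
  have disj: "?I \<inter> J l = {}" using insert.prems(2) insert.hyps(2)
    by (auto simp: disjoint_family_on_def)
  have fin: "finite ?I" "finite (J l)" using insert.hyps(1) insert.prems(1) by auto
  note K = insert.prems(4)
  have fm [measurable]: "f \<in> borel_measurable (PiM (?I \<union> J l) (\<lambda>_. D))"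
    using insert.prems(3) unfolding un .
  have mm: "merge ?I (J l) \<in> ?PI \<Otimes>\<^sub>M ?PJ \<rightarrow>\<^sub>M PiM (?I \<union> J l) (\<lambda>_. D)" by (rule measurable_merge)
  have ms: "merge ?I (J l) (x, y) \<in> space (PiM (?I \<union> J l) (\<lambda>_. D))"
    if "x \<in> space ?PI" "y \<in> space ?PJ" for x y
    using measurable_space[OF mm, of "(x, y)"] that by (simp add: space_pair_measure)
  note diff = insert.prems(5)[unfolded un]
  have fmm: "(\<lambda>p. f (merge ?I (J l) p)) \<in> borel_measurable (?PI \<Otimes>\<^sub>M ?PJ)"
    by (rule measurable_compose[OF mm fm])
  have fmx: "(\<lambda>y. f (merge ?I (J l) (x, y))) \<in> borel_measurable ?PJ" if "x \<in> space ?PI" for x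
    by (rule measurable_compose[OF measurable_Pair1'[OF that] fmm])
  \<comment> \<open>Integrating out block \<open>l\<close> gives the conditional mean
    \<open>F\<close> and the conditional second moment \<open>F2\<close>. In the law of total
    variance the conditional variance contributes at most \<open>d\<^sup>2\<close>, and
    \<open>F\<close> falls under the induction hypothesis.\<close>
  define F where "F x = (\<integral>y. f (merge ?I (J l) (x, y)) \<partial>?PJ)" for x
  define F2 where "F2 x = (\<integral>y. (f (merge ?I (J l) (x, y)))\<^sup>2 \<partial>?PJ)" for x
  have Fm: "F \<in> borel_measurable ?PI"
    unfolding F_def using fmm by (intro PJ.borel_measurable_lebesgue_integral) (simp add: case_prod_beta')
  have F2m: "F2 \<in> borel_measurable ?PI"
    unfolding F2_def using fmm by (intro PJ.borel_measurable_lebesgue_integral) (simp add: case_prod_beta')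
  have FK: "\<bar>F x\<bar> \<le> K" for x
  proof (cases "integrable ?PJ (\<lambda>y. f (merge ?I (J l) (x, y)))")
    case True
    have "\<bar>F x\<bar> \<le> (\<integral>y. \<bar>f (merge ?I (J l) (x, y))\<bar> \<partial>?PJ)" unfolding F_def by (rule integral_abs_bound)
    also have "\<dots> \<le> (\<integral>y. K \<partial>?PJ)" using True K by (intro integral_mono) auto
    finally show ?thesis by (simp add: PJ.prob_space)
  next
    \<comment> \<open>The bound on \<open>F\<close> is claimed for every \<open>x\<close>, also
      outside the space. If a section is not integrable, its integral is 0 by convention.\<close>
    case False
    then show ?thesis unfolding F_def using K[of undefined] by (simp add: not_integrable_integral_eq)
  qed
  have sqK: "(f \<omega>)\<^sup>2 \<le> K\<^sup>2" for \<omega> using power_mono[OF K[of \<omega>], of 2] by simp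
  have intf: "integrable (PiM (?I \<union> J l) (\<lambda>_. D)) f" "integrable (PiM (?I \<union> J l) (\<lambda>_. D)) (\<lambda>\<omega>. (f \<omega>)\<^sup>2)"
    using PIJ.second_moment_bounded(1,2)[OF fm K] by auto
  have E1: "(\<integral>\<omega>. f \<omega> \<partial>PiM (?I \<union> J l) (\<lambda>_. D)) = (\<integral>x. F x \<partial>?PI)"
    unfolding F_def by (rule PS.product_integral_fold[OF disj fin intf(1)])
  have E2: "(\<integral>\<omega>. (f \<omega>)\<^sup>2 \<partial>PiM (?I \<union> J l) (\<lambda>_. D)) = (\<integral>x. F2 x \<partial>?PI)"
    unfolding F2_def by (rule PS.product_integral_fold[OF disj fin intf(2)])
  have inner: "F2 x - (F x)\<^sup>2 \<le> d\<^sup>2" if x: "x \<in> space ?PI" for x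
    unfolding F_def F2_def
  proof (rule PJ.variance_oscillation[OF fmx[OF x] K])
    fix y y' assume "y \<in> space ?PJ" "y' \<in> space ?PJ"
    with x show "\<bar>f (merge ?I (J l) (x, y)) - f (merge ?I (J l) (x, y'))\<bar> \<le> d"
      by (intro diff[of l] ms) (auto simp: merge_def)
  qed
  have F2K: "\<bar>F2 x\<bar> \<le> K\<^sup>2" if x: "x \<in> space ?PI" for x
  proof -
    have "F2 x \<le> (\<integral>y. K\<^sup>2 \<partial>?PJ)"
      unfolding F2_def using sqK PJ.second_moment_bounded(2)[OF fmx[OF x] K] by (intro integral_mono) auto
    moreover have "F2 x \<ge> 0" unfolding F2_def by simp
    ultimately show ?thesis by (simp add: PJ.prob_space)
  qed
  have intF2: "integrable ?PI F2"
    by (rule PI.integrable_const_bound[of _ "K\<^sup>2"]) (use F2K F2m in auto)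
  have intFsq: "integrable ?PI (\<lambda>x. (F x)\<^sup>2)" by (rule PI.second_moment_bounded(2)[OF Fm FK])
  have "(\<integral>x. F2 x \<partial>?PI) - (\<integral>x. (F x)\<^sup>2 \<partial>?PI) = (\<integral>x. F2 x - (F x)\<^sup>2 \<partial>?PI)"
    using intF2 intFsq by simp
  also have "\<dots> \<le> (\<integral>x. d\<^sup>2 \<partial>?PI)" using intF2 intFsq inner by (intro integral_mono) auto
  finally have 1: "(\<integral>x. F2 x \<partial>?PI) - (\<integral>x. (F x)\<^sup>2 \<partial>?PI) \<le> d\<^sup>2" by (simp add: PI.prob_space)
  have 2: "(\<integral>x. (F x)\<^sup>2 \<partial>?PI) - (\<integral>x. F x \<partial>?PI)\<^sup>2 \<le> real (card L) * d\<^sup>2"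
  proof (rule insert.IH[OF _ _ Fm FK])
    show "finite (J l')" if "l' \<in> L" for l' using insert.prems(1) that by auto
    show "disjoint_family_on J L" using insert.prems(2) by (auto simp: disjoint_family_on_def)
    fix l' and \<omega> \<omega>' :: "'i \<Rightarrow> 'a"
    assume l': "l' \<in> L" and sp: "\<omega> \<in> space ?PI" "\<omega>' \<in> space ?PI"
      and eq: "\<And>i. i \<notin> J l' \<Longrightarrow> \<omega> i = \<omega>' i"
    have pd: "\<bar>f (merge ?I (J l) (\<omega>, y)) - f (merge ?I (J l) (\<omega>', y))\<bar> \<le> d" if "y \<in> space ?PJ" for y
      by (intro diff[of l'] ms that sp) (use l' eq in \<open>auto simp: merge_def\<close>)
    have int: "integrable ?PJ (\<lambda>y. f (merge ?I (J l) (\<omega>, y)))" "integrable ?PJ (\<lambda>y. f (merge ?I (J l) (\<omega>', y)))"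
      using PJ.second_moment_bounded(1)[OF fmx K] sp by auto
    have "F \<omega> - F \<omega>' = (\<integral>y. f (merge ?I (J l) (\<omega>, y)) - f (merge ?I (J l) (\<omega>', y)) \<partial>?PJ)"
      using int by (simp add: F_def)
    also have "\<bar>\<dots>\<bar> \<le> (\<integral>y. \<bar>f (merge ?I (J l) (\<omega>, y)) - f (merge ?I (J l) (\<omega>', y))\<bar> \<partial>?PJ)"
      by (rule integral_abs_bound)
    also have "\<dots> \<le> (\<integral>y. d \<partial>?PJ)" using int pd by (intro integral_mono) auto
    finally show "\<bar>F \<omega> - F \<omega>'\<bar> \<le> d" by (simp add: PJ.prob_space)
  qed
  show ?case unfolding un E1 E2 using 1 2 insert.hyps by (simp add: algebra_simps)
qed

section \<open>Block traces of a Gaussian matrix\<close>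

lemma borel_measurable_det:
  assumes "\<And>i j. i < n \<Longrightarrow> j < n \<Longrightarrow> (\<lambda>\<omega>. f \<omega> i j) \<in> borel_measurable \<Omega>"
  shows "(\<lambda>\<omega>. det (fmat n (f \<omega>))) \<in> borel_measurable \<Omega>"
  unfolding det_fmat_eq_sum
proof (intro borel_measurable_sum borel_measurable_times borel_measurable_const borel_measurable_prod)
  fix p r assume "p \<in> {p. p permutes {0..<n}}" "r \<in> {0..<n}"
  then show "(\<lambda>\<omega>. f \<omega> r (p r)) \<in> borel_measurable \<Omega>"
    using permutes_in_image[of p "{0..<n}" r] by (intro assms) auto
qed

lemma borel_measurable_minv:
  assumes f: "\<And>i j. i < n \<Longrightarrow> j < n \<Longrightarrow> (\<lambda>\<omega>. f \<omega> i j) \<in> borel_measurable \<Omega>"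
    and r: "r < n" and s: "s < n"
  shows "(\<lambda>\<omega>. minv n (f \<omega>) r s) \<in> borel_measurable \<Omega>"
proof -
  have "minv n (f \<omega>) r s = (- 1) ^ (s + r) *
      det (fmat (n - 1) (\<lambda>i j. f \<omega> (if i < s then i else Suc i) (if j < r then j else Suc j))) /
      det (fmat n (f \<omega>))" for \<omega>
  proof -
    have "mat_delete (fmat n (f \<omega>)) s r =
        fmat (n - 1) (\<lambda>i j. f \<omega> (if i < s then i else Suc i) (if j < r then j else Suc j))"
      unfolding mat_delete_def by (intro eq_matI) auto
    then show ?thesis using r s by (simp add: minv_def adj_mat_def cofactor_def)
  qed
  then show ?thesis
    using f by (auto intro!: borel_measurable_divide borel_measurable_times borel_measurable_det)
qed

lemma sum_blocks: "(\<Sum>c\<in>{a * N..<b * N}. f c) = (\<Sum>k\<in>{a..<b}. \<Sum>c\<in>{k * N..<k * N + N}. f c)"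
  for a b N :: nat
proof (induction b)
  case (Suc b)
  show ?case
  proof (cases "a \<le> b")
    case True
    then have "{a * N..<Suc b * N} = {a * N..<b * N} \<union> {b * N..<b * N + N}"
      by (auto simp: add.commute intro: order_trans[OF mult_le_mono1])
    then have "(\<Sum>c\<in>{a * N..<Suc b * N}. f c) = (\<Sum>c\<in>{a * N..<b * N}. f c) + (\<Sum>c\<in>{b * N..<b * N + N}. f c)"
      by (simp add: sum.union_disjoint)
    then show ?thesis using Suc True by simp
  next
    case False
    then have "Suc b * N \<le> a * N" by (intro mult_le_mono1) simp
    then show ?thesis using False by simp
  qed
qed simp

text \<open>\<open>\<sigma>\<close> is the full amplitude, meant to absorb both the gain and the
  square root of the power per user; \<open>c0\<close> is the first active group. The probability
  space carries the entries of all groups and so is the same for every \<open>c0\<close>, as in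
  \<open>FN\<close>.\<close>

locale gaussian_block_matrix =
  fixes B A M N c0 :: nat and \<sigma> :: "nat \<Rightarrow> nat \<Rightarrow> real"
  assumes M_pos: "M > 0" and N_pos: "N > 0"
begin

abbreviation "nr \<equiv> B * M"
abbreviation "cs \<equiv> {c0 * N..<A * N}"
abbreviation "\<Omega> \<equiv> PiM (idx B A M N) (\<lambda>_. CN01)"

definition X :: "(nat \<times> nat \<times> nat \<times> nat \<Rightarrow> complex) \<Rightarrow> nat \<Rightarrow> nat \<Rightarrow> complex" where
  "X \<omega> r c = of_real (\<sigma> (r div M) (c div N)) * \<omega> (r div M, c div N, r mod M, c mod N)"

abbreviation "gd \<omega> r \<equiv> Re (resolvent nr cs (X \<omega>) r r)"
abbreviation "cg \<omega> c \<equiv> coresolvent nr cs (X \<omega>) c"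
abbreviation "ov \<omega> r c \<equiv> overlap nr cs (X \<omega>) r c"
abbreviation "mean f \<equiv> (\<integral>\<omega>. (f \<omega> :: real) \<partial>\<Omega>)"

definition rowtr :: "nat \<Rightarrow> (nat \<times> nat \<times> nat \<times> nat \<Rightarrow> complex) \<Rightarrow> real" where
  "rowtr m \<omega> = (\<Sum>r\<in>{m * M..<m * M + M}. gd \<omega> r)"

definition coltr :: "nat \<Rightarrow> (nat \<times> nat \<times> nat \<times> nat \<Rightarrow> complex) \<Rightarrow> real" where
  "coltr k \<omega> = (\<Sum>c\<in>{k * N..<k * N + N}. cg \<omega> c)"

lemma finite_idx: "finite (idx B A M N)"
  by (rule finite_subset[of _ "{..<B} \<times> {..<A} \<times> {..<M} \<times> {..<N}"]) (auto simp: idx_def)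

lemma index_mem: "r < nr \<Longrightarrow> c < A * N \<Longrightarrow> (r div M, c div N, r mod M, c mod N) \<in> idx B A M N"
  using M_pos N_pos by (auto simp: idx_def less_mult_imp_div_less)

sublocale prob: prob_space \<Omega>
  by (rule prob_space_PiM) (rule prob_space_CN01)

lemma coordinate_measurable [measurable]: "e \<in> idx B A M N \<Longrightarrow> (\<lambda>\<omega>. \<omega> e) \<in> borel_measurable \<Omega>"
  using measurable_component_singleton[of e "idx B A M N" "\<lambda>_. CN01"]
  by (simp add: measurable_cong_sets[OF refl sets_CN01])

lemma integrable_coordinate_sq:
  assumes e: "e \<in> idx B A M N"
  shows "integrable \<Omega> (\<lambda>\<omega>. (cmod (\<omega> e))\<^sup>2)"
    and "(\<integral>\<omega>. (cmod (\<omega> e))\<^sup>2 \<partial>\<Omega>) = (\<integral>z. (cmod z)\<^sup>2 \<partial>CN01)"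
proof -
  have d: "distr \<Omega> CN01 (\<lambda>\<omega>. \<omega> e) = CN01"
    by (rule distr_PiM_component[OF prob_space_CN01 e])
  have m: "(\<lambda>\<omega>. \<omega> e) \<in> \<Omega> \<rightarrow>\<^sub>M CN01" using e by (rule measurable_component_singleton)
  have "integrable (distr \<Omega> CN01 (\<lambda>\<omega>. \<omega> e)) (\<lambda>z. (cmod z)\<^sup>2)"
    unfolding d by (rule integrable_CN01_cmod_sq)
  then show "integrable \<Omega> (\<lambda>\<omega>. (cmod (\<omega> e))\<^sup>2)" by (rule integrable_distr[OF m])
  have "(\<integral>z. (cmod z)\<^sup>2 \<partial>distr \<Omega> CN01 (\<lambda>\<omega>. \<omega> e)) = (\<integral>\<omega>. (cmod (\<omega> e))\<^sup>2 \<partial>\<Omega>)"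
    by (rule integral_distr[OF m borel_measurable_integrable[OF integrable_CN01_cmod_sq]])
  then show "(\<integral>\<omega>. (cmod (\<omega> e))\<^sup>2 \<partial>\<Omega>) = (\<integral>z. (cmod z)\<^sup>2 \<partial>CN01)" unfolding d by simp
qed

lemma X_measurable [measurable]: "r < nr \<Longrightarrow> c < A * N \<Longrightarrow> (\<lambda>\<omega>. X \<omega> r c) \<in> borel_measurable \<Omega>"
  unfolding X_def by (intro borel_measurable_times borel_measurable_const coordinate_measurable index_mem)

lemma id_plus_measurable: "r < nr \<Longrightarrow> s < nr \<Longrightarrow> (\<lambda>\<omega>. id_plus D cs (X \<omega>) r s) \<in> borel_measurable \<Omega>"
  unfolding id_plus_def gram_def
  by (intro borel_measurable_add borel_measurable_const borel_measurable_times borel_measurable_sum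
      borel_measurable_continuous_on[OF continuous_on_cnj[OF continuous_on_id]] X_measurable) auto

lemma resolvent_measurable [measurable]:
  "r < nr \<Longrightarrow> s < nr \<Longrightarrow> (\<lambda>\<omega>. resolvent nr cs (X \<omega>) r s) \<in> borel_measurable \<Omega>"
  unfolding resolvent_def by (rule borel_measurable_minv[OF id_plus_measurable])

lemma resolvent_col_measurable [measurable]:
  "r < nr \<Longrightarrow> c < A * N \<Longrightarrow> (\<lambda>\<omega>. resolvent_col nr cs (X \<omega>) c r) \<in> borel_measurable \<Omega>"
  unfolding resolvent_col_def
  by (intro borel_measurable_sum borel_measurable_times resolvent_measurable X_measurable) auto

lemma overlap_measurable [measurable]:
  "r < nr \<Longrightarrow> c < A * N \<Longrightarrow> (\<lambda>\<omega>. ov \<omega> r c) \<in> borel_measurable \<Omega>"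
  unfolding overlap_def
  by (intro borel_measurable_continuous_on[OF continuous_on_Re[OF continuous_on_id]] borel_measurable_times
      borel_measurable_continuous_on[OF continuous_on_cnj[OF continuous_on_id]] X_measurable resolvent_col_measurable)

lemma coresolvent_measurable [measurable]:
  "c < A * N \<Longrightarrow> (\<lambda>\<omega>. cg \<omega> c) \<in> borel_measurable \<Omega>"
  unfolding coresolvent_def
  by (intro borel_measurable_diff borel_measurable_const
      borel_measurable_continuous_on[OF continuous_on_Re[OF continuous_on_id]] borel_measurable_sum borel_measurable_times
      borel_measurable_continuous_on[OF continuous_on_cnj[OF continuous_on_id]] X_measurable resolvent_col_measurable) auto

lemma resolvent_diag_measurable [measurable]:
  "r < nr \<Longrightarrow> (\<lambda>\<omega>. gd \<omega> r) \<in> borel_measurable \<Omega>"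
  by (intro borel_measurable_continuous_on[OF continuous_on_Re[OF continuous_on_id]] resolvent_measurable)

lemma row_lt: "m < B \<Longrightarrow> r \<in> {m * M..<m * M + M} \<Longrightarrow> r < nr \<and> r div M = m"
proof -
  assume m: "m < B" and r: "r \<in> {m * M..<m * M + M}"
  have "Suc m * M \<le> B * M" using m by (intro mult_le_mono1) simp
  moreover have "r div M = m" using r by (intro div_nat_eqI) (auto simp: mult.commute)
  ultimately show ?thesis using r by auto
qed

lemma col_lt: "c0 \<le> k \<Longrightarrow> k < A \<Longrightarrow> c \<in> {k * N..<k * N + N} \<Longrightarrow> c < A * N \<and> c \<in> cs \<and> c div N = k"
proof -
  assume k: "c0 \<le> k" "k < A" and c: "c \<in> {k * N..<k * N + N}"
  have "Suc k * N \<le> A * N" using k by (intro mult_le_mono1) simp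
  moreover have "c0 * N \<le> k * N" using k by (intro mult_le_mono1) simp
  then have "c0 * N \<le> c" using c by (meson atLeastLessThan_iff order_trans)
  moreover have "c div N = k" using c by (intro div_nat_eqI) (auto simp: mult.commute)
  ultimately show ?thesis using c by auto
qed

lemma rowtr_measurable [measurable]: "m < B \<Longrightarrow> rowtr m \<in> borel_measurable \<Omega>"
  unfolding rowtr_def[abs_def] using row_lt by (intro borel_measurable_sum resolvent_diag_measurable) auto

lemma coltr_measurable [measurable]: "c0 \<le> k \<Longrightarrow> k < A \<Longrightarrow> coltr k \<in> borel_measurable \<Omega>"
  unfolding coltr_def[abs_def] using col_lt by (intro borel_measurable_sum coresolvent_measurable) auto

lemma rowtr_bounds: "m < B \<Longrightarrow> 0 \<le> rowtr m \<omega> \<and> rowtr m \<omega> \<le> M"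
proof -
  assume m: "m < B"
  have b: "0 \<le> gd \<omega> r \<and> gd \<omega> r \<le> 1"
    if "r \<in> {m * M..<m * M + M}" for r
    using row_lt[OF m that] resolvent_diag_bounds[of cs r nr "X \<omega>"] by auto
  then have "0 \<le> rowtr m \<omega>" unfolding rowtr_def by (intro sum_nonneg) auto
  moreover have "rowtr m \<omega> \<le> (\<Sum>r\<in>{m * M..<m * M + M}. 1)" unfolding rowtr_def using b by (intro sum_mono) auto
  ultimately show ?thesis by simp
qed

lemma coltr_bounds: "c0 \<le> k \<Longrightarrow> k < A \<Longrightarrow> 0 \<le> coltr k \<omega> \<and> coltr k \<omega> \<le> N"
proof -
  assume k: "c0 \<le> k" "k < A"
  have b: "0 \<le> cg \<omega> c \<and> cg \<omega> c \<le> 1"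
    if "c \<in> {k * N..<k * N + N}" for c
    using col_lt[OF k that] coresolvent_bounds[of cs c nr "X \<omega>"] by auto
  then have "0 \<le> coltr k \<omega>" unfolding coltr_def by (intro sum_nonneg) auto
  moreover have "coltr k \<omega> \<le> (\<Sum>c\<in>{k * N..<k * N + N}. 1)" unfolding coltr_def using b by (intro sum_mono) auto
  ultimately show ?thesis by simp
qed

lemma integrable_overlap:
  assumes r: "r < nr" and c: "c \<in> cs"
  shows "integrable \<Omega> (\<lambda>\<omega>. ov \<omega> r c)"
proof (rule Bochner_Integration.integrable_bound)
  let ?e = "(r div M, c div N, r mod M, c mod N)"
  let ?s = "\<sigma> (r div M) (c div N)"
  have cA: "c < A * N" using c by simp
  show "integrable \<Omega> (\<lambda>\<omega>. \<bar>?s\<bar> * (1 + (cmod (\<omega> ?e))\<^sup>2))"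
    by (intro integrable_mult_right Bochner_Integration.integrable_add integrable_coordinate_sq index_mem r cA) simp
  have "\<bar>ov \<omega> r c\<bar> \<le> \<bar>?s\<bar> * (1 + (cmod (\<omega> ?e))\<^sup>2)" for \<omega>
  proof -
    have "\<bar>ov \<omega> r c\<bar> \<le> \<bar>?s\<bar> * cmod (\<omega> ?e)"
      using overlap_bound[of cs c r nr "X \<omega>"] r c by (simp add: X_def norm_mult)
    also have "cmod (\<omega> ?e) \<le> 1 + (cmod (\<omega> ?e))\<^sup>2"
      using zero_le_power2[of "cmod (\<omega> ?e) - 1"] norm_ge_zero[of "\<omega> ?e"]
      unfolding power2_diff power_one mult_1_right by linarith
    then have "\<bar>?s\<bar> * cmod (\<omega> ?e) \<le> \<bar>?s\<bar> * (1 + (cmod (\<omega> ?e))\<^sup>2)" by (rule mult_left_mono) simp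
    finally show ?thesis .
  qed
  then show "AE \<omega> in \<Omega>. norm (ov \<omega> r c) \<le> norm (\<bar>?s\<bar> * (1 + (cmod (\<omega> ?e))\<^sup>2))"
    by (simp add: abs_mult)
  show "(\<lambda>\<omega>. ov \<omega> r c) \<in> borel_measurable \<Omega>" by (rule overlap_measurable[OF r cA])
qed

text \<open>Gaussian integration by parts in a single entry.\<close>

lemma expectation_overlap:
  assumes r: "r < nr" and c: "c \<in> cs"
  shows "(\<integral>\<omega>. ov \<omega> r c \<partial>\<Omega>) =
    (\<sigma> (r div M) (c div N))\<^sup>2 *
      (\<integral>\<omega>. gd \<omega> r * cg \<omega> c \<partial>\<Omega>)"
proof -
  define e where "e = (r div M, c div N, r mod M, c mod N)"
  define s where "s = \<sigma> (r div M) (c div N)"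
  define I where "I = idx B A M N - {e}"
  have cA: "c < A * N" using c by simp
  have eI: "e \<in> idx B A M N" unfolding e_def by (rule index_mem[OF r cA])
  have I: "finite I" "e \<notin> I" "insert e I = idx B A M N" using finite_idx eI by (auto simp: I_def)
  interpret CN: prob_space CN01 by (rule prob_space_CN01)
  interpret PS: product_prob_space "\<lambda>_. CN01" by standard
  let ?o = "\<lambda>\<omega>. ov \<omega> r c"
  let ?g = "\<lambda>\<omega>. gd \<omega> r * cg \<omega> c"
  have int_ov: "integrable (PiM (insert e I) (\<lambda>_. CN01)) ?o"
    unfolding I(3) by (rule integrable_overlap[OF r c])
  have int_gg: "integrable (PiM (insert e I) (\<lambda>_. CN01)) ?g"
    unfolding I(3)
  proof (rule prob.integrable_const_bound[of _ 1])
    have "norm (?g \<omega>) \<le> 1" for \<omega>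
      using resolvent_diag_bounds[of cs r nr "X \<omega>"] coresolvent_bounds[of cs c nr "X \<omega>"] r c
      by (simp add: abs_mult mult_le_one)
    then show "AE \<omega> in \<Omega>. norm (?g \<omega>) \<le> 1" by simp
    show "?g \<in> borel_measurable \<Omega>"
      by (intro borel_measurable_times resolvent_diag_measurable coresolvent_measurable r cA)
  qed
  \<comment> \<open>Fubini isolates the coordinate \<open>e\<close>: with all other entries fixed,
    both integrands are explicit functions of one complex Gaussian variable.\<close>
  have "(\<integral>\<omega>. ?o \<omega> \<partial>PiM (insert e I) (\<lambda>_. CN01)) = (\<integral>x. (\<integral>y. ?o (x(e := y)) \<partial>CN01) \<partial>PiM I (\<lambda>_. CN01))"
    by (rule PS.product_integral_insert[OF I(1,2) int_ov])
  also have "\<dots> = (\<integral>x. s\<^sup>2 * (\<integral>y. ?g (x(e := y)) \<partial>CN01) \<partial>PiM I (\<lambda>_. CN01))"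
  proof (rule Bochner_Integration.integral_cong[OF refl])
    fix x
    obtain \<alpha> \<delta> :: real and b :: complex where \<delta>: "\<delta> \<ge> 0" and disc: "(cmod b)\<^sup>2 \<le> \<alpha> * \<delta>"
      and p1: "\<And>\<zeta>. 1 \<le> \<alpha> + 2 * Re (cnj \<zeta> * b) + \<delta> * (cmod \<zeta>)\<^sup>2"
      and dep: "\<And>Y. (\<And>i j. i < nr \<Longrightarrow> j \<in> cs \<Longrightarrow> (i, j) \<noteq> (r, c) \<Longrightarrow> Y i j = X (x(e := 0)) i j) \<Longrightarrow>
       overlap nr cs Y r c = Re (cnj (Y r c) * (b + of_real \<delta> * Y r c)) /
         (\<alpha> + 2 * Re (cnj (Y r c) * b) + \<delta> * (cmod (Y r c))\<^sup>2) \<and>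
       Re (resolvent nr cs Y r r) * coresolvent nr cs Y c = (\<alpha> * \<delta> - (cmod b)\<^sup>2) /
         (\<alpha> + 2 * Re (cnj (Y r c) * b) + \<delta> * (cmod (Y r c))\<^sup>2)\<^sup>2"
      using single_entry_dependence[of cs c r nr "X (x(e := 0))"] r c by (metis (no_types, lifting) finite_atLeastLessThan)
    have Yrc: "X (x(e := y)) r c = of_real s * y" for y by (simp add: X_def e_def s_def)
    have other: "X (x(e := y)) i j = X (x(e := 0)) i j" if "(i, j) \<noteq> (r, c)" for i j y
    proof -
      have "(i div M, j div N, i mod M, j mod N) \<noteq> e"
      proof
        assume "(i div M, j div N, i mod M, j mod N) = e"
        then have "i = r" "j = c" unfolding e_def by (metis Pair_inject div_mult_mod_eq)+
        then show False using that by simp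
      qed
      then show ?thesis by (simp add: X_def)
    qed
    \<comment> \<open>The matrix entry is \<open>s * y\<close>, so the coefficients are rescaled by
      \<open>s\<close> and \<open>s\<^sup>2\<close>; then
      \<open>\<alpha> * \<delta> - (cmod b)\<^sup>2\<close> picks up the factor
      \<open>s\<^sup>2\<close> of the claim.\<close>
    let ?b = "of_real s * b" and ?\<delta> = "s\<^sup>2 * \<delta>"
    define p where "p y = \<alpha> + 2 * Re (cnj y * ?b) + ?\<delta> * (cmod y)\<^sup>2" for y
    have p: "\<alpha> + 2 * Re (cnj (of_real s * y) * b) + \<delta> * (cmod (of_real s * y))\<^sup>2 = p y" for y
      by (simp add: p_def norm_mult power_mult_distrib algebra_simps)
    have ov: "?o (x(e := y)) = Re (cnj y * (?b + of_real ?\<delta> * y)) / p y" for y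
    proof -
      have "?o (x(e := y)) = Re (cnj (of_real s * y) * (b + of_real \<delta> * (of_real s * y))) / p y"
        using dep[of "X (x(e := y))"] other unfolding Yrc p by blast
      also have "cnj (of_real s * y) * (b + of_real \<delta> * (of_real s * y)) = cnj y * (?b + of_real ?\<delta> * y)"
        by (simp add: algebra_simps power2_eq_square)
      finally show ?thesis .
    qed
    have gg: "?g (x(e := y)) = (\<alpha> * \<delta> - (cmod b)\<^sup>2) / (p y)\<^sup>2" for y
      using dep[of "X (x(e := y))"] other unfolding Yrc p by blast
    have "(\<integral>y. ?o (x(e := y)) \<partial>CN01) = (\<integral>y. (\<alpha> * ?\<delta> - (cmod ?b)\<^sup>2) / (p y)\<^sup>2 \<partial>CN01)"
      unfolding ov p_def
    proof (rule CN01_stein_quadratic)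
      show "0 \<le> ?\<delta>" using \<delta> by simp
      show "(cmod ?b)\<^sup>2 \<le> \<alpha> * ?\<delta>"
        using mult_left_mono[OF disc, of "s\<^sup>2"] by (simp add: norm_mult power_mult_distrib algebra_simps)
      show "1 \<le> \<alpha> + 2 * Re (cnj y * ?b) + ?\<delta> * (cmod y)\<^sup>2" for y
        using p1[of "of_real s * y"] unfolding p p_def .
    qed
    also have "\<dots> = (\<integral>y. s\<^sup>2 * ((\<alpha> * \<delta> - (cmod b)\<^sup>2) / (p y)\<^sup>2) \<partial>CN01)"
      by (rule Bochner_Integration.integral_cong) (simp_all add: norm_mult power_mult_distrib algebra_simps)
    also have "\<dots> = s\<^sup>2 * (\<integral>y. ?g (x(e := y)) \<partial>CN01)"
      unfolding gg by (rule integral_mult_right_zero)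
    finally show "(\<integral>y. ?o (x(e := y)) \<partial>CN01) = s\<^sup>2 * (\<integral>y. ?g (x(e := y)) \<partial>CN01)" .
  qed
  also have "\<dots> = s\<^sup>2 * (\<integral>\<omega>. ?g \<omega> \<partial>PiM (insert e I) (\<lambda>_. CN01))"
    unfolding PS.product_integral_insert[OF I(1,2) int_gg] by (rule integral_mult_right_zero)
  finally show ?thesis unfolding I(3) s_def .
qed

lemma integrable_resolvent_product:
  assumes r: "r < nr" and c: "c \<in> cs"
  shows "integrable \<Omega> (\<lambda>\<omega>. gd \<omega> r * cg \<omega> c)"
proof (rule prob.integrable_const_bound[of _ 1])
  have "norm (gd \<omega> r * cg \<omega> c) \<le> 1" for \<omega>
    using resolvent_diag_bounds[of cs r nr "X \<omega>"] coresolvent_bounds[of cs c nr "X \<omega>"] r c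
    by (simp add: abs_mult mult_le_one)
  then show "AE \<omega> in \<Omega>. norm (gd \<omega> r * cg \<omega> c) \<le> 1" by simp
  show "(\<lambda>\<omega>. gd \<omega> r * cg \<omega> c) \<in> borel_measurable \<Omega>"
    by (intro borel_measurable_times resolvent_diag_measurable coresolvent_measurable r) (use c in auto)
qed

text \<open>Integration by parts in each entry produces the same factor throughout the block, so the
  double sum of products becomes the product of two traces under the integral.\<close>

lemma expectation_block_product:
  assumes m: "m < B" and k: "c0 \<le> k" "k < A"
  shows "(\<integral>\<omega>. (\<Sum>r\<in>{m * M..<m * M + M}. \<Sum>c\<in>{k * N..<k * N + N}. ov \<omega> r c) \<partial>\<Omega>)
    = (\<sigma> m k)\<^sup>2 * mean (\<lambda>\<omega>. rowtr m \<omega> * coltr k \<omega>)"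
proof -
  let ?R = "{m * M..<m * M + M}" and ?K = "{k * N..<k * N + N}"
  have io: "integrable \<Omega> (\<lambda>\<omega>. ov \<omega> r c)" if "r \<in> ?R" "c \<in> ?K" for r c
    using row_lt[OF m that(1)] col_lt[OF k that(2)] by (intro integrable_overlap) auto
  have ig: "integrable \<Omega> (\<lambda>\<omega>. gd \<omega> r * cg \<omega> c)"
    if "r \<in> ?R" "c \<in> ?K" for r c
    using row_lt[OF m that(1)] col_lt[OF k that(2)] by (intro integrable_resolvent_product) auto
  have "(\<integral>\<omega>. (\<Sum>r\<in>?R. \<Sum>c\<in>?K. ov \<omega> r c) \<partial>\<Omega>) =
      (\<Sum>r\<in>?R. \<Sum>c\<in>?K. \<integral>\<omega>. ov \<omega> r c \<partial>\<Omega>)"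
  proof -
    have "(\<integral>\<omega>. (\<Sum>r\<in>?R. \<Sum>c\<in>?K. ov \<omega> r c) \<partial>\<Omega>) =
        (\<Sum>r\<in>?R. \<integral>\<omega>. (\<Sum>c\<in>?K. ov \<omega> r c) \<partial>\<Omega>)"
      by (rule Bochner_Integration.integral_sum, rule Bochner_Integration.integrable_sum, rule io)
    also have "\<dots> = (\<Sum>r\<in>?R. \<Sum>c\<in>?K. \<integral>\<omega>. ov \<omega> r c \<partial>\<Omega>)"
      by (rule sum.cong[OF refl], rule Bochner_Integration.integral_sum, rule io)
    finally show ?thesis .
  qed
  also have "\<dots> = (\<Sum>r\<in>?R. \<Sum>c\<in>?K. (\<sigma> m k)\<^sup>2 *
      (\<integral>\<omega>. gd \<omega> r * cg \<omega> c \<partial>\<Omega>))"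
    using row_lt[OF m] col_lt[OF k] by (intro sum.cong refl) (simp add: expectation_overlap)
  also have "\<dots> = (\<sigma> m k)\<^sup>2 * (\<Sum>r\<in>?R. \<Sum>c\<in>?K.
      \<integral>\<omega>. gd \<omega> r * cg \<omega> c \<partial>\<Omega>)"
    by (simp add: sum_distrib_left)
  also have "(\<Sum>r\<in>?R. \<Sum>c\<in>?K. \<integral>\<omega>. gd \<omega> r * cg \<omega> c \<partial>\<Omega>) =
      (\<integral>\<omega>. (\<Sum>r\<in>?R. \<Sum>c\<in>?K. gd \<omega> r * cg \<omega> c) \<partial>\<Omega>)"
  proof -
    have "(\<integral>\<omega>. (\<Sum>r\<in>?R. \<Sum>c\<in>?K. gd \<omega> r * cg \<omega> c) \<partial>\<Omega>) =
        (\<Sum>r\<in>?R. \<integral>\<omega>. (\<Sum>c\<in>?K. gd \<omega> r * cg \<omega> c) \<partial>\<Omega>)"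
      by (rule Bochner_Integration.integral_sum, rule Bochner_Integration.integrable_sum, rule ig)
    also have "\<dots> = (\<Sum>r\<in>?R. \<Sum>c\<in>?K. \<integral>\<omega>. gd \<omega> r * cg \<omega> c \<partial>\<Omega>)"
      by (rule sum.cong[OF refl], rule Bochner_Integration.integral_sum, rule ig)
    finally show ?thesis by (rule sym)
  qed
  also have "\<dots> = mean (\<lambda>\<omega>. rowtr m \<omega> * coltr k \<omega>)"
    unfolding rowtr_def coltr_def sum_product ..
  finally show ?thesis .
qed

lemma integrable_rowtr: "m < B \<Longrightarrow> integrable \<Omega> (rowtr m)"
  by (rule prob.integrable_const_bound[of _ M]) (use rowtr_bounds[of m] in \<open>auto simp: rowtr_measurable\<close>)

lemma integrable_coltr: "c0 \<le> k \<Longrightarrow> k < A \<Longrightarrow> integrable \<Omega> (coltr k)"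
  by (rule prob.integrable_const_bound[of _ N]) (use coltr_bounds[of k] in \<open>auto simp: coltr_measurable\<close>)

lemma integrable_block_overlap:
  assumes m: "m < B" and k: "c0 \<le> k" "k < A"
  shows "integrable \<Omega> (\<lambda>\<omega>. \<Sum>r\<in>{m * M..<m * M + M}. \<Sum>c\<in>{k * N..<k * N + N}. ov \<omega> r c)"
proof (intro Bochner_Integration.integrable_sum)
  fix r c assume "r \<in> {m * M..<m * M + M}" "c \<in> {k * N..<k * N + N}"
  then show "integrable \<Omega> (\<lambda>\<omega>. ov \<omega> r c)"
    using row_lt[OF m] col_lt[OF k] by (intro integrable_overlap) auto
qed

text \<open>Exact at every size: the trace deficit is the sum of the overlaps in its rows. An error
  enters only later, when the mean of the product is compared with the product of the means.\<close>

lemma row_equation: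
  assumes m: "m < B"
  shows "real M - mean (rowtr m) = (\<Sum>k\<in>{c0..<A}. (\<sigma> m k)\<^sup>2 * mean (\<lambda>\<omega>. rowtr m \<omega> * coltr k \<omega>))"
proof -
  have "real M - rowtr m \<omega> = (\<Sum>k\<in>{c0..<A}. \<Sum>r\<in>{m * M..<m * M + M}. \<Sum>c\<in>{k * N..<k * N + N}. ov \<omega> r c)" for \<omega>
  proof -
    have "real M - rowtr m \<omega> = (\<Sum>r\<in>{m * M..<m * M + M}. 1 - gd \<omega> r)"
      unfolding rowtr_def sum_subtractf by simp
    also have "\<dots> = (\<Sum>r\<in>{m * M..<m * M + M}. \<Sum>c\<in>cs. ov \<omega> r c)"
      using row_lt[OF m] by (intro sum.cong refl) (auto simp: sum_overlap_columns)
    also have "\<dots> = (\<Sum>r\<in>{m * M..<m * M + M}. \<Sum>k\<in>{c0..<A}. \<Sum>c\<in>{k * N..<k * N + N}. ov \<omega> r c)"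
      unfolding sum_blocks ..
    also have "\<dots> = (\<Sum>k\<in>{c0..<A}. \<Sum>r\<in>{m * M..<m * M + M}. \<Sum>c\<in>{k * N..<k * N + N}. ov \<omega> r c)"
      by (rule sum.swap)
    finally show ?thesis .
  qed
  then have "(\<integral>\<omega>. real M - rowtr m \<omega> \<partial>\<Omega>) =
      (\<Sum>k\<in>{c0..<A}. \<integral>\<omega>. (\<Sum>r\<in>{m * M..<m * M + M}. \<Sum>c\<in>{k * N..<k * N + N}. ov \<omega> r c) \<partial>\<Omega>)"
    using integrable_block_overlap[OF m] by (simp add: Bochner_Integration.integral_sum)
  also have "\<dots> = (\<Sum>k\<in>{c0..<A}. (\<sigma> m k)\<^sup>2 * mean (\<lambda>\<omega>. rowtr m \<omega> * coltr k \<omega>))"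
    using expectation_block_product[OF m] by (intro sum.cong) auto
  finally show ?thesis using integrable_rowtr[OF m] by (simp add: prob.prob_space)
qed

lemma col_equation:
  assumes k: "c0 \<le> k" "k < A"
  shows "real N - mean (coltr k) = (\<Sum>m<B. (\<sigma> m k)\<^sup>2 * mean (\<lambda>\<omega>. rowtr m \<omega> * coltr k \<omega>))"
proof -
  have "real N - coltr k \<omega> = (\<Sum>m<B. \<Sum>r\<in>{m * M..<m * M + M}. \<Sum>c\<in>{k * N..<k * N + N}. ov \<omega> r c)" for \<omega>
  proof -
    have "real N - coltr k \<omega> = (\<Sum>c\<in>{k * N..<k * N + N}. \<Sum>r<nr. ov \<omega> r c)"
      unfolding coltr_def sum_overlap_rows sum_subtractf by simp
    also have "\<dots> = (\<Sum>r<nr. \<Sum>c\<in>{k * N..<k * N + N}. ov \<omega> r c)"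
      by (rule sum.swap)
    also have "\<dots> = (\<Sum>m<B. \<Sum>r\<in>{m * M..<m * M + M}. \<Sum>c\<in>{k * N..<k * N + N}. ov \<omega> r c)"
      by (rule sum.nat_group[symmetric])
    finally show ?thesis .
  qed
  then have "(\<integral>\<omega>. real N - coltr k \<omega> \<partial>\<Omega>) =
      (\<Sum>m<B. \<integral>\<omega>. (\<Sum>r\<in>{m * M..<m * M + M}. \<Sum>c\<in>{k * N..<k * N + N}. ov \<omega> r c) \<partial>\<Omega>)"
    using integrable_block_overlap[OF _ k] by (simp add: Bochner_Integration.integral_sum)
  also have "\<dots> = (\<Sum>m<B. (\<sigma> m k)\<^sup>2 * mean (\<lambda>\<omega>. rowtr m \<omega> * coltr k \<omega>))"
    using expectation_block_product[OF _ k] by (intro sum.cong) auto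
  finally show ?thesis using integrable_coltr[OF k] by (simp add: prob.prob_space)
qed

text \<open>Replacing one column moves a partial trace by at most 1, and there are
  \<open>A * N\<close> columns. After division by \<open>N\<close> the standard deviation is of
  order \<open>N\<close> to the power -1/2, which is the origin of the error rate.\<close>

lemma variance_rowtr:
  assumes m: "m < B"
  shows "(\<integral>\<omega>. (rowtr m \<omega>)\<^sup>2 \<partial>\<Omega>) - (\<integral>\<omega>. rowtr m \<omega> \<partial>\<Omega>)\<^sup>2 \<le> real (A * N)"
proof -
  \<comment> \<open>\<open>J (k, i)\<close> collects the entries of column \<open>i\<close> of group
    \<open>k\<close> over all base stations; these sets partition
    \<open>idx B A M N\<close>.\<close>
  define J where "J l = (case l of (k, i) \<Rightarrow> {(m', k', j, i'). k' = k \<and> i' = i \<and> m' < B \<and> j < M})"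
    for l :: "nat \<times> nat"
  let ?L = "{..<A} \<times> {..<N}"
  have un: "(\<Union>l\<in>?L. J l) = idx B A M N" by (auto simp: J_def idx_def)
  have "(\<integral>\<omega>. (rowtr m \<omega>)\<^sup>2 \<partial>PiM (\<Union>l\<in>?L. J l) (\<lambda>_. CN01)) - (\<integral>\<omega>. rowtr m \<omega> \<partial>PiM (\<Union>l\<in>?L. J l) (\<lambda>_. CN01))\<^sup>2
    \<le> real (card ?L) * 1\<^sup>2"
  proof (rule variance_bounded_differences[OF prob_space_CN01])
    show "finite (J l)" if "l \<in> ?L" for l
      using that finite_idx un by (metis UN_upper finite_subset)
    show "disjoint_family_on J ?L" by (auto simp: disjoint_family_on_def J_def)
    show "rowtr m \<in> borel_measurable (PiM (\<Union>l\<in>?L. J l) (\<lambda>_. CN01))"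
      unfolding un by (rule rowtr_measurable[OF m])
    show "\<bar>rowtr m \<omega>\<bar> \<le> M" for \<omega> using rowtr_bounds[OF m, of \<omega>] by simp
    fix l and \<omega> \<omega>' :: "nat \<times> nat \<times> nat \<times> nat \<Rightarrow> complex"
    assume l: "l \<in> ?L" and sp: "\<omega> \<in> space (PiM (\<Union>l\<in>?L. J l) (\<lambda>_. CN01))"
      "\<omega>' \<in> space (PiM (\<Union>l\<in>?L. J l) (\<lambda>_. CN01))" and eq: "\<And>i. i \<notin> J l \<Longrightarrow> \<omega> i = \<omega>' i"
    obtain k i where ki: "l = (k, i)" "k < A" "i < N" using l by auto
    show "\<bar>rowtr m \<omega> - rowtr m \<omega>'\<bar> \<le> 1"
      unfolding rowtr_def
    proof (rule sum_resolvent_diag_column_change[where ?c0.0 = "k * N + i"])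
      show "{m * M..<m * M + M} \<subseteq> {..<nr}" using row_lt[OF m] by auto
      fix r c assume rc: "r < nr" "c \<in> cs - {k * N + i}"
      then have "\<not> (c div N = k \<and> c mod N = i)" using div_mult_mod_eq[of c N] by auto
      then have "(r div M, c div N, r mod M, c mod N) \<notin> J l" by (auto simp: ki J_def)
      then show "X \<omega> r c = X \<omega>' r c" unfolding X_def using eq by simp
    qed simp
  qed auto
  then show ?thesis unfolding un by (simp add: card_cartesian_product)
qed

lemma covariance_bound:
  assumes m: "m < B" and k: "c0 \<le> k" "k < A"
  shows "\<bar>mean (\<lambda>\<omega>. rowtr m \<omega> * coltr k \<omega>) - mean (rowtr m) * mean (coltr k)\<bar>
    \<le> sqrt (real (A * N)) * real N"
proof (rule prob.covariance_le_sqrt_variance[OF rowtr_measurable[OF m] coltr_measurable[OF k]])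
  show "\<bar>rowtr m \<omega>\<bar> \<le> M" for \<omega> using rowtr_bounds[OF m, of \<omega>] by simp
  show "\<bar>coltr k \<omega>\<bar> \<le> N" for \<omega> using coltr_bounds[OF k, of \<omega>] by simp
qed (rule variance_rowtr[OF m])

end

section \<open>Trace bounds and tangent inequalities in expectation\<close>

text \<open>Expanding \<open>D r * (cmod (x r))\<^sup>2\<close> around \<open>x - w\<close> and
  summing gives the weighted squares, twice \<open>Q\<close> and a nonnegative rest, whereas the
  left side contains \<open>Q\<close> only once.\<close>

lemma kappa_le:
  fixes x :: "nat \<Rightarrow> complex"
  assumes d: "det (fmat n (id_plus D C X)) \<noteq> 0" and D: "\<And>r. r < n \<Longrightarrow> D r \<ge> 0"
  shows "Re (\<Sum>r<n. cnj (x r) * (\<Sum>s<n. minv n (id_plus D C X) r s * (of_real (D s) * x s)))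
    \<le> (\<Sum>r<n. D r * (cmod (x r))\<^sup>2)"
proof -
  define z where "z r = (\<Sum>s<n. minv n (id_plus D C X) r s * (of_real (D s) * x s))" for r
  define w where "w r = (\<Sum>s<n. gram C X r s * z s)" for r
  define Q where "Q = (\<Sum>c\<in>C. (cmod (\<Sum>r<n. cnj (X r c) * z r))\<^sup>2)"
  have Q0: "Q \<ge> 0" unfolding Q_def by (intro sum_nonneg) auto
  have zr: "z r = of_real (D r) * (x r - w r)" if "r < n" for r
    unfolding w_def z_def by (rule kappa_formula(2)[OF d that])
  have k: "Re (\<Sum>r<n. cnj (x r) * z r) = (\<Sum>r<n. D r * (cmod (x r - w r))\<^sup>2) + Q"
    unfolding w_def z_def Q_def kappa_formula(1)[OF d] by (rule Re_complex_of_real)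
  have "(\<Sum>r<n. cnj (z r) * w r) = of_real Q"
    unfolding w_def Q_def by (rule gram_quadratic_form)
  then have Qw: "Q = (\<Sum>r<n. Re (cnj (z r) * w r))" unfolding Re_sum[symmetric] by simp
  have "D r * (cmod (x r))\<^sup>2 \<ge> D r * (cmod (x r - w r))\<^sup>2 + 2 * Re (cnj (z r) * w r)" if r: "r < n" for r
  proof -
    have "(cmod (x r))\<^sup>2 = (cmod (x r - w r))\<^sup>2 + 2 * Re (cnj (x r - w r) * w r) + (cmod (w r))\<^sup>2"
      unfolding cmod_power2 by (simp add: power2_eq_square algebra_simps)
    then have "D r * (cmod (x r))\<^sup>2 =
        D r * (cmod (x r - w r))\<^sup>2 + 2 * (D r * Re (cnj (x r - w r) * w r)) + D r * (cmod (w r))\<^sup>2"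
      by (simp only: distrib_left mult.left_commute)
    moreover have "D r * Re (cnj (x r - w r) * w r) = Re (cnj (z r) * w r)"
      unfolding zr[OF r] by (simp add: algebra_simps)
    moreover have "D r * (cmod (w r))\<^sup>2 \<ge> 0" using D[OF r] by simp
    ultimately show ?thesis by linarith
  qed
  then have "(\<Sum>r<n. D r * (cmod (x r - w r))\<^sup>2 + 2 * Re (cnj (z r) * w r)) \<le> (\<Sum>r<n. D r * (cmod (x r))\<^sup>2)"
    by (intro sum_mono) auto
  then have "(\<Sum>r<n. D r * (cmod (x r - w r))\<^sup>2) + 2 * Q \<le> (\<Sum>r<n. D r * (cmod (x r))\<^sup>2)"
    unfolding Qw by (simp add: sum.distrib sum_distrib_left)
  then show ?thesis using k Q0 unfolding z_def by linarith
qed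

text \<open>Each new column adds \<open>ln (1 + k) \<le> k\<close>, and \<open>kappa_le\<close>
  bounds \<open>k\<close> without the resolvent. The resulting trace has a finite mean, which yields
  integrability and, after scaling, a bound on the rates that is uniform in
  \<open>N\<close>.\<close>

lemma ln_det_id_plus_bounds:
  assumes "finite C" and D: "\<And>r. r < n \<Longrightarrow> D r \<ge> 0"
  shows "0 \<le> ln (Re (det (fmat n (id_plus D C X)))) \<and>
    ln (Re (det (fmat n (id_plus D C X)))) \<le> (\<Sum>c\<in>C. \<Sum>r<n. D r * (cmod (X r c))\<^sup>2)"
  using assms(1)
proof (induction C rule: finite_induct)
  case empty
  have "fmat n (id_plus D {} X) = 1\<^sub>m n" by (rule eq_matI) (auto simp: id_plus_def gram_def)
  then show ?case by simp
next
  case (insert c C)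
  obtain \<rho> where \<rho>: "\<rho> \<ge> 1" "det (fmat n (id_plus D C X)) = of_real \<rho>"
    using det_id_plus_ge_1[of C n D X, OF insert.hyps(1) D] by blast
  have d: "det (fmat n (id_plus D C X)) \<noteq> 0" using \<rho> by simp
  obtain \<rho>' where \<rho>': "\<rho>' \<ge> 1" "det (fmat n (id_plus D (insert c C) X)) = of_real \<rho>'"
    using det_id_plus_ge_1[of "insert c C" n D X] insert.hyps(1) D by auto
  define k where "k = Re (\<Sum>r<n. cnj (X r c) * (\<Sum>s<n. minv n (id_plus D C X) r s * (of_real (D s) * X s c)))"
  have k_le: "k \<le> (\<Sum>r<n. D r * (cmod (X r c))\<^sup>2)" unfolding k_def by (rule kappa_le[OF d D])
  have "of_real \<rho>' = of_real \<rho> *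
      (1 + (\<Sum>r<n. cnj (X r c) * (\<Sum>s<n. minv n (id_plus D C X) r s * (of_real (D s) * X s c))))"
    using det_id_plus_insert[OF insert.hyps d] unfolding \<rho> \<rho>' .
  from arg_cong[OF this, of Re] have eq: "\<rho>' = \<rho> * (1 + k)" unfolding k_def by (simp del: Re_sum)
  then have "1 + k > 0" using \<rho>(1) \<rho>'(1) by (smt (verit) mult_nonneg_nonpos)
  then have "ln \<rho>' \<le> ln \<rho> + k" unfolding eq using \<rho>(1) ln_add_one_self_le_self2[of k] by (simp add: ln_mult)
  then show ?case using insert.IH insert.hyps k_le \<rho>' unfolding \<rho> \<rho>' by simp
qed

context gaussian_block_matrix
begin

definition lndet :: "(nat \<Rightarrow> real) \<Rightarrow> (nat \<times> nat \<times> nat \<times> nat \<Rightarrow> complex) \<Rightarrow> real" where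
  "lndet d \<omega> = ln (Re (det (fmat nr (id_plus (\<lambda>r. d (r div M)) cs (X \<omega>)))))"

lemma lndet_bounds:
  assumes d: "\<And>m. m < B \<Longrightarrow> d m \<ge> 0"
  shows "0 \<le> lndet d \<omega>" "lndet d \<omega> \<le> (\<Sum>c\<in>cs. \<Sum>r<nr. d (r div M) * (cmod (X \<omega> r c))\<^sup>2)"
proof -
  have "d (r div M) \<ge> 0" if "r < nr" for r using that by (intro d) (simp add: less_mult_imp_div_less)
  then have "0 \<le> lndet d \<omega> \<and> lndet d \<omega> \<le> (\<Sum>c\<in>cs. \<Sum>r<nr. d (r div M) * (cmod (X \<omega> r c))\<^sup>2)"
    unfolding lndet_def by (intro ln_det_id_plus_bounds) auto
  then show "0 \<le> lndet d \<omega>" "lndet d \<omega> \<le> (\<Sum>c\<in>cs. \<Sum>r<nr. d (r div M) * (cmod (X \<omega> r c))\<^sup>2)" by auto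
qed

lemma lndet_measurable: "lndet d \<in> borel_measurable \<Omega>"
  unfolding lndet_def[abs_def]
  by (intro borel_measurable_ln borel_measurable_continuous_on[OF continuous_on_Re[OF continuous_on_id]]
      borel_measurable_det id_plus_measurable)

lemma integrable_X_sq:
  assumes "r < nr" "c \<in> cs"
  shows "integrable \<Omega> (\<lambda>\<omega>. (cmod (X \<omega> r c))\<^sup>2)"
    and "(\<integral>\<omega>. (cmod (X \<omega> r c))\<^sup>2 \<partial>\<Omega>) = (\<sigma> (r div M) (c div N))\<^sup>2 * (\<integral>z. (cmod z)\<^sup>2 \<partial>CN01)"
proof -
  have mem: "(r div M, c div N, r mod M, c mod N) \<in> idx B A M N" using assms by (intro index_mem) auto
  show "integrable \<Omega> (\<lambda>\<omega>. (cmod (X \<omega> r c))\<^sup>2)"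
    unfolding X_def norm_mult power_mult_distrib
    by (intro integrable_mult_right integrable_coordinate_sq(1)[OF mem])
  show "(\<integral>\<omega>. (cmod (X \<omega> r c))\<^sup>2 \<partial>\<Omega>) = (\<sigma> (r div M) (c div N))\<^sup>2 * (\<integral>z. (cmod z)\<^sup>2 \<partial>CN01)"
    unfolding X_def norm_mult power_mult_distrib integral_mult_right_zero integrable_coordinate_sq(2)[OF mem] by simp
qed

lemma integrable_trace_bound: "integrable \<Omega> (\<lambda>\<omega>. \<Sum>c\<in>cs. \<Sum>r<nr. d (r div M) * (cmod (X \<omega> r c))\<^sup>2)"
  by (intro Bochner_Integration.integrable_sum integrable_mult_right integrable_X_sq(1)) auto

lemma integrable_lndet:
  assumes d: "\<And>m. m < B \<Longrightarrow> d m \<ge> 0"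
  shows "integrable \<Omega> (lndet d)"
proof (rule Bochner_Integration.integrable_bound[OF integrable_trace_bound lndet_measurable])
  have "norm (lndet d \<omega>) \<le> norm (\<Sum>c\<in>cs. \<Sum>r<nr. d (r div M) * (cmod (X \<omega> r c))\<^sup>2)" for \<omega>
    using lndet_bounds[where d = d and \<omega> = \<omega>, OF d] by simp
  then show "AE \<omega> in \<Omega>. norm (lndet d \<omega>) \<le> norm (\<Sum>c\<in>cs. \<Sum>r<nr. d (r div M) * (cmod (X \<omega> r c))\<^sup>2)" by simp
qed

lemma expectation_lndet_le:
  assumes d: "\<And>m. m < B \<Longrightarrow> d m \<ge> 0"
  shows "mean (lndet d) \<le>
    (\<Sum>k\<in>{c0..<A}. \<Sum>m<B. real N * real M * (d m * (\<sigma> m k)\<^sup>2)) * (\<integral>z. (cmod z)\<^sup>2 \<partial>CN01)"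
proof -
  let ?E = "\<integral>z. (cmod z)\<^sup>2 \<partial>CN01"
  have "mean (lndet d) \<le> (\<integral>\<omega>. (\<Sum>c\<in>cs. \<Sum>r<nr. d (r div M) * (cmod (X \<omega> r c))\<^sup>2) \<partial>\<Omega>)"
    using lndet_bounds(2)[OF d] by (intro integral_mono integrable_lndet[OF d] integrable_trace_bound)
  also have "\<dots> = (\<Sum>c\<in>cs. \<Sum>r<nr. d (r div M) * (\<integral>\<omega>. (cmod (X \<omega> r c))\<^sup>2 \<partial>\<Omega>))"
  proof -
    have i: "integrable \<Omega> (\<lambda>\<omega>. d (r div M) * (cmod (X \<omega> r c))\<^sup>2)" if "c \<in> cs" "r \<in> {..<nr}" for r c
      using that by (intro integrable_mult_right integrable_X_sq(1)) auto
    have "(\<integral>\<omega>. (\<Sum>c\<in>cs. \<Sum>r<nr. d (r div M) * (cmod (X \<omega> r c))\<^sup>2) \<partial>\<Omega>) =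
        (\<Sum>c\<in>cs. \<integral>\<omega>. (\<Sum>r<nr. d (r div M) * (cmod (X \<omega> r c))\<^sup>2) \<partial>\<Omega>)"
      by (rule Bochner_Integration.integral_sum, rule Bochner_Integration.integrable_sum, rule i)
    also have "\<dots> = (\<Sum>c\<in>cs. \<Sum>r<nr. \<integral>\<omega>. d (r div M) * (cmod (X \<omega> r c))\<^sup>2 \<partial>\<Omega>)"
      by (rule sum.cong[OF refl], rule Bochner_Integration.integral_sum, rule i)
    finally show ?thesis unfolding integral_mult_right_zero .
  qed
  also have "\<dots> = (\<Sum>c\<in>cs. \<Sum>r<nr. d (r div M) * ((\<sigma> (r div M) (c div N))\<^sup>2 * ?E))"
    by (intro sum.cong refl) (simp add: integrable_X_sq(2))
  also have "\<dots> = (\<Sum>k\<in>{c0..<A}. \<Sum>c\<in>{k * N..<k * N + N}. \<Sum>m<B. \<Sum>r\<in>{m * M..<m * M + M}. d m * ((\<sigma> m k)\<^sup>2 * ?E))"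
    unfolding sum_blocks sum.nat_group[symmetric]
    using row_lt col_lt by (intro sum.cong refl) auto
  also have "\<dots> = (\<Sum>k\<in>{c0..<A}. \<Sum>m<B. real N * real M * (d m * (\<sigma> m k)\<^sup>2)) * ?E"
    by (simp add: sum_distrib_left sum_distrib_right mult_ac)
  finally show ?thesis .
qed

lemma expectation_lndet_ge:
  assumes d: "\<And>m. m < B \<Longrightarrow> d m > 0"
  shows "mean (lndet (\<lambda>_. 1)) + (\<Sum>m<B. ln (d m) * (real M - mean (rowtr m)))
    \<le> mean (lndet d)"
proof -
  have pw: "lndet (\<lambda>_. 1) \<omega> + (\<Sum>m<B. ln (d m) * (real M - rowtr m \<omega>)) \<le> lndet d \<omega>" for \<omega>
  proof -
    have "d (r div M) > 0" if "r < nr" for r using that by (intro d) (simp add: less_mult_imp_div_less)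
    then have "lndet (\<lambda>_. 1) \<omega> + (\<Sum>r<nr. ln (d (r div M)) * (1 - gd \<omega> r)) \<le> lndet d \<omega>"
      unfolding lndet_def by (intro ln_det_tangent_rows) auto
    also have "(\<Sum>r<nr. ln (d (r div M)) * (1 - gd \<omega> r)) =
        (\<Sum>m<B. \<Sum>r\<in>{m * M..<m * M + M}. ln (d m) * (1 - gd \<omega> r))"
      unfolding sum.nat_group[symmetric] using row_lt by (intro sum.cong refl) auto
    also have "\<dots> = (\<Sum>m<B. ln (d m) * (real M - rowtr m \<omega>))"
      unfolding rowtr_def by (simp add: sum_distrib_left[symmetric] sum_subtractf)
    finally show ?thesis .
  qed
  have d0: "0 \<le> d m" if "m < B" for m using d[OF that] by simp
  have i1: "integrable \<Omega> (\<lambda>\<omega>. \<Sum>m<B. ln (d m) * (real M - rowtr m \<omega>))"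
    by (intro Bochner_Integration.integrable_sum integrable_mult_right Bochner_Integration.integrable_diff integrable_rowtr) auto
  have "(\<integral>\<omega>. lndet (\<lambda>_. 1) \<omega> + (\<Sum>m<B. ln (d m) * (real M - rowtr m \<omega>)) \<partial>\<Omega>) \<le> mean (lndet d)"
    using pw by (intro integral_mono Bochner_Integration.integrable_add integrable_lndet i1) (auto simp: d0)
  also have "(\<integral>\<omega>. lndet (\<lambda>_. 1) \<omega> + (\<Sum>m<B. ln (d m) * (real M - rowtr m \<omega>)) \<partial>\<Omega>) =
      mean (lndet (\<lambda>_. 1)) + (\<integral>\<omega>. (\<Sum>m<B. ln (d m) * (real M - rowtr m \<omega>)) \<partial>\<Omega>)"
    by (intro Bochner_Integration.integral_add integrable_lndet i1) auto
  also have "(\<integral>\<omega>. (\<Sum>m<B. ln (d m) * (real M - rowtr m \<omega>)) \<partial>\<Omega>) =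
      (\<Sum>m<B. \<integral>\<omega>. ln (d m) * (real M - rowtr m \<omega>) \<partial>\<Omega>)"
    by (intro Bochner_Integration.integral_sum integrable_mult_right Bochner_Integration.integrable_diff integrable_rowtr) auto
  also have "\<dots> = (\<Sum>m<B. ln (d m) * (real M - mean (rowtr m)))"
    using integrable_rowtr by (intro sum.cong refl) (simp add: prob.prob_space)
  finally show ?thesis .
qed

text \<open>Both matrices are built from the same sample \<open>\<omega>\<close>, so the tangent
  inequality applies pointwise. The slope in group \<open>k\<close> is the total of
  \<open>1 - coresolvent\<close> over its columns.\<close>

lemma expectation_lndet_columns_le:
  assumes \<tau>: "\<And>k. c0 \<le> k \<Longrightarrow> k < A \<Longrightarrow> \<tau> k \<ge> 0"
    and \<sigma>': "\<And>m k. m < B \<Longrightarrow> c0 \<le> k \<Longrightarrow> k < A \<Longrightarrow> \<sigma>' m k = sqrt (\<tau> k) * \<sigma> m k"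
  shows "(\<integral>\<omega>. gaussian_block_matrix.lndet B A M N c0 \<sigma>' (\<lambda>_. 1) \<omega> \<partial>\<Omega>)
    \<le> mean (lndet (\<lambda>_. 1)) + (\<Sum>k\<in>{c0..<A}. (\<tau> k - 1) * (real N - mean (coltr k)))"
proof -
  interpret Y: gaussian_block_matrix B A M N c0 \<sigma>' using M_pos N_pos by unfold_locales
  have cdiv: "c0 \<le> c div N \<and> c div N < A" if "c \<in> cs" for c
    using that N_pos by (auto simp: less_mult_imp_div_less less_eq_div_iff_mult_less_eq)
  have pw: "Y.lndet (\<lambda>_. 1) \<omega> \<le> lndet (\<lambda>_. 1) \<omega> + (\<Sum>k\<in>{c0..<A}. (\<tau> k - 1) * (real N - coltr k \<omega>))" for \<omega>
  proof -
    have "Y.lndet (\<lambda>_. 1) \<omega> \<le> lndet (\<lambda>_. 1) \<omega> + (\<Sum>c\<in>cs. (\<tau> (c div N) - 1) *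
        Re (\<Sum>r<nr. \<Sum>s<nr. cnj (X \<omega> r c) * resolvent nr cs (X \<omega>) r s * X \<omega> s c))"
      unfolding lndet_def Y.lndet_def
    proof (rule ln_det_tangent_columns)
      show "\<tau> (c div N) \<ge> 0" if "c \<in> cs" for c using cdiv[OF that] \<tau> by blast
      show "Y.X \<omega> r c = of_real (sqrt (\<tau> (c div N))) * X \<omega> r c" if "r < nr" "c \<in> cs" for r c
        using cdiv[OF that(2)] that(1) by (simp add: X_def Y.X_def \<sigma>' less_mult_imp_div_less)
    qed simp
    also have "(\<Sum>c\<in>cs. (\<tau> (c div N) - 1) *
        Re (\<Sum>r<nr. \<Sum>s<nr. cnj (X \<omega> r c) * resolvent nr cs (X \<omega>) r s * X \<omega> s c)) =
        (\<Sum>c\<in>cs. (\<tau> (c div N) - 1) * (1 - cg \<omega> c))"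
      unfolding coresolvent_def resolvent_col_def by (simp only: sum_distrib_left mult.assoc diff_diff_eq2 add_diff_cancel_left')
    also have "\<dots> = (\<Sum>k\<in>{c0..<A}. \<Sum>c\<in>{k * N..<k * N + N}. (\<tau> k - 1) * (1 - cg \<omega> c))"
      unfolding sum_blocks using col_lt by (intro sum.cong refl) auto
    also have "\<dots> = (\<Sum>k\<in>{c0..<A}. (\<tau> k - 1) * (real N - coltr k \<omega>))"
      unfolding coltr_def by (simp add: sum_distrib_left[symmetric] sum_subtractf)
    finally show ?thesis .
  qed
  have i1: "integrable \<Omega> (\<lambda>\<omega>. \<Sum>k\<in>{c0..<A}. (\<tau> k - 1) * (real N - coltr k \<omega>))"
    by (intro Bochner_Integration.integrable_sum integrable_mult_right Bochner_Integration.integrable_diff integrable_coltr) auto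
  have "(\<integral>\<omega>. Y.lndet (\<lambda>_. 1) \<omega> \<partial>\<Omega>) \<le> (\<integral>\<omega>. lndet (\<lambda>_. 1) \<omega> + (\<Sum>k\<in>{c0..<A}. (\<tau> k - 1) * (real N - coltr k \<omega>)) \<partial>\<Omega>)"
    using pw by (intro integral_mono Bochner_Integration.integrable_add integrable_lndet Y.integrable_lndet i1) auto
  also have "\<dots> = mean (lndet (\<lambda>_. 1)) + (\<integral>\<omega>. (\<Sum>k\<in>{c0..<A}. (\<tau> k - 1) * (real N - coltr k \<omega>)) \<partial>\<Omega>)"
    by (intro Bochner_Integration.integral_add integrable_lndet i1) auto
  also have "(\<integral>\<omega>. (\<Sum>k\<in>{c0..<A}. (\<tau> k - 1) * (real N - coltr k \<omega>)) \<partial>\<Omega>) =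
      (\<Sum>k\<in>{c0..<A}. \<integral>\<omega>. (\<tau> k - 1) * (real N - coltr k \<omega>) \<partial>\<Omega>)"
    by (intro Bochner_Integration.integral_sum integrable_mult_right Bochner_Integration.integrable_diff integrable_coltr) auto
  also have "\<dots> = (\<Sum>k\<in>{c0..<A}. (\<tau> k - 1) * (real N - mean (coltr k)))"
    using integrable_coltr by (intro sum.cong refl) (simp add: prob.prob_space)
  finally show ?thesis .
qed

end

text \<open>The approximate fixed-point equations force equal row values and equal column values within
  a block: comparing the largest and smallest \<open>a m\<close> through the increasing function
  \<open>x + (\<Sum>k. S m k * x / (1 + w k * x))\<close>, which does not depend on \<open>m\<close> and has slope at least 1.\<close>

lemma fixed_point_stability:
  fixes S :: "nat \<Rightarrow> nat \<Rightarrow> real" and g :: "nat \<Rightarrow> nat" and w :: "nat \<Rightarrow> real"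
  assumes B: "B > 0" and K: "finite K" and S0: "\<And>m k. m < B \<Longrightarrow> k \<in> K \<Longrightarrow> S m k \<ge> 0"
    and rows: "\<And>m m' f. m < B \<Longrightarrow> m' < B \<Longrightarrow> (\<Sum>k\<in>K. S m k * f (g k)) = (\<Sum>k\<in>K. S m' k * f (g k))"
    and cols: "\<And>k. k \<in> K \<Longrightarrow> (\<Sum>m<B. S m k) = w (g k)" and \<gamma>: "\<gamma> \<ge> 0"
  shows "\<exists>c\<ge>0. \<forall>\<epsilon> a v e. \<epsilon> \<ge> 0 \<longrightarrow>
      (\<forall>m<B. 0 \<le> a m \<and> a m \<le> \<gamma>) \<longrightarrow> (\<forall>m<B. \<forall>k\<in>K. \<bar>e m k\<bar> \<le> \<epsilon>) \<longrightarrow>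
      (\<forall>m<B. \<gamma> - a m = (\<Sum>k\<in>K. S m k * (a m * v k + e m k))) \<longrightarrow>
      (\<forall>k\<in>K. 1 - v k = (\<Sum>m<B. S m k * (a m * v k + e m k))) \<longrightarrow>
      (\<forall>m<B. \<forall>m'<B. \<bar>a m - a m'\<bar> \<le> c * \<epsilon>) \<and> (\<forall>k\<in>K. \<forall>k'\<in>K. g k = g k' \<longrightarrow> \<bar>v k - v k'\<bar> \<le> c * \<epsilon>)"
proof -
  define \<Theta> where "\<Theta> = (\<Sum>m<B. \<Sum>k\<in>K. S m k)"
  have row_le: "(\<Sum>k\<in>K. S m k) \<le> \<Theta>" if "m < B" for m
    unfolding \<Theta>_def by (rule member_le_sum) (use that S0 in \<open>auto intro: sum_nonneg\<close>)
  have col_le: "(\<Sum>m<B. S m k) \<le> \<Theta>" if "k \<in> K" for k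
    unfolding \<Theta>_def by (intro sum_mono member_le_sum that K) (use S0 in auto)
  have \<Theta>0: "\<Theta> \<ge> 0" unfolding \<Theta>_def using S0 by (intro sum_nonneg) auto
  have w0: "w (g k) \<ge> 0" if "k \<in> K" for k
    unfolding cols[OF that, symmetric] using S0 that by (intro sum_nonneg) auto
  \<comment> \<open>\<open>c1\<close> bounds the residual of the row equation once \<open>v\<close>
    is eliminated: \<open>\<Theta>\<close> comes from the error term itself,
    \<open>\<gamma> * \<Theta> * \<Theta>\<close> from the error hidden in \<open>v\<close>. The
    spread of \<open>a\<close> is then \<open>2 * c1\<close>; the rest of \<open>c\<close> carries
    this spread and the error over to \<open>v\<close>.\<close>
  define c1 where "c1 = \<Theta> + \<gamma> * \<Theta> * \<Theta>"
  define c where "c = 2 * c1 + 2 * (\<Theta> * (2 * c1)) + 2 * \<Theta>"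
  have c10: "c1 \<ge> 0" unfolding c1_def using \<Theta>0 \<gamma> by simp
  have c0: "c \<ge> 0" unfolding c_def using c10 \<Theta>0 by simp
  show ?thesis
  proof (rule exI[of _ c], rule conjI[OF c0], intro allI impI)
    fix \<epsilon> :: real and a v :: "nat \<Rightarrow> real" and e :: "nat \<Rightarrow> nat \<Rightarrow> real"
    assume \<epsilon>: "\<epsilon> \<ge> 0" and hyps: "\<forall>m<B. 0 \<le> a m \<and> a m \<le> \<gamma>" "\<forall>m<B. \<forall>k\<in>K. \<bar>e m k\<bar> \<le> \<epsilon>"
      "\<forall>m<B. \<gamma> - a m = (\<Sum>k\<in>K. S m k * (a m * v k + e m k))"
      "\<forall>k\<in>K. 1 - v k = (\<Sum>m<B. S m k * (a m * v k + e m k))"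
    have a: "0 \<le> a m \<and> a m \<le> \<gamma>" if "m < B" for m using hyps(1) that by blast
    have e: "\<bar>e m k\<bar> \<le> \<epsilon>" if "m < B" "k \<in> K" for m k using hyps(2) that by blast
    have row: "\<gamma> - a m = (\<Sum>k\<in>K. S m k * (a m * v k + e m k))" if "m < B" for m using hyps(3) that by blast
    have col: "1 - v k = (\<Sum>m<B. S m k * (a m * v k + e m k))" if "k \<in> K" for k using hyps(4) that by blast
    define t where "t k = (\<Sum>m<B. S m k * a m)" for k
    define \<eta> where "\<eta> k = (\<Sum>m<B. S m k * e m k)" for k
    define \<zeta> where "\<zeta> m = (\<Sum>k\<in>K. S m k * e m k)" for m
    have t0: "t k \<ge> 0" if "k \<in> K" for k unfolding t_def using S0 a that by (intro sum_nonneg) auto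
    have \<eta>: "\<bar>\<eta> k\<bar> \<le> \<Theta> * \<epsilon>" if "k \<in> K" for k
    proof -
      have "\<bar>\<eta> k\<bar> \<le> (\<Sum>m<B. \<bar>S m k * e m k\<bar>)" unfolding \<eta>_def by (rule sum_abs)
      also have "\<dots> \<le> (\<Sum>m<B. S m k * \<epsilon>)"
        using S0 e that by (intro sum_mono) (auto simp: abs_mult intro!: mult_left_mono)
      also have "\<dots> \<le> \<Theta> * \<epsilon>"
        unfolding sum_distrib_right[symmetric] using col_le[OF that] \<epsilon> by (rule mult_right_mono)
      finally show ?thesis .
    qed
    have \<zeta>: "\<bar>\<zeta> m\<bar> \<le> \<Theta> * \<epsilon>" if "m < B" for m
    proof -
      have "\<bar>\<zeta> m\<bar> \<le> (\<Sum>k\<in>K. \<bar>S m k * e m k\<bar>)" unfolding \<zeta>_def by (rule sum_abs)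
      also have "\<dots> \<le> (\<Sum>k\<in>K. S m k * \<epsilon>)"
        using S0 e that by (intro sum_mono) (auto simp: abs_mult intro!: mult_left_mono)
      also have "\<dots> \<le> \<Theta> * \<epsilon>"
        unfolding sum_distrib_right[symmetric] using row_le[OF that] \<epsilon> by (rule mult_right_mono)
      finally show ?thesis .
    qed
    have v: "v k = 1 / (1 + t k) - \<eta> k / (1 + t k)" if "k \<in> K" for k
    proof -
      have "(\<Sum>m<B. S m k * (a m * v k + e m k)) = t k * v k + \<eta> k"
        unfolding t_def \<eta>_def by (simp add: sum_distrib_left sum.distrib algebra_simps)
      then have "v k * (1 + t k) = 1 - \<eta> k" using col[OF that] by (simp add: algebra_simps)
      then have "v k = (1 - \<eta> k) / (1 + t k)" using t0[OF that] by (simp add: eq_divide_eq)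
      then show ?thesis by (simp add: diff_divide_distrib)
    qed
    have \<eta>t: "\<bar>\<eta> k / (1 + t k)\<bar> \<le> \<Theta> * \<epsilon>" if "k \<in> K" for k
    proof -
      have "\<bar>\<eta> k / (1 + t k)\<bar> \<le> \<bar>\<eta> k\<bar> / 1"
        unfolding abs_divide using t0[OF that] by (intro divide_left_mono) auto
      then show ?thesis using \<eta>[OF that] by simp
    qed
    have near: "\<bar>a m + (\<Sum>k\<in>K. S m k * (a m / (1 + t k))) - \<gamma>\<bar> \<le> c1 * \<epsilon>" if m: "m < B" for m
    proof -
      have "(\<Sum>k\<in>K. S m k * (a m * v k + e m k)) =
          (\<Sum>k\<in>K. S m k * (a m / (1 + t k)) - a m * (S m k * (\<eta> k / (1 + t k))) + S m k * e m k)"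
        by (intro sum.cong refl) (simp add: v algebra_simps)
      also have "\<dots> = (\<Sum>k\<in>K. S m k * (a m / (1 + t k))) - a m * (\<Sum>k\<in>K. S m k * (\<eta> k / (1 + t k))) + \<zeta> m"
        unfolding \<zeta>_def by (simp add: sum.distrib sum_subtractf sum_distrib_left)
      finally have eq: "a m + (\<Sum>k\<in>K. S m k * (a m / (1 + t k))) - \<gamma> =
          a m * (\<Sum>k\<in>K. S m k * (\<eta> k / (1 + t k))) - \<zeta> m" using row[OF m] by simp
      have "\<bar>\<Sum>k\<in>K. S m k * (\<eta> k / (1 + t k))\<bar> \<le> (\<Sum>k\<in>K. \<bar>S m k * (\<eta> k / (1 + t k))\<bar>)" by (rule sum_abs)
      also have "\<dots> \<le> (\<Sum>k\<in>K. S m k * (\<Theta> * \<epsilon>))"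
      proof (rule sum_mono)
        fix k assume k: "k \<in> K"
        show "\<bar>S m k * (\<eta> k / (1 + t k))\<bar> \<le> S m k * (\<Theta> * \<epsilon>)"
          unfolding abs_mult using S0[OF m k] mult_left_mono[OF \<eta>t[OF k] S0[OF m k]] by simp
      qed
      also have "\<dots> \<le> \<Theta> * (\<Theta> * \<epsilon>)"
        unfolding sum_distrib_right[symmetric] using row_le[OF m] \<Theta>0 \<epsilon> by (intro mult_right_mono) auto
      finally have "a m * \<bar>\<Sum>k\<in>K. S m k * (\<eta> k / (1 + t k))\<bar> \<le> \<gamma> * (\<Theta> * (\<Theta> * \<epsilon>))"
        using a[OF m] \<gamma> by (intro mult_mono) auto
      then have "\<bar>a m * (\<Sum>k\<in>K. S m k * (\<eta> k / (1 + t k)))\<bar> \<le> \<gamma> * \<Theta> * \<Theta> * \<epsilon>"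
        using a[OF m] by (simp add: abs_mult mult.assoc)
      then show ?thesis using \<zeta>[OF m] unfolding eq c1_def by (simp add: distrib_right)
    qed
    have fin: "finite (a ` {..<B})" "a ` {..<B} \<noteq> {}" using B by auto
    obtain m1 where m1: "m1 < B" "\<And>m. m < B \<Longrightarrow> a m \<le> a m1"
      using Max_in[OF fin] Max_ge[OF fin(1)] by (metis (no_types, lifting) imageE imageI lessThan_iff)
    obtain m2 where m2: "m2 < B" "\<And>m. m < B \<Longrightarrow> a m2 \<le> a m"
      using Min_in[OF fin] Min_le[OF fin(1)] by (metis (no_types, lifting) imageE imageI lessThan_iff)
    let ?x = "a m1" and ?y = "a m2"
    have x0: "0 \<le> ?x" "0 \<le> ?y" "?y \<le> ?x" using a m1 m2 by auto
    have tx: "t k \<le> w (g k) * ?x" if "k \<in> K" for k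
      unfolding t_def cols[OF that, symmetric] sum_distrib_right
      using m1 S0 that by (intro sum_mono mult_left_mono) auto
    have ty: "w (g k) * ?y \<le> t k" if "k \<in> K" for k
      unfolding t_def cols[OF that, symmetric] sum_distrib_right
      using m2 S0 that by (intro sum_mono mult_left_mono) auto
    \<comment> \<open>At the largest \<open>a m\<close> the value \<open>t k\<close> is replaced by
      its upper bound, at the smallest by its lower bound. Both rows then give inequalities for a
      function of one variable, evaluated at \<open>?x\<close> and at \<open>?y\<close>.\<close>
    have up: "?x + (\<Sum>k\<in>K. S m1 k * (?x / (1 + w (g k) * ?x))) \<le> \<gamma> + c1 * \<epsilon>"
    proof -
      have "(\<Sum>k\<in>K. S m1 k * (?x / (1 + w (g k) * ?x))) \<le> (\<Sum>k\<in>K. S m1 k * (?x / (1 + t k)))"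
      proof (intro sum_mono mult_left_mono divide_left_mono)
        fix k assume k: "k \<in> K"
        show "1 + t k \<le> 1 + w (g k) * ?x" using tx[OF k] by simp
        have "0 < 1 + t k" using t0[OF k] by simp
        moreover have "0 < 1 + w (g k) * ?x" using w0[OF k] x0 by (simp add: add_pos_nonneg)
        ultimately show "0 < (1 + w (g k) * ?x) * (1 + t k)" by simp
      qed (use x0 S0 m1 in auto)
      then show ?thesis using near[OF m1(1)] by linarith
    qed
    have lo: "\<gamma> - c1 * \<epsilon> \<le> ?y + (\<Sum>k\<in>K. S m2 k * (?y / (1 + w (g k) * ?y)))"
    proof -
      have "(\<Sum>k\<in>K. S m2 k * (?y / (1 + t k))) \<le> (\<Sum>k\<in>K. S m2 k * (?y / (1 + w (g k) * ?y)))"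
      proof (intro sum_mono mult_left_mono divide_left_mono)
        fix k assume k: "k \<in> K"
        show "1 + w (g k) * ?y \<le> 1 + t k" using ty[OF k] by simp
        have "0 < 1 + t k" using t0[OF k] by simp
        moreover have "0 < 1 + w (g k) * ?y" using w0[OF k] x0 by (simp add: add_pos_nonneg)
        ultimately show "0 < (1 + t k) * (1 + w (g k) * ?y)" by simp
      qed (use x0 S0 m2 in auto)
      then show ?thesis using near[OF m2(1)] by linarith
    qed
    \<comment> \<open>Equal row sums per class move row \<open>m2\<close> to row \<open>m1\<close>.
      By monotonicity of the sum the linear term alone then bounds \<open>?x - ?y\<close>.\<close>
    have "(\<Sum>k\<in>K. S m2 k * (?y / (1 + w (g k) * ?y))) = (\<Sum>k\<in>K. S m1 k * (?y / (1 + w (g k) * ?y)))"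
      by (rule rows[OF m2(1) m1(1), of "\<lambda>i. ?y / (1 + w i * ?y)"])
    also have "\<dots> \<le> (\<Sum>k\<in>K. S m1 k * (?x / (1 + w (g k) * ?x)))"
    proof (intro sum_mono mult_left_mono)
      fix k assume k: "k \<in> K"
      have "0 < 1 + w (g k) * ?x" "0 < 1 + w (g k) * ?y" using w0[OF k] x0 by (simp_all add: add_pos_nonneg)
      then show "?y / (1 + w (g k) * ?y) \<le> ?x / (1 + w (g k) * ?x)"
        using x0 by (simp add: divide_le_eq le_divide_eq algebra_simps frac_le_eq)
    qed (use S0 m1 in auto)
    finally have xy: "?x - ?y \<le> 2 * c1 * \<epsilon>" using up lo by linarith
    have A: "\<bar>a m - a m'\<bar> \<le> 2 * c1 * \<epsilon>" if "m < B" "m' < B" for m m'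
      using m1(2)[OF that(1)] m1(2)[OF that(2)] m2(2)[OF that(1)] m2(2)[OF that(2)] xy by linarith
    have T: "\<bar>t k - w (g k) * a 0\<bar> \<le> \<Theta> * (2 * c1 * \<epsilon>)" if k: "k \<in> K" for k
    proof -
      have "\<bar>t k - w (g k) * a 0\<bar> = \<bar>\<Sum>m<B. S m k * (a m - a 0)\<bar>"
        unfolding t_def cols[OF k, symmetric] by (simp add: sum_distrib_right right_diff_distrib sum_subtractf)
      also have "\<dots> \<le> (\<Sum>m<B. \<bar>S m k * (a m - a 0)\<bar>)" by (rule sum_abs)
      also have "\<dots> \<le> (\<Sum>m<B. S m k * (2 * c1 * \<epsilon>))"
        using S0 k A B by (intro sum_mono) (auto simp: abs_mult intro!: mult_left_mono)
      also have "\<dots> \<le> \<Theta> * (2 * c1 * \<epsilon>)"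
        unfolding sum_distrib_right[symmetric] using col_le[OF k] c10 \<epsilon> by (intro mult_right_mono) auto
      finally show ?thesis .
    qed
    have "\<bar>v k - v k'\<bar> \<le> 2 * (\<Theta> * (2 * c1 * \<epsilon>)) + 2 * (\<Theta> * \<epsilon>)" if k: "k \<in> K" "k' \<in> K" "g k = g k'" for k k'
    proof -
      have "\<bar>1 / (1 + t k) - 1 / (1 + t k')\<bar> \<le> \<bar>t k - t k'\<bar>"
      proof -
        have p: "1 \<le> (1 + t k) * (1 + t k')"
          using mult_mono[of 1 "1 + t k" 1 "1 + t k'"] t0[OF k(1)] t0[OF k(2)] by simp
        have "1 / (1 + t k) - 1 / (1 + t k') = (t k' - t k) / ((1 + t k) * (1 + t k'))"
          using t0[OF k(1)] t0[OF k(2)] by (subst diff_frac_eq) (auto simp: algebra_simps)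
        also have "\<bar>\<dots>\<bar> = \<bar>t k' - t k\<bar> / ((1 + t k) * (1 + t k'))" using p by (simp add: abs_divide)
        also have "\<dots> \<le> \<bar>t k' - t k\<bar> / 1" using p by (intro divide_left_mono) auto
        finally show ?thesis by simp
      qed
      then show ?thesis
        using \<eta>t[OF k(1)] \<eta>t[OF k(2)] T[OF k(1)] T[OF k(2)] unfolding v[OF k(1)] v[OF k(2)] k(3) by linarith
    qed
    moreover have "2 * (\<Theta> * (2 * c1 * \<epsilon>)) + 2 * (\<Theta> * \<epsilon>) \<le> c * \<epsilon>" "2 * c1 * \<epsilon> \<le> c * \<epsilon>"
      using c10 \<Theta>0 \<epsilon> unfolding c_def by (simp_all add: algebra_simps)
    ultimately show "(\<forall>m<B. \<forall>m'<B. \<bar>a m - a m'\<bar> \<le> c * \<epsilon>) \<and> (\<forall>k\<in>K. \<forall>k'\<in>K. g k = g k' \<longrightarrow> \<bar>v k - v k'\<bar> \<le> c * \<epsilon>)"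
      using A by (meson order_trans)
  qed
qed

section \<open>Comparison with the block average\<close>

text \<open>The power \<open>Q k / real N\<close> is split into two square roots, one for each
  factor of the Gram matrix. \<open>cmod\<close> and \<open>Re\<close> of the determinant agree
  because it is real and at least 1.\<close>

lemma logdet_eq_lndet:
  assumes MN: "M > 0" "N > 0" and lam: "\<And>m. m < B \<Longrightarrow> lam m > 0" and Q: "\<And>k. k < A \<Longrightarrow> Q k \<ge> 0"
  shows "logdet \<beta> B A M N lam Q c0 =
    gaussian_block_matrix.lndet B A M N c0 (\<lambda>m k. \<beta> m k * sqrt (Q k / real N)) (\<lambda>m. 1 / lam m)"
proof (rule ext)
  fix \<omega>
  interpret G: gaussian_block_matrix B A M N c0 "\<lambda>m k. \<beta> m k * sqrt (Q k / real N)"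
    using MN by unfold_locales
  have "mat (B * M) (B * M) (\<lambda>(r, s). (if r = s then 1 else 0) + (1 / complex_of_real (lam (r div M))) *
        (\<Sum>col \<in> {c0 * N..<A * N}. Hent \<beta> M N \<omega> r col * complex_of_real (Q (col div N) / real N)
             * cnj (Hent \<beta> M N \<omega> s col))) =
      fmat (B * M) (id_plus (\<lambda>r. 1 / lam (r div M)) {c0 * N..<A * N} (G.X \<omega>))" (is "?L = ?R")
  proof (rule eq_matI)
    fix r s assume "r < dim_row ?R" "s < dim_col ?R"
    then have rs: "r < B * M" "s < B * M" by auto
    have "Hent \<beta> M N \<omega> r c * complex_of_real (Q (c div N) / real N) * cnj (Hent \<beta> M N \<omega> s c) =
        G.X \<omega> r c * cnj (G.X \<omega> s c)" if c: "c \<in> {c0 * N..<A * N}" for c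
    proof -
      have "Q (c div N) \<ge> 0" using c by (intro Q) (simp add: less_mult_imp_div_less)
      then have "complex_of_real (Q (c div N) / real N) =
          complex_of_real (sqrt (Q (c div N) / real N)) * complex_of_real (sqrt (Q (c div N) / real N))"
        unfolding of_real_mult[symmetric] by simp
      then show ?thesis unfolding Hent_def G.X_def by (simp only: of_real_mult complex_cnj_mult complex_cnj_complex_of_real mult_ac)
    qed
    then have "(\<Sum>c \<in> {c0 * N..<A * N}. Hent \<beta> M N \<omega> r c * complex_of_real (Q (c div N) / real N)
             * cnj (Hent \<beta> M N \<omega> s c)) = gram {c0 * N..<A * N} (G.X \<omega>) r s"
      unfolding gram_def by (intro sum.cong refl) auto
    then show "?L $$ (r, s) = ?R $$ (r, s)"
      using rs by (simp add: id_plus_def)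
  qed auto
  moreover obtain \<rho> where "\<rho> \<ge> 1"
    "det (fmat (B * M) (id_plus (\<lambda>r. 1 / lam (r div M)) {c0 * N..<A * N} (G.X \<omega>))) = of_real \<rho>"
  proof -
    have "1 / lam (r div M) \<ge> 0" if "r < B * M" for r
      using lam[of "r div M"] that by (simp add: less_mult_imp_div_less less_imp_le)
    then show thesis using that det_id_plus_ge_1[of "{c0 * N..<A * N}" "B * M" "\<lambda>r. 1 / lam (r div M)" "G.X \<omega>"] by auto
  qed
  ultimately show "logdet \<beta> B A M N lam Q c0 \<omega> = G.lndet (\<lambda>m. 1 / lam m) \<omega>"
    unfolding logdet_def G.lndet_def by simp
qed

lemma block_sum: "(\<Sum>k\<in>{b * B..<b * B + B}. h k) = (\<Sum>j<B. h (b * B + j))" for b B :: nat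
  by (rule sum.reindex_bij_witness[of _ "\<lambda>j. b * B + j" "\<lambda>k. k - b * B"]) auto

definition block_average :: "nat \<Rightarrow> (nat \<Rightarrow> real) \<Rightarrow> nat \<Rightarrow> real" where
  "block_average B Q k = (\<Sum>j<B. Q (k div B * B + j)) / real B"

lemma sum_block_average:
  assumes "B > 0"
  shows "(\<Sum>k<n * B. block_average B Q k) = (\<Sum>k<n * B. Q k)"
proof -
  have "(\<Sum>k\<in>{b * B..<b * B + B}. block_average B Q k) = (\<Sum>k\<in>{b * B..<b * B + B}. Q k)" for b
    using assms unfolding block_sum block_average_def by simp
  then show ?thesis unfolding sum.nat_group[symmetric] by simp
qed

lemma block_average_nonneg:
  assumes Q: "\<And>k. k < n * B \<Longrightarrow> Q k \<ge> 0" and k: "k < n * B"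
  shows "block_average B Q k \<ge> 0"
  unfolding block_average_def
proof (intro divide_nonneg_nonneg sum_nonneg Q)
  fix j assume j: "j \<in> {..<B}"
  have "Suc (k div B) * B \<le> n * B" using k by (intro mult_le_mono1) (simp add: less_mult_imp_div_less Suc_le_eq)
  then show "k div B * B + j < n * B" using j by simp
qed simp

lemma strongly_symmetric_row_sum:
  assumes "strongly_symmetric_blocks B A' \<beta>" "b < A'" "m < B"
  shows "(\<Sum>j<B. f (\<beta> m (b * B + j))) = (\<Sum>j<B. f (\<beta> 0 (b * B + j)))"
proof -
  obtain s where s: "s permutes {0..<B}" "\<And>j. j < B \<Longrightarrow> \<beta> m (b * B + j) = \<beta> 0 (b * B + s j)"
    using assms unfolding strongly_symmetric_blocks_def by blast
  have "(\<Sum>j<B. f (\<beta> m (b * B + j))) = (\<Sum>j\<in>{0..<B}. f (\<beta> 0 (b * B + s j)))"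
    by (rule sum.cong) (auto simp: s(2))
  also have "\<dots> = (\<Sum>j\<in>{0..<B}. f (\<beta> 0 (b * B + j)))"
    using sum.permute[OF s(1), of "\<lambda>j. f (\<beta> 0 (b * B + j))"] by (simp add: comp_def)
  finally show ?thesis by (simp add: lessThan_atLeast0)
qed

lemma strongly_symmetric_col_sum:
  assumes "strongly_symmetric_blocks B A' \<beta>" "b < A'" "j < B"
  shows "(\<Sum>m<B. f (\<beta> m (b * B + j))) = (\<Sum>m<B. f (\<beta> m (b * B)))"
proof -
  obtain s where s: "s permutes {0..<B}" "\<And>m. m < B \<Longrightarrow> \<beta> m (b * B + j) = \<beta> (s m) (b * B)"
    using assms unfolding strongly_symmetric_blocks_def by blast
  have "(\<Sum>m<B. f (\<beta> m (b * B + j))) = (\<Sum>m\<in>{0..<B}. f (\<beta> (s m) (b * B)))"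
    by (rule sum.cong) (auto simp: s(2))
  also have "\<dots> = (\<Sum>m\<in>{0..<B}. f (\<beta> m (b * B)))"
    using sum.permute[OF s(1), of "\<lambda>m. f (\<beta> m (b * B))"] by (simp add: comp_def)
  finally show ?thesis by (simp add: lessThan_atLeast0)
qed

definition mean_rate :: "(nat \<Rightarrow> nat \<Rightarrow> real) \<Rightarrow> nat \<Rightarrow> nat \<Rightarrow> nat \<Rightarrow> nat \<Rightarrow>
    (nat \<Rightarrow> real) \<Rightarrow> (nat \<Rightarrow> real) \<Rightarrow> nat \<Rightarrow> real" where
  "mean_rate \<beta> B A M N lam Q c0 =
     (\<integral>\<omega>. logdet \<beta> B A M N lam Q c0 \<omega> \<partial>PiM (idx B A M N) (\<lambda>_. CN01)) / real N"

text \<open>Both rates are compared with the one at \<open>lam = 1\<close> and averaged powers: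
  concavity bounds the left rate from above there, convexity bounds the right rate from below.
  \<open>L\<close> may depend on \<open>lam\<close> and \<open>Q\<close> but not on
  \<open>N\<close>, so the error vanishes in the limit.\<close>

lemma block_comparison:
  fixes \<beta> :: "nat \<Rightarrow> nat \<Rightarrow> real" and lam Q :: "nat \<Rightarrow> real" and \<gamma> :: real
  assumes B: "B > 0" and A: "A = A' * B" and b0: "b0 < A'"
    and sym: "strongly_symmetric_blocks B A' \<beta>" and \<gamma>: "\<gamma> > 0"
    and lam: "\<And>m. m < B \<Longrightarrow> lam m > 0" and lam_sum: "(\<Sum>m<B. lam m) = real B"
    and Q: "\<And>k. k < A \<Longrightarrow> Q k \<ge> 0"
  obtains L :: real where "\<And>N M. N > 0 \<Longrightarrow> M > 0 \<Longrightarrow> real M = \<gamma> * real N \<Longrightarrow>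
    mean_rate \<beta> B A M N (\<lambda>_. 1) Q (b0 * B) \<le>
    mean_rate \<beta> B A M N lam (block_average B Q) (b0 * B)
      + L * sqrt (real A / real N)"
proof -
  define q where "q b = (\<Sum>j<B. Q (b * B + j)) / real B" for b
  define c0 where "c0 = b0 * B"
  define K where "K = {c0..<A}"
  define S where "S m k = (\<beta> m k)\<^sup>2 * q (k div B)" for m k
  \<comment> \<open>Factors that turn the averaged powers back into \<open>Q\<close>. In a block
    without power, division by zero gives \<open>\<tau> k = 0\<close>, consistent with
    \<open>Q k = 0\<close> there.\<close>
  define \<tau> where "\<tau> k = Q k / q (k div B)" for k
  have av: "block_average B Q = (\<lambda>k. q (k div B))" by (simp add: block_average_def q_def fun_eq_iff)
  have bB: "b * B + j < A" if "b < A'" "j < B" for b j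
  proof -
    have "Suc b * B \<le> A' * B" using that by (intro mult_le_mono1) simp
    then show ?thesis using that A by simp
  qed
  have divA: "k div B < A'" if "k < A" for k using that A by (simp add: less_mult_imp_div_less)
  have q0: "q b \<ge> 0" if "b < A'" for b
    unfolding q_def using Q bB that by (intro divide_nonneg_nonneg sum_nonneg) auto
  have blockdiv: "k div B = b" if "k \<in> {b * B..<b * B + B}" for k b
    using that by (intro div_nat_eqI) (auto simp: mult.commute)
  have sumK: "(\<Sum>k\<in>K. f k) = (\<Sum>b\<in>{b0..<A'}. \<Sum>k\<in>{b * B..<b * B + B}. f k)" for f :: "nat \<Rightarrow> real"
    unfolding K_def c0_def A by (rule sum_blocks)
  have finK: "finite K" by (simp add: K_def)
  have KA: "k < A" if "k \<in> K" for k using that by (simp add: K_def)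
  have S0: "S m k \<ge> 0" if "m < B" "k \<in> K" for m k
    unfolding S_def using q0[OF divA[OF KA[OF that(2)]]] by simp
  have rows: "(\<Sum>k\<in>K. S m k * f (k div B)) = (\<Sum>k\<in>K. S m' k * f (k div B))"
    if "m < B" "m' < B" for m m' f
  proof -
    have "(\<Sum>k\<in>K. S m k * f (k div B)) = (\<Sum>b\<in>{b0..<A'}. (\<Sum>j<B. (\<beta> 0 (b * B + j))\<^sup>2) * (q b * f b))"
      if m: "m < B" for m
      unfolding sumK
    proof (rule sum.cong[OF refl])
      fix b assume b: "b \<in> {b0..<A'}"
      have "(\<Sum>k\<in>{b * B..<b * B + B}. S m k * f (k div B)) =
          (\<Sum>k\<in>{b * B..<b * B + B}. (\<beta> m k)\<^sup>2 * (q b * f b))"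
        by (intro sum.cong refl) (simp add: S_def blockdiv)
      also have "\<dots> = (\<Sum>j<B. (\<beta> m (b * B + j))\<^sup>2) * (q b * f b)"
        unfolding block_sum sum_distrib_right ..
      also have "(\<Sum>j<B. (\<beta> m (b * B + j))\<^sup>2) = (\<Sum>j<B. (\<beta> 0 (b * B + j))\<^sup>2)"
        using b m by (intro strongly_symmetric_row_sum[OF sym]) auto
      finally show "(\<Sum>k\<in>{b * B..<b * B + B}. S m k * f (k div B)) =
          (\<Sum>j<B. (\<beta> 0 (b * B + j))\<^sup>2) * (q b * f b)" .
    qed
    then show ?thesis using that by simp
  qed
  have cols: "(\<Sum>m<B. S m k) = (\<Sum>m<B. (\<beta> m (k div B * B))\<^sup>2) * q (k div B)" if k: "k \<in> K" for k
  proof -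
    have "(\<Sum>m<B. S m k) = (\<Sum>m<B. (\<beta> m (k div B * B + k mod B))\<^sup>2) * q (k div B)"
      unfolding S_def sum_distrib_right by simp
    also have "(\<Sum>m<B. (\<beta> m (k div B * B + k mod B))\<^sup>2) = (\<Sum>m<B. (\<beta> m (k div B * B))\<^sup>2)"
      using B by (intro strongly_symmetric_col_sum[OF sym divA[OF KA[OF k]]]) simp
    finally show ?thesis .
  qed
  have "\<exists>c\<ge>0. \<forall>\<epsilon> a v e. \<epsilon> \<ge> 0 \<longrightarrow>
      (\<forall>m<B. 0 \<le> a m \<and> a m \<le> \<gamma>) \<longrightarrow> (\<forall>m<B. \<forall>k\<in>K. \<bar>e m k\<bar> \<le> \<epsilon>) \<longrightarrow>
      (\<forall>m<B. \<gamma> - a m = (\<Sum>k\<in>K. S m k * (a m * v k + e m k))) \<longrightarrow>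
      (\<forall>k\<in>K. 1 - v k = (\<Sum>m<B. S m k * (a m * v k + e m k))) \<longrightarrow>
      (\<forall>m<B. \<forall>m'<B. \<bar>a m - a m'\<bar> \<le> c * \<epsilon>) \<and> (\<forall>k\<in>K. \<forall>k'\<in>K. k div B = k' div B \<longrightarrow> \<bar>v k - v k'\<bar> \<le> c * \<epsilon>)"
    (is "\<exists>c\<ge>0. ?stable c")
  proof (rule fixed_point_stability[OF B finK])
    show "S m k \<ge> 0" if "m < B" "k \<in> K" for m k using that by (rule S0)
    show "(\<Sum>k\<in>K. S m k * f (k div B)) = (\<Sum>k\<in>K. S m' k * f (k div B))" if "m < B" "m' < B" for m m' f
      using that by (rule rows)
    show "(\<Sum>m<B. S m k) = (\<lambda>b. (\<Sum>m<B. (\<beta> m (b * B))\<^sup>2) * q b) (k div B)" if "k \<in> K" for k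
      using cols[OF that] .
  qed (use \<gamma> in simp)
  then obtain c where c0': "c \<ge> 0" and stab: "?stable c" by blast
  \<comment> \<open>The tangent slopes differ by at most \<open>c\<close> times the error from a
    common value, for rows over all base stations and for columns within a block. The weights are
    the displacements \<open>ln (lam m)\<close> and \<open>\<tau> k - 1\<close>.\<close>
  define L where "L = (\<Sum>m<B. \<bar>ln (lam m)\<bar> * c) + (\<Sum>k\<in>K. \<bar>\<tau> k - 1\<bar> * c)"
  show ?thesis
  proof (rule that[of L])
    fix N M :: nat assume N: "N > 0" and M: "M > 0" and MN: "real M = \<gamma> * real N"
    interpret G: gaussian_block_matrix B A M N c0 "\<lambda>m k. \<beta> m k * sqrt (q (k div B) / real N)"
      using M N by unfold_locales
    define \<epsilon> where "\<epsilon> = sqrt (real A / real N)"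
    define a where "a m = G.mean (G.rowtr m) / real N" for m
    define v where "v k = G.mean (G.coltr k) / real N" for k
    define e where "e m k = (G.mean (\<lambda>\<omega>. G.rowtr m \<omega> * G.coltr k \<omega>) -
        G.mean (G.rowtr m) * G.mean (G.coltr k)) / (real N)\<^sup>2" for m k
    have Nr: "real N > 0" using N by simp
    have \<epsilon>0: "\<epsilon> \<ge> 0" by (simp add: \<epsilon>_def)
    have \<sigma>sq: "(\<beta> m k * sqrt (q (k div B) / real N))\<^sup>2 = S m k / real N" if "k \<in> K" for m k
      using q0[OF divA[OF KA[OF that]]] Nr by (simp add: S_def power_mult_distrib)
    have prod: "G.mean (\<lambda>\<omega>. G.rowtr m \<omega> * G.coltr k \<omega>) = (a m * v k + e m k) * (real N)\<^sup>2" for m k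
      using Nr by (simp add: a_def v_def e_def field_simps power2_eq_square)
    have a_bounds: "0 \<le> a m \<and> a m \<le> \<gamma>" if m: "m < B" for m
    proof -
      have "0 \<le> G.mean (G.rowtr m)" using G.rowtr_bounds[OF m] by (intro Bochner_Integration.integral_nonneg) auto
      moreover have "G.mean (G.rowtr m) \<le> (\<integral>\<omega>. real M \<partial>G.\<Omega>)"
        using G.rowtr_bounds[OF m] by (intro integral_mono G.integrable_rowtr m) auto
      ultimately show ?thesis using Nr MN by (simp add: a_def G.prob.prob_space divide_le_eq)
    qed
    have v_le: "v k \<le> 1" if k: "k \<in> K" for k
    proof -
      have k': "c0 \<le> k" "k < A" using k by (auto simp: K_def)
      have "G.mean (G.coltr k) \<le> (\<integral>\<omega>. real N \<partial>G.\<Omega>)"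
        using G.coltr_bounds[OF k'] by (intro integral_mono G.integrable_coltr k') auto
      then show ?thesis using Nr by (simp add: v_def G.prob.prob_space)
    qed
    have e_bound: "\<bar>e m k\<bar> \<le> \<epsilon>" if m: "m < B" and k: "k \<in> K" for m k
    proof -
      have k': "c0 \<le> k" "k < A" using k by (auto simp: K_def)
      have "\<bar>e m k\<bar> \<le> sqrt (real (A * N)) * real N / (real N)\<^sup>2"
        using divide_right_mono[OF G.covariance_bound[OF m k'], of "(real N)\<^sup>2"]
        by (simp add: e_def abs_divide)
      also have "real (A * N) = real A / real N * (real N)\<^sup>2" using Nr by (simp add: power2_eq_square)
      also have "sqrt (real A / real N * (real N)\<^sup>2) = \<epsilon> * real N" by (simp only: real_sqrt_mult real_sqrt_abs abs_of_nat \<epsilon>_def)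
      also have "\<epsilon> * real N * real N / (real N)\<^sup>2 = \<epsilon>" using Nr by (simp add: power2_eq_square)
      finally show ?thesis .
    qed
    have row: "\<gamma> - a m = (\<Sum>k\<in>K. S m k * (a m * v k + e m k))" if m: "m < B" for m
    proof -
      have "real M - G.mean (G.rowtr m) = (\<Sum>k\<in>K. S m k / real N * ((a m * v k + e m k) * (real N)\<^sup>2))"
        unfolding G.row_equation[OF m] K_def[symmetric] prod by (intro sum.cong refl) (simp only: \<sigma>sq)
      also have "\<dots> = (\<Sum>k\<in>K. S m k * (a m * v k + e m k)) * real N"
        unfolding sum_distrib_right using Nr by (intro sum.cong refl) (simp add: power2_eq_square)
      finally have "(real M - G.mean (G.rowtr m)) / real N = (\<Sum>k\<in>K. S m k * (a m * v k + e m k))"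
        using Nr by simp
      then show ?thesis using Nr MN by (simp add: a_def diff_divide_distrib)
    qed
    have col: "1 - v k = (\<Sum>m<B. S m k * (a m * v k + e m k))" if k: "k \<in> K" for k
    proof -
      have k': "c0 \<le> k" "k < A" using k by (auto simp: K_def)
      have "real N - G.mean (G.coltr k) = (\<Sum>m<B. S m k / real N * ((a m * v k + e m k) * (real N)\<^sup>2))"
        unfolding G.col_equation[OF k'] prod \<sigma>sq[OF k] ..
      also have "\<dots> = (\<Sum>m<B. S m k * (a m * v k + e m k)) * real N"
        unfolding sum_distrib_right using Nr by (intro sum.cong refl) (simp add: power2_eq_square)
      finally have "(real N - G.mean (G.coltr k)) / real N = (\<Sum>m<B. S m k * (a m * v k + e m k))"
        using Nr by simp
      then show ?thesis using Nr by (simp add: v_def diff_divide_distrib)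
    qed
    have close: "(\<forall>m<B. \<forall>m'<B. \<bar>a m - a m'\<bar> \<le> c * \<epsilon>) \<and>
        (\<forall>k\<in>K. \<forall>k'\<in>K. k div B = k' div B \<longrightarrow> \<bar>v k - v k'\<bar> \<le> c * \<epsilon>)"
   
    proof -
      have h1: "\<forall>m<B. 0 \<le> a m \<and> a m \<le> \<gamma>" using a_bounds by blast
      have h2: "\<forall>m<B. \<forall>k\<in>K. \<bar>e m k\<bar> \<le> \<epsilon>" using e_bound by blast
      have h3: "\<forall>m<B. \<gamma> - a m = (\<Sum>k\<in>K. S m k * (a m * v k + e m k))" using row by blast
      have h4: "\<forall>k\<in>K. 1 - v k = (\<Sum>m<B. S m k * (a m * v k + e m k))" using col by blast
      show ?thesis
        by (rule stab[THEN spec[of _ \<epsilon>], THEN spec[of _ a], THEN spec[of _ v], THEN spec[of _ e],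
              THEN mp, THEN mp, THEN mp, THEN mp, THEN mp, OF \<epsilon>0 h1 h2 h3 h4])
    qed
    have ce: "0 \<le> c * \<epsilon>" using c0' \<epsilon>0 by simp
    \<comment> \<open>Each slope is the common value \<open>\<gamma> - a 0\<close> plus a deviation
      of size \<open>c * \<epsilon>\<close>. The common value is nonnegative and multiplies minus
      the sum of the \<open>ln (lam m)\<close>, which is nonnegative by the normalisation of
      \<open>lam\<close>.\<close>
    have dev_rows: "- (\<Sum>m<B. \<bar>ln (lam m)\<bar> * c) * \<epsilon> \<le> (\<Sum>m<B. ln (1 / lam m) * (\<gamma> - a m))"
    proof -
      have "(\<Sum>m<B. ln (lam m)) \<le> (\<Sum>m<B. lam m - 1)" using lam by (intro sum_mono ln_le_minus_one) auto
      then have "(\<Sum>m<B. ln (lam m)) \<le> 0" using lam_sum by (simp add: sum_subtractf)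
      then have 1: "(\<Sum>m<B. ln (lam m)) * (\<gamma> - a 0) \<le> 0"
        using a_bounds[OF B] by (intro mult_nonpos_nonneg) auto
      have "(\<Sum>m<B. ln (lam m) * (a 0 - a m)) \<le> (\<Sum>m<B. \<bar>ln (lam m)\<bar> * (c * \<epsilon>))"
      proof (rule sum_mono)
        fix m assume "m \<in> {..<B}"
        then have "\<bar>a 0 - a m\<bar> \<le> c * \<epsilon>" using close B by auto
        then have "\<bar>ln (lam m)\<bar> * \<bar>a 0 - a m\<bar> \<le> \<bar>ln (lam m)\<bar> * (c * \<epsilon>)" by (rule mult_left_mono) simp
        then show "ln (lam m) * (a 0 - a m) \<le> \<bar>ln (lam m)\<bar> * (c * \<epsilon>)"
          unfolding abs_mult[symmetric] using abs_ge_self order_trans by blast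
      qed
      moreover have "(\<Sum>m<B. ln (1 / lam m) * (\<gamma> - a m)) =
          - ((\<Sum>m<B. ln (lam m)) * (\<gamma> - a 0)) - (\<Sum>m<B. ln (lam m) * (a 0 - a m))"
        unfolding sum_distrib_right sum_negf[symmetric] sum_subtractf[symmetric]
        using lam by (intro sum.cong refl) (auto simp: ln_div algebra_simps)
      moreover have "(\<Sum>m<B. \<bar>ln (lam m)\<bar> * (c * \<epsilon>)) = (\<Sum>m<B. \<bar>ln (lam m)\<bar> * c) * \<epsilon>"
        by (simp add: sum_distrib_right mult.assoc)
      ultimately show ?thesis using 1 by linarith
    qed
    have dev_cols: "(\<Sum>k\<in>K. (\<tau> k - 1) * (1 - v k)) \<le> (\<Sum>k\<in>K. \<bar>\<tau> k - 1\<bar> * c) * \<epsilon>"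
    proof -
      have "(\<Sum>k\<in>{b * B..<b * B + B}. (\<tau> k - 1) * (1 - v k)) \<le> (\<Sum>k\<in>{b * B..<b * B + B}. \<bar>\<tau> k - 1\<bar> * (c * \<epsilon>))"
        if b: "b \<in> {b0..<A'}" for b
      proof -
        have inK: "k \<in> K" if "k \<in> {b * B..<b * B + B}" for k
        proof -
          have "b0 * B \<le> b * B" using b by (intro mult_le_mono1) simp
          then have "c0 \<le> k" using that unfolding c0_def by (meson atLeastLessThan_iff order_trans)
          moreover have "k < A" using bB[of b "k - b * B"] b that by auto
          ultimately show ?thesis unfolding K_def by simp
        qed
        show ?thesis
        proof (cases "q b = 0")
          \<comment> \<open>In a block without power every \<open>\<tau> k\<close> is 0, so the
            displacements do not sum to 0. The terms are nonpositive instead, because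
            \<open>v k\<close> is at most 1.\<close>
          case True
          show ?thesis
          proof (rule sum_mono)
            fix k assume k: "k \<in> {b * B..<b * B + B}"
            then have "\<tau> k = 0" by (simp add: \<tau>_def blockdiv True)
            then show "(\<tau> k - 1) * (1 - v k) \<le> \<bar>\<tau> k - 1\<bar> * (c * \<epsilon>)"
              using v_le[OF inK[OF k]] ce by simp
          qed
        next
          case False
          have "(\<Sum>k\<in>{b * B..<b * B + B}. \<tau> k) = (\<Sum>k\<in>{b * B..<b * B + B}. Q k / q b)"
            by (intro sum.cong refl) (simp add: \<tau>_def blockdiv)
          also have "\<dots> = (\<Sum>j<B. Q (b * B + j)) / q b" unfolding block_sum sum_divide_distrib ..
          also have "\<dots> = real B" using False B by (simp add: q_def)
          finally have zero: "(\<Sum>k\<in>{b * B..<b * B + B}. \<tau> k - 1) = 0" by (simp add: sum_subtractf)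
          \<comment> \<open>The displacements \<open>\<tau> k - 1\<close> sum to 0 over the block,
            so the slope at one reference column group may be subtracted.\<close>
          let ?k0 = "b * B"
          have "(\<Sum>k\<in>{b * B..<b * B + B}. (\<tau> k - 1) * (1 - v k)) =
              (\<Sum>k\<in>{b * B..<b * B + B}. (\<tau> k - 1) * (v ?k0 - v k)) + (\<Sum>k\<in>{b * B..<b * B + B}. \<tau> k - 1) * (1 - v ?k0)"
            unfolding sum_distrib_right sum.distrib[symmetric] by (intro sum.cong refl) (simp add: algebra_simps)
          also have "\<dots> = (\<Sum>k\<in>{b * B..<b * B + B}. (\<tau> k - 1) * (v ?k0 - v k))" unfolding zero by simp
          also have "\<dots> \<le> (\<Sum>k\<in>{b * B..<b * B + B}. \<bar>\<tau> k - 1\<bar> * (c * \<epsilon>))"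
          proof (rule sum_mono)
            fix k assume k: "k \<in> {b * B..<b * B + B}"
            have k0: "?k0 \<in> {b * B..<b * B + B}" using B by simp
            have "\<bar>v ?k0 - v k\<bar> \<le> c * \<epsilon>" using close inK[OF k0] inK[OF k] blockdiv[OF k0] blockdiv[OF k] by metis
            then have "\<bar>\<tau> k - 1\<bar> * \<bar>v ?k0 - v k\<bar> \<le> \<bar>\<tau> k - 1\<bar> * (c * \<epsilon>)" by (rule mult_left_mono) simp
            then show "(\<tau> k - 1) * (v ?k0 - v k) \<le> \<bar>\<tau> k - 1\<bar> * (c * \<epsilon>)"
              unfolding abs_mult[symmetric] using abs_ge_self order_trans by blast
          qed
          finally show ?thesis .
        qed
      qed
      then have "(\<Sum>k\<in>K. (\<tau> k - 1) * (1 - v k)) \<le> (\<Sum>k\<in>K. \<bar>\<tau> k - 1\<bar> * (c * \<epsilon>))"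
        unfolding sumK by (rule sum_mono)
      then show ?thesis by (simp add: sum_distrib_right mult.assoc)
    qed
    have avA: "block_average B Q k \<ge> 0" if "k < A" for k unfolding av using q0 divA that by blast
    have le1: "G.mean (G.lndet (\<lambda>_. 1)) + (\<Sum>m<B. ln (1 / lam m) * (real M - G.mean (G.rowtr m)))
        \<le> (\<integral>\<omega>. logdet \<beta> B A M N lam (block_average B Q) c0 \<omega> \<partial>G.\<Omega>)"
    proof -
      have "logdet \<beta> B A M N lam (block_average B Q) c0 = G.lndet (\<lambda>m. 1 / lam m)"
        using logdet_eq_lndet[of M N B lam A "block_average B Q" \<beta> c0] M N lam avA by (simp add: av)
      then show ?thesis using lam by (simp only: G.expectation_lndet_ge zero_less_divide_1_iff)
    qed
    have le2: "(\<integral>\<omega>. logdet \<beta> B A M N (\<lambda>_. 1) Q c0 \<omega> \<partial>G.\<Omega>) \<le>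
        G.mean (G.lndet (\<lambda>_. 1)) + (\<Sum>k\<in>K. (\<tau> k - 1) * (real N - G.mean (G.coltr k)))"
    proof -
      have eq: "logdet \<beta> B A M N (\<lambda>_. 1) Q c0 =
          gaussian_block_matrix.lndet B A M N c0 (\<lambda>m k. \<beta> m k * sqrt (Q k / real N)) (\<lambda>_. 1)"
        using logdet_eq_lndet[of M N B "\<lambda>_. 1" A Q \<beta> c0] M N Q by simp
      show ?thesis unfolding eq K_def
      proof (rule G.expectation_lndet_columns_le)
        fix k assume k: "c0 \<le> k" "k < A"
        show "\<tau> k \<ge> 0" unfolding \<tau>_def using Q[OF k(2)] q0[OF divA[OF k(2)]] by simp
      next
        fix m k assume k: "c0 \<le> k" "k < A"
        have "Q k = \<tau> k * q (k div B)"
        proof (cases "q (k div B) = 0")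
          case True
          then have "(\<Sum>j<B. Q (k div B * B + j)) = 0" using B by (simp add: q_def)
          then have "\<forall>j\<in>{..<B}. Q (k div B * B + j) = 0"
            using Q bB[OF divA[OF k(2)]] by (subst (asm) sum_nonneg_eq_0_iff) auto
          then have "Q (k div B * B + k mod B) = 0" using B by (metis lessThan_iff mod_less_divisor)
          then show ?thesis using True by simp
        qed (simp add: \<tau>_def)
        then show "\<beta> m k * sqrt (Q k / real N) = sqrt (\<tau> k) * (\<beta> m k * sqrt (q (k div B) / real N))"
          by (simp add: real_sqrt_mult real_sqrt_divide)
      qed
    qed
    have rt: "G.mean (G.rowtr m) = a m * real N" for m using Nr by (simp add: a_def)
    have ct: "G.mean (G.coltr k) = v k * real N" for k using Nr by (simp add: v_def)
    have "(\<Sum>m<B. ln (1 / lam m) * (real M - G.mean (G.rowtr m))) = (\<Sum>m<B. ln (1 / lam m) * (\<gamma> - a m)) * real N"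
      unfolding rt MN sum_distrib_right by (intro sum.cong refl) (simp add: algebra_simps)
    moreover have "(\<Sum>k\<in>K. (\<tau> k - 1) * (real N - G.mean (G.coltr k))) = (\<Sum>k\<in>K. (\<tau> k - 1) * (1 - v k)) * real N"
      unfolding ct sum_distrib_right by (intro sum.cong refl) (simp add: algebra_simps)
    moreover have "(\<Sum>m<B. ln (1 / lam m) * (\<gamma> - a m)) * real N \<ge> - (\<Sum>m<B. \<bar>ln (lam m)\<bar> * c) * \<epsilon> * real N"
      using dev_rows Nr by (intro mult_right_mono) auto
    moreover have "(\<Sum>k\<in>K. (\<tau> k - 1) * (1 - v k)) * real N \<le> (\<Sum>k\<in>K. \<bar>\<tau> k - 1\<bar> * c) * \<epsilon> * real N"
      using dev_cols Nr by (intro mult_right_mono) auto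
    moreover have "L * \<epsilon> * real N = (\<Sum>m<B. \<bar>ln (lam m)\<bar> * c) * \<epsilon> * real N + (\<Sum>k\<in>K. \<bar>\<tau> k - 1\<bar> * c) * \<epsilon> * real N"
      by (simp add: L_def algebra_simps)
    ultimately have "(\<integral>\<omega>. logdet \<beta> B A M N (\<lambda>_. 1) Q c0 \<omega> \<partial>G.\<Omega>) \<le>
        (\<integral>\<omega>. logdet \<beta> B A M N lam (block_average B Q) c0 \<omega> \<partial>G.\<Omega>) + L * \<epsilon> * real N"
      using le1 le2 by linarith
    from divide_right_mono[OF this, of "real N"]
    show "mean_rate \<beta> B A M N (\<lambda>_. 1) Q (b0 * B) \<le>
        mean_rate \<beta> B A M N lam (block_average B Q) (b0 * B) + L * sqrt (real A / real N)"
      using Nr unfolding c0_def \<epsilon>_def mean_rate_def by (simp add: add_divide_distrib)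
  qed
qed

text \<open>The right side is free of \<open>N\<close>, so the bound passes to the limit and makes
  the set under the supremum in \<open>Gval\<close> bounded above.\<close>

lemma mean_rate_le:
  assumes M: "M > 0" and N: "N > 0" and MN: "real M = \<gamma> * real N"
    and lam: "\<And>m. m < B \<Longrightarrow> lam m > 0" and Q: "\<And>k. k < A \<Longrightarrow> 0 \<le> Q k \<and> Q k \<le> P"
    and \<gamma>: "\<gamma> > 0"
  shows "mean_rate \<beta> B A M N lam Q c0 \<le>
    \<gamma> * (\<Sum>k\<in>{c0..<A}. \<Sum>m<B. (\<beta> m k)\<^sup>2 * P / lam m) * (\<integral>z. (cmod z)\<^sup>2 \<partial>CN01)"
proof -
  interpret G: gaussian_block_matrix B A M N c0 "\<lambda>m k. \<beta> m k * sqrt (Q k / real N)"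
    using M N by unfold_locales
  have Nr: "real N > 0" using N by simp
  let ?E = "\<integral>z. (cmod z)\<^sup>2 \<partial>CN01"
  have "(\<integral>\<omega>. logdet \<beta> B A M N lam Q c0 \<omega> \<partial>G.\<Omega>) \<le>
      (\<Sum>k\<in>{c0..<A}. \<Sum>m<B. real N * real M * (1 / lam m * (\<beta> m k * sqrt (Q k / real N))\<^sup>2)) * ?E"
  proof -
    have "logdet \<beta> B A M N lam Q c0 = G.lndet (\<lambda>m. 1 / lam m)"
      using logdet_eq_lndet[of M N B lam A Q \<beta> c0] M N lam Q by blast
    then show ?thesis using G.expectation_lndet_le[of "\<lambda>m. 1 / lam m"] lam by (simp add: less_imp_le)
  qed
  also have "\<dots> \<le> (\<Sum>k\<in>{c0..<A}. \<Sum>m<B. real N * (\<gamma> * ((\<beta> m k)\<^sup>2 * P / lam m))) * ?E"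
  proof (intro mult_right_mono sum_mono)
    fix k m assume k: "k \<in> {c0..<A}" and m: "m \<in> {..<B}"
    have "(\<beta> m k * sqrt (Q k / real N))\<^sup>2 = (\<beta> m k)\<^sup>2 * Q k / real N"
      using Q[of k] k Nr by (simp add: power_mult_distrib)
    then have "real N * real M * (1 / lam m * (\<beta> m k * sqrt (Q k / real N))\<^sup>2) = real N * (\<gamma> * ((\<beta> m k)\<^sup>2 * Q k / lam m))"
      using Nr unfolding MN by simp
    also have "\<dots> \<le> real N * (\<gamma> * ((\<beta> m k)\<^sup>2 * P / lam m))"
      using Q[of k] k lam[of m] m Nr \<gamma> by (intro mult_left_mono divide_right_mono) auto
    finally show "real N * real M * (1 / lam m * (\<beta> m k * sqrt (Q k / real N))\<^sup>2) \<le> real N * (\<gamma> * ((\<beta> m k)\<^sup>2 * P / lam m))" .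
  qed simp
  also have "\<dots> = real N * (\<gamma> * (\<Sum>k\<in>{c0..<A}. \<Sum>m<B. (\<beta> m k)\<^sup>2 * P / lam m) * ?E)"
    by (simp add: sum_distrib_left mult.assoc)
  finally show ?thesis using Nr by (simp add: mean_rate_def divide_le_eq mult.commute)
qed

section \<open>Passage to the limit along the admissible N\<close>

lemma eventually_Nfilter:
  assumes "\<And>N. N > 0 \<Longrightarrow> \<gamma> * real N \<in> \<nat> \<Longrightarrow> R N"
  shows "eventually R (Nfilter \<gamma>)"
  unfolding Nfilter_def eventually_inf_principal
  using eventually_gt_at_top[of 0] by eventually_elim (use assms in auto)

lemma Nfilter_neq_bot:
  assumes "\<exists>\<^sub>\<infinity>N. \<gamma> * real N \<in> \<nat>"
  shows "Nfilter \<gamma> \<noteq> bot"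
proof
  assume "Nfilter \<gamma> = bot"
  then have "eventually (\<lambda>_. False) (Nfilter \<gamma>)" by simp
  then have "eventually (\<lambda>N. \<not> \<gamma> * real N \<in> \<nat>) sequentially"
    unfolding Nfilter_def eventually_inf_principal by simp
  then have "eventually (\<lambda>N. \<not> \<gamma> * real N \<in> \<nat>) cofinite" by (simp add: cofinite_eq_sequentially)
  then show False using assms by (simp add: frequently_def)
qed

theorem theorem2:
  fixes B A :: nat and \<gamma> P :: real and \<beta> :: "nat \<Rightarrow> nat \<Rightarrow> real"
    and W' :: "nat \<Rightarrow> real"
    and Finf :: "(nat \<Rightarrow> real) \<Rightarrow> (nat \<Rightarrow> real) \<Rightarrow> real"
  assumes "B > 0" and "B dvd A" and "A > 0"
    and "\<gamma> > 0" and "\<exists>\<^sub>\<infinity>N. \<gamma> * real N \<in> \<nat>"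
    and "P > 0"
    and "\<forall>m<B. \<forall>k<A. \<beta> m k > 0"
    and "strongly_symmetric_blocks B (A div B) \<beta>"
    and "0 \<le> W' 1" and "\<forall>b. 1 \<le> b \<and> b < A div B \<longrightarrow> W' b \<le> W' (b + 1)"
    and "\<forall>lam Q. (\<forall>m<B. lam m > 0) \<and> (\<forall>k<A. Q k \<ge> 0) \<longrightarrow>
           ((\<lambda>N. FN \<gamma> B A \<beta> W' lam Q N) \<longlongrightarrow> Finf lam Q) (Nfilter \<gamma>)"
  shows "\<forall>lam. (\<forall>m<B. lam m > 0) \<and> (\<Sum>m<B. lam m) / real B = 1 \<longrightarrow>
           Gval Finf B A P (\<lambda>_. 1) \<le> Gval Finf B A P lam"
proof (intro allI impI, elim conjE)
  fix lam :: "nat \<Rightarrow> real"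
  assume lam: "\<forall>m<B. lam m > 0" and "(\<Sum>m<B. lam m) / real B = 1"
  then have lam_sum: "(\<Sum>m<B. lam m) = real B" using assms(1) by simp
  have A: "A = A div B * B" using assms(2) by simp
  have bot: "Nfilter \<gamma> \<noteq> bot" by (rule Nfilter_neq_bot[OF assms(5)])
  define \<Delta> where "\<Delta> b = W' b - (if b = 1 then 0 else W' (b - 1))" for b
  \<comment> \<open>Nondecreasing weights make the increments nonnegative, so the comparisons for
    the single \<open>b\<close> may be added up. The case \<open>b = 1\<close> encodes that the
    weight before the first one is 0.\<close>
  have \<Delta>: "\<Delta> b \<ge> 0" if "b \<in> {1..A div B}" for b
  proof (cases "b = 1")
    case False
    then have "1 \<le> b - 1" "b - 1 < A div B" "b - 1 + 1 = b" using that by auto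
    then show ?thesis using assms(10) False unfolding \<Delta>_def by (metis diff_ge_0_iff_ge)
  next
    case True
    then show ?thesis using assms(9) unfolding \<Delta>_def by simp
  qed
  \<comment> \<open>Along the filter \<open>\<gamma> * real N\<close> is an integer, so the floor in
    \<open>ant\<close> is exact; \<open>N > 0\<close> guarantees at least one antenna.\<close>
  have ant: "real (ant \<gamma> N) = \<gamma> * real N \<and> ant \<gamma> N > 0" if N: "N > 0" "\<gamma> * real N \<in> \<nat>" for N
  proof -
    obtain M :: nat where M: "\<gamma> * real N = real M" using N(2) by (auto elim: Nats_cases)
    have "\<gamma> * real N > 0" using assms(4) N(1) by simp
    then show ?thesis unfolding ant_def M by simp
  qed
  define I where "I lam Q b N = mean_rate \<beta> B A (ant \<gamma> N) N lam Q ((b - 1) * B)" for lam Q b N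
  have FN: "FN \<gamma> B A \<beta> W' lam Q N = (\<Sum>b\<in>{1..A div B}. \<Delta> b * I lam Q b N)" for lam Q N
    unfolding FN_def I_def mean_rate_def \<Delta>_def by (intro sum.cong refl) simp
  let ?feas = "{Q. (\<forall>k<A. 0 \<le> Q k) \<and> (\<Sum>k<A. Q k) \<le> real B * P}"
  have feas: "(\<Sum>m<B. (\<lambda>_. 1) m * P) = real B * P" "(\<Sum>m<B. lam m * P) = real B * P"
    by (simp_all add: sum_distrib_right[symmetric] lam_sum)
  \<comment> \<open>A real supremum dominates its elements only for a set bounded above; this is
    used on the \<open>lam\<close> side, where the averaged powers are inserted.\<close>
  have bdd: "bdd_above (Finf lam ` ?feas)"
  proof -
    define U where "U b = \<gamma> * (\<Sum>k\<in>{(b - 1) * B..<A}. \<Sum>m<B. (\<beta> m k)\<^sup>2 * (real B * P) / lam m) *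
        (\<integral>z. (cmod z)\<^sup>2 \<partial>CN01)" for b
    have "Finf lam Q \<le> (\<Sum>b\<in>{1..A div B}. \<Delta> b * U b)" if Q: "Q \<in> ?feas" for Q
    proof (rule tendsto_upperbound[OF _ _ bot])
      show "((\<lambda>N. FN \<gamma> B A \<beta> W' lam Q N) \<longlongrightarrow> Finf lam Q) (Nfilter \<gamma>)"
        using assms(11) lam Q by blast
      have Qk: "0 \<le> Q k \<and> Q k \<le> real B * P" if "k < A" for k
      proof -
        have "Q k \<le> (\<Sum>k<A. Q k)" by (rule member_le_sum) (use that Q in auto)
        then show ?thesis using Q that by auto
      qed
      show "eventually (\<lambda>N. FN \<gamma> B A \<beta> W' lam Q N \<le> (\<Sum>b\<in>{1..A div B}. \<Delta> b * U b)) (Nfilter \<gamma>)"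
      proof (rule eventually_Nfilter)
        fix N assume N: "N > 0" "\<gamma> * real N \<in> \<nat>"
        have "I lam Q b N \<le> U b" for b
          unfolding I_def U_def using ant[OF N] N lam Qk assms(4) by (intro mean_rate_le) auto
        then show "FN \<gamma> B A \<beta> W' lam Q N \<le> (\<Sum>b\<in>{1..A div B}. \<Delta> b * U b)"
          unfolding FN using \<Delta> by (intro sum_mono mult_left_mono) auto
      qed
    qed
    then show ?thesis by (rule bdd_aboveI2)
  qed
  have avg: "block_average B Q k \<ge> 0" if "Q \<in> ?feas" "k < A" for Q k
    using that A by (intro block_average_nonneg[of "A div B"]) auto
  \<comment> \<open>Averaging preserves the total power, and both budgets equal
    \<open>real B * P\<close>, so powers feasible for \<open>lam = 1\<close> have an average
    feasible for \<open>lam\<close>.\<close>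
  have avg_feas: "block_average B Q \<in> ?feas" if Q: "Q \<in> ?feas" for Q
    using avg[OF Q] Q sum_block_average[OF assms(1), of Q "A div B"] A by auto
  have compare: "Finf (\<lambda>_. 1) Q \<le> Finf lam (block_average B Q)" if Q: "Q \<in> ?feas" for Q
  proof -
    have Q0: "Q k \<ge> 0" if "k < A" for k using Q that by auto
    have "\<exists>L. \<forall>N M. N > 0 \<longrightarrow> M > 0 \<longrightarrow> real M = \<gamma> * real N \<longrightarrow>
        mean_rate \<beta> B A M N (\<lambda>_. 1) Q ((b - 1) * B) \<le>
        mean_rate \<beta> B A M N lam (block_average B Q) ((b - 1) * B)
          + L * sqrt (real A / real N)" if b: "b \<in> {1..A div B}" for b
    proof -
      have "b - 1 < A div B" using b by auto
      from block_comparison[OF assms(1) A this assms(8,4), of lam Q] lam lam_sum Q0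
      show ?thesis by metis
    qed
    then obtain L where L: "\<And>b N M. b \<in> {1..A div B} \<Longrightarrow> N > 0 \<Longrightarrow> M > 0 \<Longrightarrow> real M = \<gamma> * real N \<Longrightarrow>
        mean_rate \<beta> B A M N (\<lambda>_. 1) Q ((b - 1) * B) \<le>
        mean_rate \<beta> B A M N lam (block_average B Q) ((b - 1) * B)
          + L b * sqrt (real A / real N)" by metis
    let ?E = "\<lambda>N. (\<Sum>b\<in>{1..A div B}. \<Delta> b * L b) * sqrt (real A / real N)"
    have ev: "eventually (\<lambda>N. FN \<gamma> B A \<beta> W' (\<lambda>_. 1) Q N \<le> FN \<gamma> B A \<beta> W' lam (block_average B Q) N + ?E N) (Nfilter \<gamma>)"
    proof (rule eventually_Nfilter)
      fix N assume N: "N > 0" "\<gamma> * real N \<in> \<nat>"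
      have "(\<Sum>b\<in>{1..A div B}. \<Delta> b * I (\<lambda>_. 1) Q b N) \<le>
          (\<Sum>b\<in>{1..A div B}. \<Delta> b * (I lam (block_average B Q) b N + L b * sqrt (real A / real N)))"
        unfolding I_def using L ant[OF N] N \<Delta> by (intro sum_mono mult_left_mono) auto
      then show "FN \<gamma> B A \<beta> W' (\<lambda>_. 1) Q N \<le> FN \<gamma> B A \<beta> W' lam (block_average B Q) N + ?E N"
        unfolding FN by (simp add: distrib_left sum.distrib sum_distrib_right mult.assoc)
    qed
    have "((\<lambda>N. sqrt (real A / real N)) \<longlongrightarrow> 0) sequentially"
      using tendsto_real_sqrt[OF lim_const_over_n[of "real A"]] by simp
    then have "(?E \<longlongrightarrow> 0) sequentially" by (rule tendsto_mult_right_zero)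
    then have E: "(?E \<longlongrightarrow> 0) (Nfilter \<gamma>)"
      by (rule tendsto_mono[rotated]) (simp add: Nfilter_def)
    have "((\<lambda>N. FN \<gamma> B A \<beta> W' lam (block_average B Q) N + ?E N) \<longlongrightarrow> Finf lam (block_average B Q) + 0) (Nfilter \<gamma>)"
      using assms(11) lam avg[OF Q] by (intro tendsto_add E) blast
    moreover have "((\<lambda>N. FN \<gamma> B A \<beta> W' (\<lambda>_. 1) Q N) \<longlongrightarrow> Finf (\<lambda>_. 1) Q) (Nfilter \<gamma>)"
      using assms(11) Q0 by simp
    ultimately have "Finf (\<lambda>_. 1) Q \<le> Finf lam (block_average B Q) + 0"
      using tendsto_le[OF bot] ev by blast
    then show ?thesis by simp
  qed
  show "Gval Finf B A P (\<lambda>_. 1) \<le> Gval Finf B A P lam"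
    unfolding Gval_def feas
  proof (rule cSUP_least)
    show "?feas \<noteq> {}"
      using assms(6) by (auto intro!: exI[of _ "\<lambda>_. 0"])
    fix Q assume Q: "Q \<in> ?feas"
    have "Finf lam (block_average B Q) \<le> (SUP Q\<in>?feas. Finf lam Q)"
      by (rule cSUP_upper[OF avg_feas[OF Q] bdd])
    then show "Finf (\<lambda>_. 1) Q \<le> (SUP Q\<in>?feas. Finf lam Q)" using compare[OF Q] by linarith
  qed
qed

end
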